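(* Let $(M,J)$ be a compact complex manifold of complex dimension $n$ with a pluriclosed metric $\omega$ (i.e. $\omega$ is the fundamental form of a Hermitian metric and $\partial\bar\partial\omega=0$). (a) If $\rho^{1,1}(\omega)$ is strictly positive definite, then the Dolbeault cohomology $H^{p,0}_{\bar\partial}(M;\mathbb{C})$ is trivial for $1\le p\le n$. (b) If the Bismut scalar curvature $r=\operatorname{tr}_\omega\rho^{1,1}(\omega)$ is positive everywhere, then $H^{n,0}_{\bar\partial}(M;\mathbb{C})$ is trivial.
   Context: For a Hermitian metric $g$, $\omega(\cdot,\cdot)=g(J\cdot,\cdot)$, locally $\omega=\sqrt{-1}\,g_{i\bar j}\,dz^i\wedge d\bar z^j$. $\rho^{1,1}(\omega)=-\partial\partial^*\omega-\bar\partial\bar\partial^*\omega-\sqrt{-1}\,\partial\bar\partial\log\det g$ is the $(1,1)$-part of the Ricci form of the Bismut connection (the unique connection preserving $g$ and $J$ with totally skew-symmetric torsion); $\partial^*,\bar\partial^*$ are formal $L^2$-adjoints. Writing $\rho^{1,1}=\sqrt{-1}\,P_{i\bar j}\,dz^i\wedge d\bar z^j$, positive definiteness of $\rho^{1,1}$ means that the Hermitian matrix $(P_{i\bar j})$ is positive definite at every point, and $\operatorname{tr}_\omega\rho^{1,1}=g^{\bar j i}P_{i\bar j}$. *)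

theory Defs
  imports "HOL-Analysis.Analysis" "HOL-Combinatorics.Combinatorics"
begin

section \<open>Calculus on open subsets of complex coordinate space\<close>

text \<open>Real differentiability classes on an open set, by iterated directional derivatives.\<close>

primrec Ck_on :: "nat \<Rightarrow> 'a::real_normed_vector set \<Rightarrow> ('a \<Rightarrow> 'b::real_normed_vector) \<Rightarrow> bool" where
  "Ck_on 0 S f \<longleftrightarrow> continuous_on S f"
| "Ck_on (Suc k) S f \<longleftrightarrow>
     (\<forall>x\<in>S. f differentiable (at x)) \<and>
     (\<forall>v. Ck_on k S (\<lambda>x. frechet_derivative f (at x) v))"

definition smooth_on :: "'a::real_normed_vector set \<Rightarrow> ('a \<Rightarrow> 'b::real_normed_vector) \<Rightarrow> bool" where
  "smooth_on S f \<longleftrightarrow> (\<forall>k. Ck_on k S f)"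

definition holomorphic_map_on :: "(complex^'n::finite) set \<Rightarrow> (complex^'n \<Rightarrow> complex^'m) \<Rightarrow> bool" where
  "holomorphic_map_on S f \<longleftrightarrow>
     (\<forall>z\<in>S. \<exists>D. (f has_derivative D) (at z) \<and> (\<forall>c v. D (c *s v) = c *s D v))"

text \<open>The Wirtinger derivatives with respect to \<open>z\<^sub>i\<close> and its conjugate; \<open>axis i 1\<close> and
  \<open>axis i \<i>\<close> are the real coordinate directions \<open>x\<^sub>i\<close> and \<open>y\<^sub>i\<close>.\<close>

definition dz :: "'n::finite \<Rightarrow> (complex^'n \<Rightarrow> complex) \<Rightarrow> complex^'n \<Rightarrow> complex" where
  "dz i f z = (frechet_derivative f (at z) (axis i 1)
               - \<i> * frechet_derivative f (at z) (axis i \<i>)) / 2"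

definition dzbar :: "'n::finite \<Rightarrow> (complex^'n \<Rightarrow> complex) \<Rightarrow> complex^'n \<Rightarrow> complex" where
  "dzbar i f z = (frechet_derivative f (at z) (axis i 1)
                  + \<i> * frechet_derivative f (at z) (axis i \<i>)) / 2"

section \<open>Differential forms in one coordinate domain\<close>

text \<open>A form is given by its components: \<open>a z [i\<^sub>1,\<dots>,i\<^sub>p] [j\<^sub>1,\<dots>,j\<^sub>q]\<close> stands for
  the alternating coefficient in
  \[ a = \frac{1}{p!\,q!} \sum a_{i_1 \dots i_p \bar j_1 \dots \bar j_q}\,
       dz^{i_1} \wedge \dots \wedge dz^{i_p} \wedge d\bar z^{j_1} \wedge \dots \wedge d\bar z^{j_q}. \]
  Components of any other bidegree, and values off the domain, are required to be zero, so that
  equality of functions is equality of forms.\<close>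

type_synonym 'n lform = "complex^'n \<Rightarrow> 'n list \<Rightarrow> 'n list \<Rightarrow> complex"

definition local_form :: "(complex^'n::finite) set \<Rightarrow> nat \<Rightarrow> nat \<Rightarrow> 'n lform \<Rightarrow> bool" where
  "local_form W p q a \<longleftrightarrow>
     (\<forall>I J. smooth_on W (\<lambda>z. a z I J)) \<and>
     (\<forall>z I J. z \<notin> W \<or> length I \<noteq> p \<or> length J \<noteq> q \<longrightarrow> a z I J = 0) \<and>
     (\<forall>z I J \<sigma>. \<sigma> permutes {..<length I} \<longrightarrow>
        a z (permute_list \<sigma> I) J = of_int (sign \<sigma>) * a z I J) \<and>
     (\<forall>z I J \<sigma>. \<sigma> permutes {..<length J} \<longrightarrow>
        a z I (permute_list \<sigma> J) = of_int (sign \<sigma>) * a z I J)"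

definition remove_nth :: "nat \<Rightarrow> 'a list \<Rightarrow> 'a list" where
  "remove_nth k xs = take k xs @ drop (Suc k) xs"

definition del :: "'n::finite lform \<Rightarrow> 'n lform" where
  "del a = (\<lambda>z I J. \<Sum>k<length I. (-1)^k * dz (I ! k) (\<lambda>w. a w (remove_nth k I) J) z)"

text \<open>The sign \<open>(-1)^length I\<close> comes from moving the new \<open>d\<bar>z\<close> factor past the \<open>dz\<close> factors.\<close>

definition delbar :: "'n::finite lform \<Rightarrow> 'n lform" where
  "delbar a = (\<lambda>z I J. (-1)^length I *
     (\<Sum>k<length J. (-1)^k * dzbar (J ! k) (\<lambda>w. a w I (remove_nth k J)) z))"

section \<open>Local Hermitian metrics and formal adjoints\<close>

text \<open>\<open>G z $ i $ j\<close> is the component \<open>g\<close> with first index \<open>i\<close> (holomorphic) and second index \<open>j\<close>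
  (antiholomorphic).\<close>

type_synonym 'n lmetric = "complex^'n \<Rightarrow> complex^'n^'n"

definition hermitian_posdef :: "complex^'n^'n \<Rightarrow> bool" where
  "hermitian_posdef P \<longleftrightarrow>
     (\<forall>i j. P $ j $ i = cnj (P $ i $ j)) \<and>
     (\<forall>v. v \<noteq> 0 \<longrightarrow> 0 < Re (\<Sum>i\<in>UNIV. \<Sum>j\<in>UNIV. P $ i $ j * v $ i * cnj (v $ j)))"

definition fundamental_form :: "(complex^'n::finite) set \<Rightarrow> 'n lmetric \<Rightarrow> 'n lform" where
  "fundamental_form W G = (\<lambda>z I J.
     if z \<in> W \<and> length I = 1 \<and> length J = 1 then \<i> * G z $ hd I $ hd J else 0)"

text \<open>The raised metric components \<open>g\<^sup>j\<^sup>i\<close> (\<open>j\<close> antiholomorphic, \<open>i\<close> holomorphic)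
  are \<open>matrix_inv (G z) $ j $ i\<close>. The pointwise inner product below is normalized by
  \<open>\<langle>dz\<^sup>i, dz\<^sup>k\<rangle> = g\<^sup>k\<^sup>i\<close>, which fixes the scale of the adjoints.\<close>

definition form_inner :: "'n::finite lmetric \<Rightarrow> nat \<Rightarrow> nat \<Rightarrow> 'n lform \<Rightarrow> 'n lform \<Rightarrow> complex^'n \<Rightarrow> complex" where
  "form_inner G p q a b z =
     (\<Sum>I | length I = p. \<Sum>K | length K = p. \<Sum>J | length J = q. \<Sum>L | length L = q.
        a z I J * cnj (b z K L)
        * (\<Prod>s<p. matrix_inv (G z) $ (K ! s) $ (I ! s))
        * (\<Prod>t<q. matrix_inv (G z) $ (J ! t) $ (L ! t))) / (fact p * fact q)"

text \<open>The volume form \<open>\<omega>\<^sup>n / n!\<close> is \<open>2\<^sup>n det g\<close> times Lebesgue measure.\<close>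

definition L2_inner :: "(complex^'n::finite) set \<Rightarrow> 'n lmetric \<Rightarrow> nat \<Rightarrow> nat \<Rightarrow> 'n lform \<Rightarrow> 'n lform \<Rightarrow> complex" where
  "L2_inner W G p q a b =
     set_lebesgue_integral lborel W (\<lambda>z. form_inner G p q a b z * (2 ^ CARD('n) * det (G z)))"

definition test_form :: "(complex^'n::finite) set \<Rightarrow> nat \<Rightarrow> nat \<Rightarrow> 'n lform \<Rightarrow> bool" where
  "test_form W p q b \<longleftrightarrow> local_form W p q b \<and>
     (\<exists>K. compact K \<and> K \<subseteq> W \<and> (\<forall>z I J. z \<notin> K \<longrightarrow> b z I J = 0))"

text \<open>The formal adjoints, as differential operators on a coordinate domain: the smooth form
  of the indicated bidegree \<open>(p,q)\<close> adjoint to all compactly supported test forms.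
  Formal adjoints are local, so on a manifold they are computed in each chart.\<close>

definition del_adj :: "(complex^'n::finite) set \<Rightarrow> 'n lmetric \<Rightarrow> nat \<Rightarrow> nat \<Rightarrow> 'n lform \<Rightarrow> 'n lform" where
  "del_adj W G p q a = (THE e. local_form W p q e \<and>
     (\<forall>b. test_form W p q b \<longrightarrow> L2_inner W G p q e b = L2_inner W G (Suc p) q a (del b)))"

definition delbar_adj :: "(complex^'n::finite) set \<Rightarrow> 'n lmetric \<Rightarrow> nat \<Rightarrow> nat \<Rightarrow> 'n lform \<Rightarrow> 'n lform" where
  "delbar_adj W G p q a = (THE e. local_form W p q e \<and>
     (\<forall>b. test_form W p q b \<longrightarrow> L2_inner W G p q e b = L2_inner W G p (Suc q) a (delbar b)))"

section \<open>The Bismut Ricci form\<close>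

text \<open>The function \<open>log det g\<close> as a form of bidegree \<open>(0,0)\<close>; \<open>det g\<close> is real and positive.\<close>

definition log_det :: "'n::finite lmetric \<Rightarrow> 'n lform" where
  "log_det G = (\<lambda>z I J. if I = [] \<and> J = [] then of_real (ln (Re (det (G z)))) else 0)"

definition bismut_ricci11 :: "(complex^'n::finite) set \<Rightarrow> 'n lmetric \<Rightarrow> 'n lform" where
  "bismut_ricci11 W G = (\<lambda>z I J.
     - del (del_adj W G 0 1 (fundamental_form W G)) z I J
     - delbar (delbar_adj W G 1 0 (fundamental_form W G)) z I J
     - \<i> * del (delbar (log_det G)) z I J)"

definition bismut_ricci_matrix :: "(complex^'n::finite) set \<Rightarrow> 'n lmetric \<Rightarrow> complex^'n \<Rightarrow> complex^'n^'n" where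
  "bismut_ricci_matrix W G z = (\<chi> i j. bismut_ricci11 W G z [i] [j] / \<i>)"

text \<open>The trace is real, since both matrices are Hermitian.\<close>

definition bismut_scalar :: "(complex^'n::finite) set \<Rightarrow> 'n lmetric \<Rightarrow> complex^'n \<Rightarrow> real" where
  "bismut_scalar W G z =
     Re (\<Sum>i\<in>UNIV. \<Sum>j\<in>UNIV. matrix_inv (G z) $ j $ i * bismut_ricci_matrix W G z $ i $ j)"

section \<open>Complex manifolds\<close>

text \<open>A chart consists of its domain and a coordinate map (whose values off the domain are
  irrelevant). The complex dimension is \<open>CARD('n)\<close>.\<close>

type_synonym ('m, 'n) chart = "'m set \<times> ('m \<Rightarrow> complex^'n)"

definition chart_image :: "('m, 'n::finite) chart \<Rightarrow> (complex^'n) set" where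
  "chart_image c = snd c ` fst c"

definition transition :: "('m, 'n::finite) chart \<Rightarrow> ('m, 'n) chart \<Rightarrow> complex^'n \<Rightarrow> complex^'n" where
  "transition c d = snd d \<circ> inv_into (fst c) (snd c)"

definition complex_manifold :: "'m topology \<Rightarrow> ('m, 'n::finite) chart set \<Rightarrow> bool" where
  "complex_manifold X A \<longleftrightarrow>
     Hausdorff_space X \<and> second_countable X \<and>
     (\<Union>c\<in>A. fst c) = topspace X \<and>
     (\<forall>c\<in>A. openin X (fst c) \<and> open (chart_image c) \<and>
        homeomorphic_map (subtopology X (fst c)) (top_of_set (chart_image c)) (snd c)) \<and>
     (\<forall>c\<in>A. \<forall>d\<in>A. holomorphic_map_on (snd c ` (fst c \<inter> fst d)) (transition c d))"

text \<open>A form on the manifold is a compatible family of forms in the charts: on an overlap, the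
  form in chart \<open>c\<close> is the pullback of the form in chart \<open>d\<close> under the transition map.\<close>

type_synonym ('m, 'n) mform = "('m, 'n) chart \<Rightarrow> 'n lform"

definition manifold_form :: "('m, 'n::finite) chart set \<Rightarrow> nat \<Rightarrow> nat \<Rightarrow> ('m, 'n) mform \<Rightarrow> bool" where
  "manifold_form A p q \<alpha> \<longleftrightarrow>
     (\<forall>c\<in>A. local_form (chart_image c) p q (\<alpha> c)) \<and>
     (\<forall>c. c \<notin> A \<longrightarrow> \<alpha> c = (\<lambda>z I J. 0)) \<and>
     (\<forall>c\<in>A. \<forall>d\<in>A. \<forall>x\<in>fst c \<inter> fst d. \<forall>I J. length I = p \<longrightarrow> length J = q \<longrightarrow>
        \<alpha> c (snd c x) I J =
          (\<Sum>K | length K = p. \<Sum>L | length L = q. \<alpha> d (snd d x) K L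
            * (\<Prod>s<p. dz (I ! s) (\<lambda>z. transition c d z $ (K ! s)) (snd c x))
            * (\<Prod>t<q. cnj (dz (J ! t) (\<lambda>z. transition c d z $ (L ! t)) (snd c x)))))"

definition manifold_delbar :: "('m, 'n::finite) chart set \<Rightarrow> ('m, 'n) mform \<Rightarrow> ('m, 'n) mform" where
  "manifold_delbar A \<alpha> = (\<lambda>c z I J.
     if c \<in> A \<and> z \<in> chart_image c then delbar (\<alpha> c) z I J else 0)"

section \<open>Dolbeault cohomology\<close>

definition dolbeault_closed :: "('m, 'n::finite) chart set \<Rightarrow> nat \<Rightarrow> nat \<Rightarrow> ('m, 'n) mform set" where
  "dolbeault_closed A p q =
     {\<alpha>. manifold_form A p q \<alpha> \<and> manifold_delbar A \<alpha> = (\<lambda>c z I J. 0)}"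

definition dolbeault_exact :: "('m, 'n::finite) chart set \<Rightarrow> nat \<Rightarrow> nat \<Rightarrow> ('m, 'n) mform set" where
  "dolbeault_exact A p q =
     (if q = 0 then {\<lambda>c z I J. 0}
      else manifold_delbar A ` {\<gamma>. manifold_form A p (q - 1) \<gamma>})"

definition dolbeault_rel :: "('m, 'n::finite) chart set \<Rightarrow> nat \<Rightarrow> nat \<Rightarrow> (('m, 'n) mform \<times> ('m, 'n) mform) set" where
  "dolbeault_rel A p q =
     {(\<alpha>, \<beta>). \<alpha> \<in> dolbeault_closed A p q \<and> \<beta> \<in> dolbeault_closed A p q \<and>
        (\<lambda>c z I J. \<alpha> c z I J - \<beta> c z I J) \<in> dolbeault_exact A p q}"

definition dolbeault_cohomology :: "('m, 'n::finite) chart set \<Rightarrow> nat \<Rightarrow> nat \<Rightarrow> ('m, 'n) mform set set" where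
  "dolbeault_cohomology A p q = dolbeault_closed A p q // dolbeault_rel A p q"

definition dolbeault_trivial :: "('m, 'n::finite) chart set \<Rightarrow> nat \<Rightarrow> nat \<Rightarrow> bool" where
  "dolbeault_trivial A p q \<longleftrightarrow>
     dolbeault_cohomology A p q = {dolbeault_rel A p q `` {\<lambda>c z I J. 0}}"

section \<open>Pluriclosed metrics\<close>

text \<open>A Hermitian metric is a positive definite matrix of components in each chart, which
  transforms so that the fundamental forms fit together to a smooth global form.\<close>

definition hermitian_metric :: "('m, 'n::finite) chart set \<Rightarrow> (('m, 'n) chart \<Rightarrow> 'n lmetric) \<Rightarrow> bool" where
  "hermitian_metric A g \<longleftrightarrow>
     (\<forall>c\<in>A. \<forall>z\<in>chart_image c. hermitian_posdef (g c z)) \<and>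
     manifold_form A 1 1
       (\<lambda>c. if c \<in> A then fundamental_form (chart_image c) (g c) else (\<lambda>z I J. 0))"

definition pluriclosed :: "('m, 'n::finite) chart set \<Rightarrow> (('m, 'n) chart \<Rightarrow> 'n lmetric) \<Rightarrow> bool" where
  "pluriclosed A g \<longleftrightarrow>
     (\<forall>c\<in>A. \<forall>z\<in>chart_image c. \<forall>I J.
        del (delbar (fundamental_form (chart_image c) (g c))) z I J = 0)"

definition bismut_ricci_positive :: "('m, 'n::finite) chart set \<Rightarrow> (('m, 'n) chart \<Rightarrow> 'n lmetric) \<Rightarrow> bool" where
  "bismut_ricci_positive A g \<longleftrightarrow>
     (\<forall>c\<in>A. \<forall>z\<in>chart_image c.
        hermitian_posdef (bismut_ricci_matrix (chart_image c) (g c) z))"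

definition bismut_scalar_positive :: "('m, 'n::finite) chart set \<Rightarrow> (('m, 'n) chart \<Rightarrow> 'n lmetric) \<Rightarrow> bool" where
  "bismut_scalar_positive A g \<longleftrightarrow>
     (\<forall>c\<in>A. \<forall>z\<in>chart_image c. bismut_scalar (chart_image c) (g c) z > 0)"

end

theory Submission
  imports Defs
begin

text \<open>
  Bochner technique with the comass instead of the \<open>L\<^sup>2\<close> norm. For a nonzero holomorphic \<open>p\<close>-form
  \<open>\<alpha>\<close> the quotient \<open>|\<alpha>(v\<^sub>1,\<dots>,v\<^sub>p)|\<^sup>2 / \<Prod> g(v\<^sub>s,v\<^sub>s)\<close> attains a positive maximum at some point
  \<open>z\<^sub>0\<close> and unit vectors \<open>v\<^sub>s\<close>. Extend the \<open>v\<^sub>s\<close> to holomorphic vector fields \<open>V\<^sub>s\<close> that are parallel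
  at \<open>z\<^sub>0\<close> for the Chern connection. Then \<open>|\<alpha>(V)|\<^sup>2 - m \<Prod> g(V\<^sub>s,V\<^sub>s)\<close> is maximal at \<open>z\<^sub>0\<close>, and the
  \<open>g\<close>-trace of its complex Hessian is at least \<open>m \<Sum> S(v\<^sub>s,v\<^sub>s)\<close>, where \<open>S\<close> is the second Chern-Ricci
  form; hence \<open>\<Sum> S(v\<^sub>s,v\<^sub>s) \<le> 0\<close>. For a pluriclosed metric \<open>S = \<rho> + Q\<close>, where \<open>\<rho>\<close> is the
  (1,1)-part of the Bismut Ricci form and \<open>Q \<ge> 0\<close> is quadratic in the torsion, so
  \<open>\<Sum> \<rho>(v\<^sub>s,v\<^sub>s) \<le> 0\<close>, which contradicts positivity of \<open>\<rho>\<close>. If \<open>p = n\<close> the maximizing vectors are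
  orthogonal, because \<open>\<alpha>\<close> is alternating, and \<open>\<Sum> \<rho>(v\<^sub>s,v\<^sub>s)\<close> is the Bismut scalar curvature.
\<close>

section \<open>Smooth functions and bump functions\<close>

text \<open>A pointwise norm on (p,0)-forms would bring in the curvature of the p-th exterior power,
  and torsion in general rules out holomorphic coordinates in which the first derivatives of g
  vanish at a point. Testing \<alpha> on vectors avoids both: only the Hessian of g(V,V) for tangent
  fields V enters, and choosing V parallel removes just the first-order terms that occur there. The
  sign of Q comes from completing a square. Pluriclosedness trades the second derivatives in \<rho>
  for the single trace that occurs in S; the first-order terms of S - \<rho> then form the squared
  norm of the torsion contracted with v. The adjoints in \<rho> are specified only weakly, by
  pairing with test forms, so explicit formulas for them must be found before any of this can start.
  That is the purpose of the bump functions, of integration by parts on a coordinate domain, and of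
  the divergence of det g times the inverse metric.\<close>

abbreviation "fd f x \<equiv> frechet_derivative f (at x)"

section \<open>Calculus of iterated directional derivatives\<close>

lemma frechet_derivative_eqI: "(f has_derivative D) (at x) \<Longrightarrow> fd f x = D"
  by (rule frechet_derivative_at[symmetric])

lemma Ck_on_imp_continuous_on: "Ck_on k S f \<Longrightarrow> continuous_on S f"
  by (cases k) (auto intro!: continuous_at_imp_continuous_on differentiable_imp_continuous_within)

lemma Ck_on_SucD: "Ck_on (Suc k) S f \<Longrightarrow> Ck_on k S f"
proof (induction k arbitrary: f)
  case 0
  then show ?case using Ck_on_imp_continuous_on by (metis Ck_on.simps(1))
next
  case (Suc k)
  then show ?case by (metis Ck_on.simps(2))
qed

text \<open>\<open>frechet_derivative\<close> is a choice among all candidates \<open>D\<close>.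
  Functions that agree near x have the same candidates, so the chosen values agree even where
  neither function is differentiable.\<close>

lemma frechet_derivative_cong_open:
  assumes "open S" "x \<in> S" "\<And>y. y \<in> S \<Longrightarrow> f y = g y"
  shows "fd f x = fd g x"
proof -
  have "(f has_derivative D) (at x) \<longleftrightarrow> (g has_derivative D) (at x)" for D
    using assms by (metis has_derivative_transform_within_open)
  then show ?thesis by (simp add: frechet_derivative_def)
qed

lemma differentiable_cong_open:
  assumes "open S" "x \<in> S" "\<And>y. y \<in> S \<Longrightarrow> f y = g y" "f differentiable (at x)"
  shows "g differentiable (at x)"
  using assms unfolding differentiable_def by (metis has_derivative_transform_within_open)

lemma Ck_on_cong:
  assumes "open S" "\<And>y. y \<in> S \<Longrightarrow> f y = g y" "Ck_on k S f"
  shows "Ck_on k S g"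
  using assms(2,3)
proof (induction k arbitrary: f g)
  case 0
  then show ?case by (metis Ck_on.simps(1) continuous_on_cong)
next
  case (Suc k)
  have "Ck_on k S (\<lambda>x. fd g x v)" for v
  proof (rule Suc.IH)
    show "fd f y v = fd g y v" if "y \<in> S" for y
      using frechet_derivative_cong_open[OF assms(1) that Suc.prems(1)] by simp
    show "Ck_on k S (\<lambda>x. fd f x v)" using Suc.prems(2) by simp
  qed
  moreover have "g differentiable (at x)" if "x \<in> S" for x
    using differentiable_cong_open[OF assms(1) that Suc.prems(1)] Suc.prems(2) that by simp
  ultimately show ?case by simp
qed

lemma Ck_on_subset: "Ck_on k T f \<Longrightarrow> S \<subseteq> T \<Longrightarrow> Ck_on k S f"
  by (induction k arbitrary: f) (auto intro: continuous_on_subset)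

text \<open>Derivatives are taken in the full space rather than within a set, so they do not depend
  on which of the two sets contains x.\<close>

lemma Ck_on_Un:
  assumes "open S" "open T"
  shows "Ck_on k S f \<Longrightarrow> Ck_on k T f \<Longrightarrow> Ck_on k (S \<union> T) f"
  using assms by (induction k arbitrary: f) (auto intro: continuous_on_open_Un)

lemma Ck_on_const: "Ck_on k S (\<lambda>x. c)"
  by (induction k arbitrary: c) simp_all

lemma Ck_on_bounded_linear:
  assumes S: "open S" and h: "bounded_linear h"
  shows "Ck_on k S f \<Longrightarrow> Ck_on k S (\<lambda>x. h (f x))"
proof (induction k arbitrary: f)
  case 0
  then show ?case using h by (auto intro: bounded_linear.continuous_on)
next
  case (Suc k)
  have D: "((\<lambda>x. h (f x)) has_derivative (\<lambda>v. h (fd f x v))) (at x)" if "x \<in> S" for x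
    using Suc.prems that
    by (intro bounded_linear.has_derivative[OF h]) (auto simp: frechet_derivative_works)
  have "Ck_on k S (\<lambda>x. fd (\<lambda>x. h (f x)) x v)" for v
    by (rule Ck_on_cong[OF S, where f="\<lambda>x. h (fd f x v)"])
       (use Suc frechet_derivative_eqI[OF D] in auto)
  then show ?case using D by (auto simp: differentiable_def)
qed

lemma Ck_on_add:
  assumes S: "open S"
  shows "Ck_on k S f \<Longrightarrow> Ck_on k S g \<Longrightarrow> Ck_on k S (\<lambda>x. f x + g x)"
proof (induction k arbitrary: f g)
  case 0
  then show ?case by (auto intro: continuous_on_add)
next
  case (Suc k)
  have D: "((\<lambda>x. f x + g x) has_derivative
      (\<lambda>v. fd f x v + fd g x v)) (at x)" if "x \<in> S" for x
    using Suc.prems that by (intro has_derivative_add) (auto simp: frechet_derivative_works)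
  have "Ck_on k S (\<lambda>x. fd (\<lambda>x. f x + g x) x v)" for v
    by (rule Ck_on_cong[OF S, where f="\<lambda>x. fd f x v + fd g x v"])
       (use Suc frechet_derivative_eqI[OF D] in auto)
  then show ?case using D by (auto simp: differentiable_def)
qed

lemma Ck_on_bounded_bilinear:
  assumes S: "open S" and h: "bounded_bilinear h"
  shows "Ck_on k S f \<Longrightarrow> Ck_on k S g \<Longrightarrow> Ck_on k S (\<lambda>x. h (f x) (g x))"
proof (induction k arbitrary: f g)
  case 0
  then show ?case using h by (auto intro: bounded_bilinear.continuous_on)
next
  case (Suc k)
  have D: "((\<lambda>x. h (f x) (g x)) has_derivative
      (\<lambda>v. h (f x) (fd g x v) + h (fd f x v) (g x))) (at x)"
    if "x \<in> S" for x
    using Suc.prems that by (intro bounded_bilinear.FDERIV[OF h]) (auto simp: frechet_derivative_works)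
  have "Ck_on k S (\<lambda>x. fd (\<lambda>x. h (f x) (g x)) x v)" for v
  proof (rule Ck_on_cong[OF S, where f="\<lambda>x. h (f x) (fd g x v)
          + h (fd f x v) (g x)"])
    show "Ck_on k S (\<lambda>x. h (f x) (fd g x v) + h (fd f x v) (g x))"
      using Suc.prems Ck_on_SucD[OF Suc.prems(1)] Ck_on_SucD[OF Suc.prems(2)]
      by (intro Ck_on_add[OF S] Suc.IH) auto
  qed (use frechet_derivative_eqI[OF D] in auto)
  then show ?case using D by (auto simp: differentiable_def)
qed

lemmas Ck_on_mult = Ck_on_bounded_bilinear[OF _ bounded_bilinear_mult]

text \<open>The derivative of 1/f is a product that contains 1/f itself; the induction on k, with f
  fixed, supplies this factor at the lower order.\<close>

lemma Ck_on_inverse: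
  fixes f :: "'a::real_normed_vector \<Rightarrow> 'b::real_normed_field"
  assumes S: "open S" and nz: "\<And>x. x \<in> S \<Longrightarrow> f x \<noteq> 0"
  shows "Ck_on k S f \<Longrightarrow> Ck_on k S (\<lambda>x. inverse (f x))"
proof (induction k)
  case 0
  then show ?case using nz by (auto intro!: continuous_intros)
next
  case (Suc k)
  have D: "((\<lambda>x. inverse (f x)) has_derivative
      (\<lambda>v. (-1) * (inverse (f x) * fd f x v * inverse (f x)))) (at x)"
    if "x \<in> S" for x
    using Suc.prems that nz[OF that] Deriv.has_derivative_inverse[of f x "fd f x" UNIV]
    by (auto simp: frechet_derivative_works)
  have "Ck_on k S (\<lambda>x. fd (\<lambda>x. inverse (f x)) x v)" for v
  proof (rule Ck_on_cong[OF S, where f="\<lambda>x. (-1) * (inverse (f x) * fd f x v * inverse (f x))"])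
    show "Ck_on k S (\<lambda>x. (-1) * (inverse (f x) * fd f x v * inverse (f x)))"
      using Suc.prems Suc.IH[OF Ck_on_SucD[OF Suc.prems]]
      by (intro Ck_on_mult[OF S] Ck_on_const) auto
  qed (use frechet_derivative_eqI[OF D] in auto)
  then show ?case using D by (auto simp: differentiable_def)
qed

lemma smooth_on_cong: "open S \<Longrightarrow> (\<And>y. y \<in> S \<Longrightarrow> f y = g y) \<Longrightarrow> smooth_on S f \<Longrightarrow> smooth_on S g"
  by (meson Ck_on_cong smooth_on_def)

lemma smooth_on_continuous: "smooth_on S f \<Longrightarrow> continuous_on S f"
  using Ck_on_imp_continuous_on smooth_on_def by blast

lemma smooth_on_differentiable: "smooth_on S f \<Longrightarrow> x \<in> S \<Longrightarrow> f differentiable (at x)"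
  unfolding smooth_on_def by (metis Ck_on.simps(2))

lemma smooth_on_frechet: "smooth_on S f \<Longrightarrow> smooth_on S (\<lambda>x. fd f x v)"
  unfolding smooth_on_def by (metis Ck_on.simps(2))

lemma smooth_on_subset: "smooth_on T f \<Longrightarrow> S \<subseteq> T \<Longrightarrow> smooth_on S f"
  unfolding smooth_on_def by (blast intro: Ck_on_subset)

lemma smooth_on_Un: "open S \<Longrightarrow> open T \<Longrightarrow> smooth_on S f \<Longrightarrow> smooth_on T f \<Longrightarrow> smooth_on (S \<union> T) f"
  unfolding smooth_on_def by (blast intro: Ck_on_Un)

lemma smooth_on_const: "smooth_on S (\<lambda>x. c)"
  unfolding smooth_on_def by (simp add: Ck_on_const)

lemma smooth_on_bounded_linear:
  "open S \<Longrightarrow> bounded_linear h \<Longrightarrow> smooth_on S f \<Longrightarrow> smooth_on S (\<lambda>x. h (f x))"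
  unfolding smooth_on_def by (blast intro: Ck_on_bounded_linear)

lemma smooth_on_linear:
  assumes "bounded_linear h"
  shows "smooth_on S h"
proof -
  have "Ck_on k UNIV h" for k
  proof (cases k)
    case 0
    then show ?thesis using assms by (auto intro: linear_continuous_on)
  next
    case (Suc m)
    then show ?thesis
      using assms
      by (auto simp: frechet_derivative_eqI[OF bounded_linear_imp_has_derivative[OF assms]] Ck_on_const
          differentiable_def intro: bounded_linear_imp_has_derivative)
  qed
  then show ?thesis unfolding smooth_on_def by (blast intro: Ck_on_subset)
qed

lemma smooth_on_add: "open S \<Longrightarrow> smooth_on S f \<Longrightarrow> smooth_on S g \<Longrightarrow> smooth_on S (\<lambda>x. f x + g x)"
  unfolding smooth_on_def by (blast intro: Ck_on_add)

lemma smooth_on_mult: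
  fixes f g :: "'a::real_normed_vector \<Rightarrow> 'b::real_normed_algebra"
  shows "open S \<Longrightarrow> smooth_on S f \<Longrightarrow> smooth_on S g \<Longrightarrow> smooth_on S (\<lambda>x. f x * g x)"
  unfolding smooth_on_def by (blast intro: Ck_on_mult)

lemma smooth_on_uminus:
  fixes f :: "'a::real_normed_vector \<Rightarrow> 'b::real_normed_vector"
  shows "open S \<Longrightarrow> smooth_on S f \<Longrightarrow> smooth_on S (\<lambda>x. - f x)"
  by (rule smooth_on_bounded_linear[where h=uminus]) (auto intro: bounded_linear_minus bounded_linear_ident)

lemma smooth_on_diff:
  fixes f :: "'a::real_normed_vector \<Rightarrow> 'b::real_normed_vector"
  shows "open S \<Longrightarrow> smooth_on S f \<Longrightarrow> smooth_on S g \<Longrightarrow> smooth_on S (\<lambda>x. f x - g x)"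
  using smooth_on_add[OF _ _ smooth_on_uminus, of S f g] by simp

lemma smooth_on_inverse:
  fixes f :: "'a::real_normed_vector \<Rightarrow> 'b::real_normed_field"
  shows "open S \<Longrightarrow> (\<And>x. x \<in> S \<Longrightarrow> f x \<noteq> 0) \<Longrightarrow> smooth_on S f \<Longrightarrow> smooth_on S (\<lambda>x. inverse (f x))"
  unfolding smooth_on_def by (blast intro: Ck_on_inverse)

lemma smooth_on_divide:
  fixes f :: "'a::real_normed_vector \<Rightarrow> 'b::real_normed_field"
  shows "open S \<Longrightarrow> (\<And>x. x \<in> S \<Longrightarrow> g x \<noteq> 0) \<Longrightarrow> smooth_on S f \<Longrightarrow> smooth_on S g \<Longrightarrow>
    smooth_on S (\<lambda>x. f x / g x)"
  unfolding divide_inverse by (intro smooth_on_mult smooth_on_inverse)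

lemma smooth_on_sum:
  "open S \<Longrightarrow> (\<And>i. i \<in> I \<Longrightarrow> smooth_on S (f i)) \<Longrightarrow> smooth_on S (\<lambda>x. \<Sum>i\<in>I. f i x)"
  by (induction I rule: infinite_finite_induct) (auto intro: smooth_on_const smooth_on_add)

lemma smooth_on_prod:
  fixes f :: "'i \<Rightarrow> 'a::real_normed_vector \<Rightarrow> 'b::real_normed_field"
  shows "open S \<Longrightarrow> (\<And>i. i \<in> I \<Longrightarrow> smooth_on S (f i)) \<Longrightarrow> smooth_on S (\<lambda>x. \<Prod>i\<in>I. f i x)"
  by (induction I rule: infinite_finite_induct) (auto intro: smooth_on_const smooth_on_mult)

lemma smooth_on_cnj: "open S \<Longrightarrow> smooth_on S f \<Longrightarrow> smooth_on S (\<lambda>x. cnj (f x))"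
  by (rule smooth_on_bounded_linear[OF _ bounded_linear_cnj])

lemma smooth_on_component: "smooth_on S (\<lambda>z::complex^'n. z $ i)"
  by (rule smooth_on_linear) (rule bounded_linear_vec_nth)

section \<open>Bump functions\<close>

text \<open>Powers of \<open>1/t\<close> are carried along so that the family is closed under differentiation.\<close>

definition flat :: "nat \<Rightarrow> real \<Rightarrow> real" where
  "flat m t = (if t > 0 then exp (- inverse t) * inverse t ^ m else 0)"

text \<open>Substituting s = 1/t turns the limit from the right into that of s^m / exp s at
  infinity.\<close>

lemma flat_tendsto_0: "(flat m \<longlongrightarrow> 0) (at 0)"
proof -
  have *: "((\<lambda>t::real. inverse t ^ m / exp (inverse t)) \<longlongrightarrow> 0) (at_right 0)"
    by (rule filterlim_compose[OF tendsto_power_div_exp_0 filterlim_inverse_at_top_right])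
  have "(flat m \<longlongrightarrow> 0) (at_right 0)"
    by (rule Lim_transform_eventually[OF *])
       (auto simp: flat_def eventually_at_right_field exp_minus field_simps intro!: exI[of _ 1])
  moreover have "(flat m \<longlongrightarrow> 0) (at_left 0)"
    by (rule Lim_transform_eventually[OF tendsto_const])
       (auto simp: flat_def eventually_at_left_field intro!: exI[of _ "-1"])
  ultimately show ?thesis by (simp add: filterlim_split_at)
qed

lemma flat_has_real_derivative:
  "(flat m has_real_derivative (flat (m + 2) t - of_nat m * flat (m + 1) t)) (at t)"
proof -
  consider "t > 0" | "t < 0" | "t = 0" by linarith
  then show ?thesis
  proof cases
    case 1
    have "((\<lambda>t. exp (- inverse t) * inverse t ^ m) has_real_derivative
            (flat (m + 2) t - of_nat m * flat (m + 1) t)) (at t)"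
      using 1
      apply (auto intro!: derivative_eq_intros)
      apply (cases m)
      apply (auto simp: flat_def field_simps power_Suc)
      done
    then show ?thesis
      by (rule has_field_derivative_transform_within_open[where S="{0<..}"]) (use 1 in \<open>auto simp: flat_def\<close>)
  next
    case 2
    have "((\<lambda>t. 0) has_real_derivative (flat (m + 2) t - of_nat m * flat (m + 1) t)) (at t)"
      using 2 by (auto simp: flat_def)
    then show ?thesis
      by (rule has_field_derivative_transform_within_open[where S="{..<0}"]) (use 2 in \<open>auto simp: flat_def\<close>)
  next
    case 3
    \<comment> \<open>Since \<open>flat m 0 = 0\<close>, dividing by h only adds one power of 1/h:
      the difference quotient at 0 is \<open>flat (Suc m) h\<close>.\<close>
    have "((\<lambda>h. (flat m (0 + h) - flat m 0) / h) \<longlongrightarrow> 0) (at 0)"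
      by (rule Lim_transform_eventually[OF flat_tendsto_0[of "Suc m"]])
         (auto simp: flat_def eventually_at field_simps intro!: exI[of _ 1])
    then have "(flat m has_real_derivative 0) (at 0)"
      by (simp add: DERIV_def)
    then show ?thesis using 3 by (simp add: flat_def)
  qed
qed

text \<open>The index m must vary in the induction on k, because each derivative raises it by one or
  two.\<close>

lemma Ck_on_flat:
  assumes S: "open S" and q: "smooth_on S q"
  shows "Ck_on k S (\<lambda>x. flat m (q x))"
proof (induction k arbitrary: m)
  have c: "continuous_on UNIV (flat m)" for m
    by (meson DERIV_isCont flat_has_real_derivative continuous_at_imp_continuous_on)
  case 0
  show ?case using smooth_on_continuous[OF q]
    by (auto intro: continuous_on_compose2[OF c])
next
  case (Suc k)
  have D: "((\<lambda>x. flat m (q x)) has_derivative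
      (\<lambda>v. (flat (m + 2) (q x) - of_nat m * flat (m + 1) (q x)) * fd q x v)) (at x)"
    if "x \<in> S" for x
    using smooth_on_differentiable[OF q that] has_derivative_compose[of q _ x UNIV "flat m",
        OF _ flat_has_real_derivative[unfolded has_field_derivative_def]]
    by (auto simp: frechet_derivative_works)
  have "Ck_on k S (\<lambda>x. fd (\<lambda>x. flat m (q x)) x v)" for v
  proof (rule Ck_on_cong[OF S, where f="\<lambda>x. (flat (m + 2) (q x) + (- of_nat m) * flat (m + 1) (q x)) * fd q x v"])
    show "Ck_on k S (\<lambda>x. (flat (m + 2) (q x) + (- of_nat m) * flat (m + 1) (q x)) * fd q x v)"
      using smooth_on_frechet[OF q]
      by (intro Ck_on_mult[OF S] Ck_on_add[OF S] Suc.IH Ck_on_const) (auto simp: smooth_on_def)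
  qed (use frechet_derivative_eqI[OF D] in auto)
  then show ?case using D by (auto simp: differentiable_def)
qed

lemma smooth_bump:
  fixes z0 :: "'a::euclidean_space"
  assumes "r > 0"
  obtains \<phi> :: "'a \<Rightarrow> real" where "smooth_on UNIV \<phi>" "\<And>z. \<phi> z \<ge> 0" "\<phi> z0 > 0" "\<And>z. z \<notin> cball z0 r \<Longrightarrow> \<phi> z = 0"
proof
  \<comment> \<open>The squared distance, unlike the distance, keeps the argument of
    \<open>flat\<close> smooth at the centre.\<close>
  let ?q = "\<lambda>z. r\<^sup>2 - (z - z0) \<bullet> (z - z0)"
  let ?\<phi> = "\<lambda>z. flat 0 (?q z)"
  have lin: "smooth_on UNIV (\<lambda>z. z - z0)"
    using smooth_on_diff[OF open_UNIV smooth_on_linear[OF bounded_linear_ident] smooth_on_const] .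
  have "smooth_on UNIV ?q"
  proof (rule smooth_on_diff[OF open_UNIV smooth_on_const])
    show "smooth_on UNIV (\<lambda>z. (z - z0) \<bullet> (z - z0))"
      using lin Ck_on_bounded_bilinear[OF open_UNIV bounded_bilinear_inner] unfolding smooth_on_def by blast
  qed
  then have "Ck_on k UNIV ?\<phi>" for k
    by (rule Ck_on_flat[OF open_UNIV])
  then show "smooth_on UNIV ?\<phi>" by (simp add: smooth_on_def)
  show "?\<phi> z \<ge> 0" for z by (simp add: flat_def)
  show "?\<phi> z0 > 0" using assms by (simp add: flat_def)
  show "?\<phi> z = 0" if "z \<notin> cball z0 r" for z
  proof -
    have "r < norm (z - z0)" using that by (simp add: dist_norm norm_minus_commute)
    then have "r\<^sup>2 < (norm (z - z0))\<^sup>2" using assms by (intro power_strict_mono) auto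
    then show ?thesis by (simp add: flat_def power2_norm_eq_inner)
  qed
qed

section \<open>Second derivatives and Wirtinger derivatives\<close>

lemma has_vector_derivative_line:
  assumes "f differentiable (at (a + s *\<^sub>R u))"
  shows "((\<lambda>s. f (a + s *\<^sub>R u)) has_vector_derivative fd f (a + s *\<^sub>R u) u) (at s)"
proof -
  have "((\<lambda>s. a + s *\<^sub>R u) has_derivative (\<lambda>h. h *\<^sub>R u)) (at s)"
    by (auto intro!: derivative_eq_intros)
  from diff_chain_at[OF this] assms
  have "((\<lambda>s. f (a + s *\<^sub>R u)) has_derivative (\<lambda>h. fd f (a + s *\<^sub>R u) (h *\<^sub>R u))) (at s)"
    by (simp add: frechet_derivative_works o_def)
  moreover have "linear (fd f (a + s *\<^sub>R u))"
    using assms by (rule linear_frechet_derivative)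
  ultimately show ?thesis
    by (simp add: has_vector_derivative_def linear_cmul)
qed

text \<open>The second difference is symmetric in u and v while the iterated derivative is not a
  priori; using the lemma in both orders makes second derivatives commute. The mean value theorem is
  applied in direction u to the difference of f along two parallel lines, then in direction v. The
  bound on t keeps the whole parallelogram in the ball.\<close>

lemma second_difference_mean_value:
  fixes f :: "'a::real_normed_vector \<Rightarrow> real"
  assumes f: "smooth_on S f" and ball: "ball z d \<subseteq> S"
    and t: "t > 0" "t * (norm u + norm v) < d"
  obtains x where "x \<in> ball z d"
    "f (z + t *\<^sub>R u + t *\<^sub>R v) - f (z + t *\<^sub>R u) - f (z + t *\<^sub>R v) + f z
      = t\<^sup>2 * fd (\<lambda>x. fd f x u) x v"
proof -
  let ?u = "\<lambda>x. fd f x u"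
  have inb: "z + s *\<^sub>R u + r *\<^sub>R v \<in> ball z d" if "0 \<le> s" "s \<le> t" "0 \<le> r" "r \<le> t" for s r
  proof -
    have "norm (s *\<^sub>R u + r *\<^sub>R v) \<le> s * norm u + r * norm v"
      using that by (metis abs_of_nonneg norm_scaleR norm_triangle_ineq)
    also have "\<dots> \<le> t * norm u + t * norm v"
      using that by (intro add_mono mult_right_mono) auto
    finally have "norm (s *\<^sub>R u + r *\<^sub>R v) < d" using t by (simp add: algebra_simps)
    moreover have "dist z (z + w) = norm w" for w by (simp add: dist_norm)
    ultimately show ?thesis by (simp add: add.assoc)
  qed
  have D: "f differentiable (at x)" "?u differentiable (at x)" if "x \<in> ball z d" for x
    using that ball smooth_on_differentiable[OF f] smooth_on_differentiable[OF smooth_on_frechet[OF f]]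
    by blast+
  have "\<exists>\<xi>>0. \<xi> < t \<and> (f ((z + t *\<^sub>R v) + t *\<^sub>R u) - f (z + t *\<^sub>R u)) - (f ((z + t *\<^sub>R v) + 0 *\<^sub>R u) - f (z + 0 *\<^sub>R u))
      = (t - 0) * (?u ((z + t *\<^sub>R v) + \<xi> *\<^sub>R u) - ?u (z + \<xi> *\<^sub>R u))"
  proof (rule MVT2[OF t(1)])
    fix s assume s: "0 \<le> s" "s \<le> t"
    show "((\<lambda>s. f ((z + t *\<^sub>R v) + s *\<^sub>R u) - f (z + s *\<^sub>R u)) has_real_derivative
        (?u ((z + t *\<^sub>R v) + s *\<^sub>R u) - ?u (z + s *\<^sub>R u))) (at s)"
      using inb[OF s, of t] inb[OF s, of 0] t
      unfolding has_real_derivative_iff_has_vector_derivative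
      by (intro has_vector_derivative_diff has_vector_derivative_line D) (auto simp: algebra_simps)
  qed
  then obtain \<xi> where xi: "0 < \<xi>" "\<xi> < t"
    "f (z + t *\<^sub>R u + t *\<^sub>R v) - f (z + t *\<^sub>R u) - f (z + t *\<^sub>R v) + f z
      = t * (?u ((z + \<xi> *\<^sub>R u) + t *\<^sub>R v) - ?u ((z + \<xi> *\<^sub>R u) + 0 *\<^sub>R v))"
    by (auto simp: algebra_simps)
  have "\<exists>\<eta>>0. \<eta> < t \<and> ?u ((z + \<xi> *\<^sub>R u) + t *\<^sub>R v) - ?u ((z + \<xi> *\<^sub>R u) + 0 *\<^sub>R v)
      = (t - 0) * fd ?u ((z + \<xi> *\<^sub>R u) + \<eta> *\<^sub>R v) v"
  proof (rule MVT2[OF t(1)])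
    fix s assume s: "0 \<le> s" "s \<le> t"
    show "((\<lambda>s. ?u ((z + \<xi> *\<^sub>R u) + s *\<^sub>R v)) has_real_derivative
        fd ?u ((z + \<xi> *\<^sub>R u) + s *\<^sub>R v) v) (at s)"
      using inb[of \<xi> s] s xi
      unfolding has_real_derivative_iff_has_vector_derivative
      by (intro has_vector_derivative_line D) auto
  qed
  then obtain \<eta> where eta: "0 < \<eta>" "\<eta> < t" "?u ((z + \<xi> *\<^sub>R u) + t *\<^sub>R v) - ?u ((z + \<xi> *\<^sub>R u) + 0 *\<^sub>R v)
      = t * fd ?u ((z + \<xi> *\<^sub>R u) + \<eta> *\<^sub>R v) v" by auto
  show ?thesis
    by (rule that[of "(z + \<xi> *\<^sub>R u) + \<eta> *\<^sub>R v"])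
       (use inb[of \<xi> \<eta>] xi eta in \<open>auto simp: power2_eq_square\<close>)
qed

text \<open>In any small ball about z there are points at which the two iterated derivatives equal
  the same second difference divided by t^2; continuity then pushes their difference at z below
  every e.\<close>

lemma second_derivative_commute_real:
  fixes f :: "'a::real_normed_vector \<Rightarrow> real"
  assumes S: "open S" and f: "smooth_on S f" and z: "z \<in> S"
  shows "fd (\<lambda>x. fd f x u) z v
       = fd (\<lambda>x. fd f x v) z u"
proof -
  let ?p = "\<lambda>x. fd (\<lambda>x. fd f x u) x v"
  let ?q = "\<lambda>x. fd (\<lambda>x. fd f x v) x u"
  have "\<bar>?p z - ?q z\<bar> \<le> e" if e: "e > 0" for e
  proof -
    have "continuous_on S ?p" "continuous_on S ?q"
      using f by (auto intro: smooth_on_continuous smooth_on_frechet)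
    then have "isCont ?p z" "isCont ?q z" using S z by (auto simp: continuous_on_eq_continuous_at)
    then obtain d1 d2 where d: "d1 > 0" "d2 > 0" "\<And>x. dist x z < d1 \<Longrightarrow> dist (?p x) (?p z) < e/2"
      "\<And>x. dist x z < d2 \<Longrightarrow> dist (?q x) (?q z) < e/2"
      using half_gt_zero[OF e] unfolding continuous_at_eps_delta by blast
    obtain d3 where d3: "d3 > 0" "ball z d3 \<subseteq> S" using S z open_contains_ball by blast
    define d where "d = min d1 (min d2 d3)"
    have dd: "d > 0" "ball z d \<subseteq> S" using d d3 by (auto simp: d_def)
    \<comment> \<open>The summand 1 keeps the quotient meaningful for u = v = 0 and makes the bound
      required of t strict.\<close>
    define t where "t = d / (norm u + norm v + 1)"
    have n: "norm u + norm v + 1 > 0" by (simp add: add_nonneg_pos)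
    have t: "t > 0" "t * (norm u + norm v) < d"
      using dd n by (auto simp: t_def field_simps)
    obtain x where x: "x \<in> ball z d" "f (z + t *\<^sub>R u + t *\<^sub>R v) - f (z + t *\<^sub>R u) - f (z + t *\<^sub>R v) + f z = t\<^sup>2 * ?p x"
      by (rule second_difference_mean_value[OF f dd(2) t])
    obtain y where y: "y \<in> ball z d" "f (z + t *\<^sub>R v + t *\<^sub>R u) - f (z + t *\<^sub>R v) - f (z + t *\<^sub>R u) + f z = t\<^sup>2 * ?q y"
      by (rule second_difference_mean_value[OF f dd(2) t(1) t(2)[unfolded add.commute[of "norm u"]]])
    have "t\<^sup>2 * ?p x = t\<^sup>2 * ?q y" using x y by (simp add: algebra_simps)
    then have "?p x = ?q y" using t by simp
    moreover have "dist (?p x) (?p z) < e/2" "dist (?q y) (?q z) < e/2"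
      using d x(1) y(1) by (auto simp: d_def dist_commute)
    ultimately show ?thesis unfolding dist_real_def by linarith
  qed
  then have "\<bar>?p z - ?q z\<bar> \<le> 0" by (meson dense not_le)
  then show ?thesis by simp
qed

lemma frechet_derivative_bounded_linear:
  assumes "bounded_linear h" "f differentiable (at x)"
  shows "fd (\<lambda>x. h (f x)) x v = h (fd f x v)"
  using frechet_derivative_eqI[OF bounded_linear.has_derivative[OF assms(1) assms(2)[unfolded frechet_derivative_works]]]
  by simp

lemma second_derivative_bounded_linear:
  assumes S: "open S" and f: "smooth_on S f" and z: "z \<in> S" and h: "bounded_linear h"
  shows "fd (\<lambda>x. fd (\<lambda>x. h (f x)) x u) z v
       = h (fd (\<lambda>x. fd f x u) z v)"
proof -
  have "fd (\<lambda>x. fd (\<lambda>x. h (f x)) x u) z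
      = fd (\<lambda>x. h (fd f x u)) z"
    using smooth_on_differentiable[OF f]
    by (intro frechet_derivative_cong_open[OF S z] frechet_derivative_bounded_linear[OF h])
  then show ?thesis
    using frechet_derivative_bounded_linear[OF h smooth_on_differentiable[OF smooth_on_frechet[OF f] z]]
    by simp
qed

lemma second_derivative_commute:
  fixes f :: "'a::real_normed_vector \<Rightarrow> complex"
  assumes S: "open S" and f: "smooth_on S f" and z: "z \<in> S"
  shows "fd (\<lambda>x. fd f x u) z v
       = fd (\<lambda>x. fd f x v) z u"
  using second_derivative_bounded_linear[OF S f z bounded_linear_Re]
    second_derivative_bounded_linear[OF S f z bounded_linear_Im]
    second_derivative_commute_real[OF S smooth_on_bounded_linear[OF S bounded_linear_Re f] z]
    second_derivative_commute_real[OF S smooth_on_bounded_linear[OF S bounded_linear_Im f] z]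
  by (simp add: complex_eq_iff)

text \<open>At a maximum the first derivative along u vanishes. If the second derivative were
  positive, the first one would be positive just after 0 and f would exceed its maximum.\<close>

lemma second_derivative_test:
  fixes f :: "'a::real_normed_vector \<Rightarrow> real"
  assumes S: "open S" and f: "smooth_on S f" and z: "z \<in> S" and max: "\<And>x. x \<in> S \<Longrightarrow> f x \<le> f z"
  shows "fd (\<lambda>x. fd f x u) z u \<le> 0"
proof (rule ccontr)
  let ?u = "\<lambda>x. fd f x u"
  assume *: "\<not> ?thesis"
  obtain d where d: "d > 0" "ball z d \<subseteq> S" using S z open_contains_ball by blast
  define e where "e = d / (norm u + 1)"
  have n: "norm u + 1 > 0" by (simp add: add_nonneg_pos)
  have e: "e > 0" using d n by (simp add: e_def)
  have inS: "z + s *\<^sub>R u \<in> S" if "\<bar>s\<bar> < e" for s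
  proof -
    have "norm (s *\<^sub>R u) \<le> \<bar>s\<bar> * (norm u + 1)" by (simp add: algebra_simps)
    also have "\<dots> < d" using that n by (simp add: e_def field_simps)
    finally show ?thesis using d by (auto simp: dist_norm)
  qed
  have g': "((\<lambda>s. f (z + s *\<^sub>R u)) has_real_derivative ?u (z + s *\<^sub>R u)) (at s)" if "\<bar>s\<bar> < e" for s
    unfolding has_real_derivative_iff_has_vector_derivative
    by (intro has_vector_derivative_line smooth_on_differentiable[OF f] inS that)
  have g'': "((\<lambda>s. ?u (z + s *\<^sub>R u)) has_real_derivative fd ?u z u) (at 0)"
    using has_vector_derivative_line[of ?u z 0 u] smooth_on_differentiable[OF smooth_on_frechet[OF f] z]
    by (simp add: has_real_derivative_iff_has_vector_derivative)
  have "?u z = 0"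
  proof (rule DERIV_local_max[of "\<lambda>s. f (z + s *\<^sub>R u)" _ 0])
    show "((\<lambda>s. f (z + s *\<^sub>R u)) has_real_derivative ?u z) (at 0)" using g'[of 0] e by simp
    show "\<forall>y. \<bar>0 - y\<bar> < e \<longrightarrow> f (z + y *\<^sub>R u) \<le> f (z + 0 *\<^sub>R u)" using max inS by auto
  qed (fact e)
  obtain d' where d': "d' > 0" "\<And>h. 0 < h \<Longrightarrow> h < d' \<Longrightarrow> ?u z < ?u (z + h *\<^sub>R u)"
    using DERIV_pos_inc_right[OF g''] * by auto
  define t where "t = min e d' / 2"
  have t: "0 < t" "t < e" "t < d'" using e d' by (auto simp: t_def)
  have "\<exists>s>0. s < t \<and> f (z + t *\<^sub>R u) - f (z + 0 *\<^sub>R u) = (t - 0) * ?u (z + s *\<^sub>R u)"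
    by (rule MVT2[OF t(1)]) (use g' t in auto)
  then obtain s where s: "0 < s" "s < t" "f (z + t *\<^sub>R u) - f z = t * ?u (z + s *\<^sub>R u)" by auto
  then have "f (z + t *\<^sub>R u) - f z > 0" using d'(2)[of s] t \<open>?u z = 0\<close> by simp
  then show False using max[OF inS[of t]] t by simp
qed

text \<open>Both Wirtinger derivatives at once: \<open>a = -\<i>\<close> gives \<^const>\<open>dz\<close>, \<open>a = \<i>\<close> gives \<^const>\<open>dzbar\<close>.\<close>

definition wirt :: "complex \<Rightarrow> 'n::finite \<Rightarrow> (complex^'n \<Rightarrow> complex) \<Rightarrow> complex^'n \<Rightarrow> complex" where
  "wirt a i f z = (fd f z (axis i 1) + a * fd f z (axis i \<i>)) / 2"

lemma dz_wirt: "dz i f z = wirt (- \<i>) i f z"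
  by (simp add: dz_def wirt_def)

lemma dzbar_wirt: "dzbar i f z = wirt \<i> i f z"
  by (simp add: dzbar_def wirt_def)

abbreviation "wdz \<equiv> wirt (- \<i>)"
abbreviation "wdzbar \<equiv> wirt \<i>"

lemma wirt_cong_open:
  "open S \<Longrightarrow> z \<in> S \<Longrightarrow> (\<And>y. y \<in> S \<Longrightarrow> f y = g y) \<Longrightarrow> wirt a i f z = wirt a i g z"
  using frechet_derivative_cong_open[of S z f g] by (simp add: wirt_def)

lemma wirt_const: "wirt a i (\<lambda>z. c) z = 0"
  by (simp add: wirt_def)

lemma wirt_add:
  assumes "f differentiable (at z)" "g differentiable (at z)"
  shows "wirt a i (\<lambda>z. f z + g z) z = wirt a i f z + wirt a i g z"
  using frechet_derivative_eqI[OF has_derivative_add[OF assms[unfolded frechet_derivative_works]]]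
  by (simp add: wirt_def field_simps)

lemma wirt_mult:
  assumes "f differentiable (at z)" "g differentiable (at z)"
  shows "wirt a i (\<lambda>z. f z * g z) z = wirt a i f z * g z + f z * wirt a i g z"
  using frechet_derivative_eqI[OF has_derivative_mult[OF assms[unfolded frechet_derivative_works]]]
  by (simp add: wirt_def field_simps)

lemma wirt_diff:
  assumes "f differentiable (at z)" "g differentiable (at z)"
  shows "wirt a i (\<lambda>z. f z - g z) z = wirt a i f z - wirt a i g z"
  using frechet_derivative_eqI[OF has_derivative_diff[OF assms[unfolded frechet_derivative_works]]]
  by (simp add: wirt_def field_simps)

lemma wirt_cnj:
  assumes "f differentiable (at z)"
  shows "wirt a i (\<lambda>z. cnj (f z)) z = cnj (wirt (cnj a) i f z)"
  using frechet_derivative_bounded_linear[OF bounded_linear_cnj assms]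
  by (simp add: wirt_def)

lemma wirt_sum:
  assumes "\<And>j. j \<in> J \<Longrightarrow> f j differentiable (at z)"
  shows "wirt a i (\<lambda>z. \<Sum>j\<in>J. f j z) z = (\<Sum>j\<in>J. wirt a i (f j) z)"
  using assms
proof (induction J rule: infinite_finite_induct)
  case (insert x F)
  then have "(\<lambda>z. \<Sum>j\<in>F. f j z) differentiable (at z)" by (intro differentiable_sum) auto
  then show ?case using insert by (simp add: wirt_add)
qed (simp_all add: wirt_const)

lemma wirt_prod:
  assumes "finite J" "\<And>j. j \<in> J \<Longrightarrow> f j differentiable (at z)"
  shows "wirt a i (\<lambda>z. \<Prod>j\<in>J. f j z) z = (\<Sum>j\<in>J. wirt a i (f j) z * (\<Prod>k\<in>J-{j}. f k z))"
  using assms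
proof (induction J)
  case (insert x F)
  have d: "(\<lambda>z. \<Prod>j\<in>F. f j z) differentiable (at z)"
    unfolding differentiable_def
    using has_derivative_prod[of F f "\<lambda>j. fd (f j) z" z UNIV] insert
    by (auto simp: frechet_derivative_works)
  have "(\<Sum>j\<in>insert x F. wirt a i (f j) z * (\<Prod>k\<in>insert x F-{j}. f k z))
    = wirt a i (f x) z * (\<Prod>k\<in>F. f k z) + (\<Sum>j\<in>F. wirt a i (f j) z * (\<Prod>k\<in>insert x F-{j}. f k z))"
    using insert by (simp add: insert_Diff_if)
  also have "(\<Sum>j\<in>F. wirt a i (f j) z * (\<Prod>k\<in>insert x F-{j}. f k z)) = (\<Sum>j\<in>F. f x z * (wirt a i (f j) z * (\<Prod>k\<in>F-{j}. f k z)))"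
    using insert by (intro sum.cong) (auto simp: insert_Diff_if)
  finally show ?case using insert d by (simp add: wirt_mult sum_distrib_left)
qed (simp add: wirt_const)

text \<open>The factor \<open>(1 + a * \<i>) / 2\<close> is 1 for \<open>wdz\<close> and 0 for
  \<open>wdzbar\<close>.\<close>

lemma wirt_component:
  "wirt a i (\<lambda>z. z $ j) z = (if i = j then (1 + a * \<i>) / 2 else 0)"
  using frechet_derivative_eqI[OF bounded_linear_imp_has_derivative[OF bounded_linear_vec_nth[of j]], of z]
  by (simp add: wirt_def axis_def)

lemma differentiable_component: "(\<lambda>z::complex^'n. z $ j) differentiable F"
  unfolding differentiable_def
  using bounded_linear_imp_has_derivative[OF bounded_linear_vec_nth[of j]] by blast

lemma differentiable_cnj: "f differentiable (at z) \<Longrightarrow> (\<lambda>z. cnj (f z)) differentiable (at z)"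
  unfolding differentiable_def using bounded_linear.has_derivative[OF bounded_linear_cnj] by blast

lemma smooth_on_wirt: "open S \<Longrightarrow> smooth_on S f \<Longrightarrow> smooth_on S (wirt a i f)"
  unfolding wirt_def[abs_def]
  by (rule smooth_on_divide) (auto intro!: smooth_on_add smooth_on_mult smooth_on_const smooth_on_frechet)

text \<open>Expanding into real second derivatives lets their symmetry carry over to any two
  Wirtinger derivatives.\<close>

lemma wirt_wirt:
  assumes S: "open S" and f: "smooth_on S f" and z: "z \<in> S"
  shows "wirt a i (wirt b j f) z
    = (fd (\<lambda>x. fd f x (axis j 1)) z (axis i 1)
     + b * fd (\<lambda>x. fd f x (axis j \<i>)) z (axis i 1)
     + a * (fd (\<lambda>x. fd f x (axis j 1)) z (axis i \<i>)
     + b * fd (\<lambda>x. fd f x (axis j \<i>)) z (axis i \<i>))) / 4"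
proof -
  have "fd (\<lambda>z. fd f z u / 2 + b * fd f z v / 2) z w
    = fd (\<lambda>x. fd f x u) z w / 2
    + b * fd (\<lambda>x. fd f x v) z w / 2" for u v w
  proof -
    have d: "((\<lambda>x. fd f x u) has_derivative
        fd (\<lambda>x. fd f x u) z) (at z)" for u
      using smooth_on_differentiable[OF smooth_on_frechet[OF f] z] by (simp add: frechet_derivative_works)
    have "((\<lambda>z. fd f z u / 2 + b * fd f z v / 2) has_derivative
       (\<lambda>w. fd (\<lambda>x. fd f x u) z w / 2
    + b * fd (\<lambda>x. fd f x v) z w / 2)) (at z)"
      using d[of u] d[of v] by (auto intro!: derivative_eq_intros)
    from frechet_derivative_eqI[OF this] show ?thesis by simp
  qed
  note D = this
  have w: "wirt b j f = (\<lambda>z. fd f z (axis j 1) / 2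
      + b * fd f z (axis j \<i>) / 2)"
    by (rule ext) (simp add: wirt_def add_divide_distrib)
  show ?thesis
    unfolding w wirt_def[of a i] D by (simp add: algebra_simps add_divide_distrib)
qed

lemma wirt_commute:
  assumes S: "open S" and f: "smooth_on S f" and z: "z \<in> S"
  shows "wirt a i (wirt b j f) z = wirt b j (wirt a i f) z"
  unfolding wirt_wirt[OF assms]
    second_derivative_commute[OF assms, of "axis j 1" "axis i 1"]
    second_derivative_commute[OF assms, of "axis j \<i>" "axis i 1"]
    second_derivative_commute[OF assms, of "axis j 1" "axis i \<i>"]
    second_derivative_commute[OF assms, of "axis j \<i>" "axis i \<i>"]
  by (simp add: algebra_simps)

section \<open>Integration by parts and the fundamental lemma\<close>

lemma integrable_compact_support:
  fixes f :: "'a::euclidean_space \<Rightarrow> complex"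
  assumes "continuous_on UNIV f" "compact K" "\<And>x. x \<notin> K \<Longrightarrow> f x = 0"
  shows "integrable lborel f"
proof -
  have "integrable lborel (\<lambda>x. indicator K x *\<^sub>R f x)"
    using assms by (intro borel_integrable_compact) (auto intro: continuous_on_subset)
  moreover have "(\<lambda>x. indicator K x *\<^sub>R f x) = f"
    using assms(3) by (auto simp: indicator_def)
  ultimately show ?thesis by simp
qed

lemma frechet_zero_outside:
  assumes "compact K" "\<And>x. x \<notin> K \<Longrightarrow> f x = 0" "x \<notin> K"
  shows "fd f x v = 0"
proof -
  have "open (- K)" using assms(1) by (simp add: compact_imp_closed open_Compl)
  then have "fd f x = fd (\<lambda>x. 0) x"
    by (rule frechet_derivative_cong_open) (use assms in auto)
  then show ?thesis by simp
qed

lemma integral_translate: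
  fixes f :: "'a::euclidean_space \<Rightarrow> complex"
  assumes "continuous_on UNIV f"
  shows "integral\<^sup>L lborel (\<lambda>x. f (c + x)) = integral\<^sup>L lborel f"
proof -
  have "f \<in> borel_measurable borel" by (rule borel_measurable_continuous_onI[OF assms])
  then have "integral\<^sup>L (distr lborel borel ((+) c)) f = integral\<^sup>L lborel (\<lambda>x. f (c + x))"
    by (intro integral_distr) auto
  then show ?thesis by (simp add: lborel_distr_plus)
qed

text \<open>Each difference quotient of f has integral 0 by translation invariance of Lebesgue
  measure, and dominated convergence passes this on to the derivative along v, without iterated
  integrals.\<close>

lemma integral_derivative_eq_0:
  fixes f :: "'a::euclidean_space \<Rightarrow> complex"
  assumes f: "smooth_on UNIV f" and K: "compact K" and 0: "\<And>x. x \<notin> K \<Longrightarrow> f x = 0"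
  shows "integral\<^sup>L lborel (\<lambda>x. fd f x v) = 0"
proof -
  let ?h = "\<lambda>x. fd f x v"
  have ch: "continuous_on UNIV ?h" and cf: "continuous_on UNIV f"
    using f by (auto intro: smooth_on_continuous smooth_on_frechet)
  have "bounded (?h ` K)" using ch K by (intro compact_imp_bounded compact_continuous_image) (auto intro: continuous_on_subset)
  then obtain B where B: "\<And>x. x \<in> K \<Longrightarrow> norm (?h x) \<le> B" "B > 0" unfolding bounded_pos by auto
  have Bh: "norm (?h x) \<le> B" for x
    using B frechet_zero_outside[OF K 0] by (cases "x \<in> K") auto
  define t where "t n = inverse (real (Suc n))" for n
  have t: "t n > 0" "t n \<le> 1" for n by (auto simp: t_def field_simps)
  have t0: "t \<longlonglongrightarrow> 0" unfolding t_def by (rule LIMSEQ_inverse_real_of_nat)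
  \<comment> \<open>If x + s v lies in K for some s in [0,1], then x lies in \<open>K'\<close>.
    Hence all the difference quotients vanish off \<open>K \<union> K'\<close>, where the constant B
    dominates them by the mean value theorem.\<close>
  define K' where "K' = (\<lambda>(x, s). x - s *\<^sub>R v) ` (K \<times> {0..1})"
  have K': "compact K'" unfolding K'_def
    by (intro compact_continuous_image compact_Times K) (auto simp: case_prod_unfold intro!: continuous_intros)
  have bnd: "norm (f (t n *\<^sub>R v + x) - f x) \<le> t n * B" for x n
  proof -
    have "\<exists>s\<in>{0<..<t n}. norm (f (x + t n *\<^sub>R v) - f (x + 0 *\<^sub>R v)) \<le> norm ((t n - 0) *\<^sub>R ?h (x + s *\<^sub>R v))"
    proof (rule mvt_general[OF t(1)])
      have d: "((\<lambda>s. f (x + s *\<^sub>R v)) has_derivative (\<lambda>r. r *\<^sub>R ?h (x + s *\<^sub>R v))) (at s)" for s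
        using has_vector_derivative_line[OF smooth_on_differentiable[OF f]]
        unfolding has_vector_derivative_def by auto
      then show "((\<lambda>s. f (x + s *\<^sub>R v)) has_derivative (\<lambda>r. r *\<^sub>R ?h (x + s *\<^sub>R v))) (at s)" for s .
      show "continuous_on {0..t n} (\<lambda>s. f (x + s *\<^sub>R v))"
        using d by (meson continuous_at_imp_continuous_on has_derivative_continuous)
    qed
    then obtain s where "norm (f (x + t n *\<^sub>R v) - f x) \<le> t n * norm (?h (x + s *\<^sub>R v))"
      using t(1)[of n] by auto
    also have "\<dots> \<le> t n * B" using t(1)[of n] Bh by (intro mult_left_mono) auto
    finally show ?thesis by (simp add: add.commute)
  qed
  have int1: "integrable lborel (\<lambda>x. f (c + x))" for c
  proof (rule integrable_compact_support[where K="(\<lambda>x. x - c) ` K"])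
    show "continuous_on UNIV (\<lambda>x. f (c + x))" by (intro continuous_on_compose2[OF cf] continuous_intros) auto
    show "compact ((\<lambda>x. x - c) ` K)" by (intro compact_continuous_image continuous_intros K)
    show "f (c + x) = 0" if "x \<notin> (\<lambda>x. x - c) ` K" for x
      using that by (intro 0) (auto simp: image_iff algebra_simps)
  qed
  have intf: "integrable lborel f" using int1[of 0] by simp
  define s where "s n x = (f (t n *\<^sub>R v + x) - f x) /\<^sub>R t n" for n x
  have "(\<lambda>n. integral\<^sup>L lborel (s n)) \<longlonglongrightarrow> integral\<^sup>L lborel ?h"
  proof (rule integral_dominated_convergence)
    show "?h \<in> borel_measurable lborel" using borel_measurable_continuous_onI[OF ch] by simp
    show "s n \<in> borel_measurable lborel" for n unfolding s_def using int1 intf by measurable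
    show "integrable lborel (\<lambda>x. indicator (K \<union> K') x *\<^sub>R B)"
      using borel_integrable_compact[of "K \<union> K'" "\<lambda>x. B"] K K' by auto
    show "AE x in lborel. (\<lambda>n. s n x) \<longlonglongrightarrow> ?h x"
    proof (rule AE_I2)
      fix x
      have "((\<lambda>r. f (x + r *\<^sub>R v)) has_vector_derivative ?h x) (at 0)"
        using has_vector_derivative_line[of f x 0 v] smooth_on_differentiable[OF f] by simp
      then have "((\<lambda>y. norm (f (x + y *\<^sub>R v) - f x - y *\<^sub>R ?h x) / norm y) \<longlongrightarrow> 0) (at 0)"
        by (simp add: has_vector_derivative_def has_derivative_iff_norm)
      moreover have "norm (f (x + y *\<^sub>R v) - f x - y *\<^sub>R ?h x) / norm y
          = norm ((f (x + y *\<^sub>R v) - f x) /\<^sub>R y - ?h x)" if "y \<noteq> 0" for y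
      proof -
        have "f (x + y *\<^sub>R v) - f x - y *\<^sub>R ?h x = y *\<^sub>R ((f (x + y *\<^sub>R v) - f x) /\<^sub>R y - ?h x)"
          using that by (simp add: scaleR_diff_right)
        then show ?thesis using that by simp
      qed
      ultimately have "((\<lambda>y. norm ((f (x + y *\<^sub>R v) - f x) /\<^sub>R y - ?h x)) \<longlongrightarrow> 0) (at 0)"
        by (rule_tac Lim_transform_eventually) (auto simp: eventually_at_filter)
      then have "((\<lambda>y. (f (x + y *\<^sub>R v) - f x) /\<^sub>R y) \<longlongrightarrow> ?h x) (at 0)"
        by (rule LIM_zero_cancel[OF tendsto_norm_zero_cancel])
      moreover have "filterlim t (at 0) sequentially"
        using t0 t(1) by (simp add: filterlim_at less_imp_neq[symmetric])
      ultimately have "(\<lambda>n. (f (x + t n *\<^sub>R v) - f x) /\<^sub>R t n) \<longlonglongrightarrow> ?h x"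
        by (rule filterlim_compose)
      then show "(\<lambda>n. s n x) \<longlonglongrightarrow> ?h x" by (simp add: s_def add.commute)
    qed
    show "AE x in lborel. norm (s n x) \<le> indicator (K \<union> K') x *\<^sub>R B" for n
    proof (rule AE_I2)
      fix x
      show "norm (s n x) \<le> indicator (K \<union> K') x *\<^sub>R B"
      proof (cases "x \<in> K \<union> K'")
        case True
        have "norm (s n x) = norm (f (t n *\<^sub>R v + x) - f x) / t n"
          using t(1)[of n] by (simp add: s_def divide_inverse)
        also have "\<dots> \<le> B" using bnd[of n x] t(1)[of n] by (simp add: field_simps)
        finally show ?thesis using True by simp
      next
        case False
        have "t n *\<^sub>R v + x \<notin> K"
        proof
          assume *: "t n *\<^sub>R v + x \<in> K"
          have "x = (\<lambda>(x, s). x - s *\<^sub>R v) (t n *\<^sub>R v + x, t n)" by simp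
          moreover have "(t n *\<^sub>R v + x, t n) \<in> K \<times> {0..1}"
            using * t(1)[of n] t(2)[of n] by simp
          ultimately have "x \<in> K'" unfolding K'_def by (rule image_eqI)
          then show False using False by simp
        qed
        then show ?thesis using False 0 by (simp add: s_def)
      qed
    qed
  qed
  moreover have "integral\<^sup>L lborel (s n) = 0" for n
  proof -
    have "integral\<^sup>L lborel (s n) = (integral\<^sup>L lborel (\<lambda>x. f (t n *\<^sub>R v + x)) - integral\<^sup>L lborel f) /\<^sub>R t n"
      unfolding s_def using int1 intf by simp
    then show ?thesis using integral_translate[OF cf] by simp
  qed
  ultimately show ?thesis by (simp add: LIMSEQ_const_iff)
qed

text \<open>W and the complement of K are open and cover the space, and f is 0 on the second of
  them.\<close>

lemma smooth_on_zero_extension: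
  assumes W: "open W" and f: "smooth_on W f" and K: "compact K" "K \<subseteq> W" and 0: "\<And>x. x \<notin> K \<Longrightarrow> f x = 0"
  shows "smooth_on UNIV f"
proof -
  have o: "open (- K)" using K(1) by (simp add: compact_imp_closed open_Compl)
  have "smooth_on (- K) f"
    by (rule smooth_on_cong[OF o _ smooth_on_const[of _ 0]]) (use 0 in auto)
  then have "smooth_on (W \<union> - K) f" by (rule smooth_on_Un[OF W o f])
  moreover have "W \<union> - K = UNIV" using K by auto
  ultimately show ?thesis by simp
qed

lemma wirt_zero_outside:
  assumes "compact K" "\<And>x. x \<notin> K \<Longrightarrow> f x = 0" "x \<notin> K"
  shows "wirt a i f x = 0"
  using frechet_zero_outside[OF assms] by (simp add: wirt_def)

abbreviation "lint \<equiv> set_lebesgue_integral lborel"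

lemma set_integral_eq_integral:
  assumes "\<And>x. x \<notin> W \<Longrightarrow> f x = 0"
  shows "lint W f = integral\<^sup>L lborel f"
  unfolding set_lebesgue_integral_def
  by (rule Bochner_Integration.integral_cong) (use assms in \<open>auto simp: indicator_def\<close>)

lemma set_integrable_compact:
  fixes f :: "'a::euclidean_space \<Rightarrow> complex"
  assumes W: "open W" and f: "continuous_on W f" and K: "compact K" "K \<subseteq> W" and 0: "\<And>x. x \<notin> K \<Longrightarrow> f x = 0"
  shows "set_integrable lborel W f"
proof -
  have "integrable lborel (\<lambda>x. indicator K x *\<^sub>R f x)"
    using f K by (intro borel_integrable_compact) (auto intro: continuous_on_subset)
  moreover have "(\<lambda>x. indicator K x *\<^sub>R f x) = (\<lambda>x. indicator W x *\<^sub>R f x)"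
    using K 0 by (auto simp: indicator_def fun_eq_iff)
  ultimately show ?thesis by (simp add: set_integrable_def)
qed

lemma integral_wirt_eq_0:
  fixes f :: "complex^'n::finite \<Rightarrow> complex"
  assumes f: "smooth_on UNIV f" and K: "compact K" and 0: "\<And>x. x \<notin> K \<Longrightarrow> f x = 0"
  shows "integral\<^sup>L lborel (wirt a i f) = 0"
proof -
  have i: "integrable lborel (\<lambda>x. fd f x v)" for v
    by (rule integrable_compact_support[OF smooth_on_continuous[OF smooth_on_frechet[OF f]] K])
       (rule frechet_zero_outside[OF K 0])
  show ?thesis
    unfolding wirt_def[abs_def]
    using i[of "axis i 1"] i[of "axis i \<i>"] integral_derivative_eq_0[OF f K 0]
    by simp
qed

text \<open>F is smooth only on W, but the product of F and b extends by zero to a smooth function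
  with compact support, whose derivative integrates to 0. So no boundary term appears.\<close>

lemma integration_by_parts:
  fixes F b :: "complex^'n::finite \<Rightarrow> complex"
  assumes W: "open W" and F: "smooth_on W F" and b: "smooth_on W b"
    and K: "compact K" "K \<subseteq> W" and 0: "\<And>x. x \<notin> K \<Longrightarrow> b x = 0"
  shows "lint W (\<lambda>z. F z * wirt a i b z)
    = - lint W (\<lambda>z. wirt a i F z * b z)"
proof -
  have Fb: "smooth_on W (\<lambda>z. F z * b z)" using W F b by (rule smooth_on_mult)
  have Fb0: "F z * b z = 0" if "z \<notin> K" for z using that 0 by simp
  have prod: "F z * wirt a i b z = wirt a i (\<lambda>z. F z * b z) z - wirt a i F z * b z" if "z \<in> W" for z
    using wirt_mult[OF smooth_on_differentiable[OF F that] smooth_on_differentiable[OF b that]]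
    by simp
  have "lint W (\<lambda>z. F z * wirt a i b z)
     = lint W (\<lambda>z. wirt a i (\<lambda>z. F z * b z) z - wirt a i F z * b z)"
    using W prod by (intro set_lebesgue_integral_cong) auto
  also have "\<dots> = lint W (wirt a i (\<lambda>z. F z * b z))
      - lint W (\<lambda>z. wirt a i F z * b z)"
  proof (rule set_integral_diff)
    show "set_integrable lborel W (wirt a i (\<lambda>z. F z * b z))"
      by (rule set_integrable_compact[OF W smooth_on_continuous[OF smooth_on_wirt[OF W Fb]] K])
         (rule wirt_zero_outside[OF K(1) Fb0])
    show "set_integrable lborel W (\<lambda>z. wirt a i F z * b z)"
      by (rule set_integrable_compact[OF W _ K])
         (use 0 in \<open>auto intro!: smooth_on_continuous smooth_on_mult smooth_on_wirt W F b\<close>)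
  qed
  also have "lint W (wirt a i (\<lambda>z. F z * b z)) = 0"
  proof -
    have "wirt a i (\<lambda>z. F z * b z) x = 0" if "x \<notin> W" for x
      using wirt_zero_outside[of K "\<lambda>z. F z * b z", OF K(1) Fb0] K(2) that by auto
    then have "lint W (wirt a i (\<lambda>z. F z * b z)) = integral\<^sup>L lborel (wirt a i (\<lambda>z. F z * b z))"
      by (rule set_integral_eq_integral)
    also have "\<dots> = 0"
      using smooth_on_zero_extension[OF W Fb K Fb0] K(1) Fb0 by (rule integral_wirt_eq_0)
    finally show ?thesis .
  qed
  finally show ?thesis by simp
qed

section \<open>The fundamental lemma of the calculus of variations\<close>

lemma continuous_nonneg_integral_pos:
  fixes f :: "'a::euclidean_space \<Rightarrow> real"
  assumes f: "continuous_on UNIV f" and i: "integrable lborel f" and nn: "\<And>x. f x \<ge> 0" and z: "f z > 0"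
  shows "integral\<^sup>L lborel f \<noteq> 0"
proof
  assume "integral\<^sup>L lborel f = 0"
  then have "AE x in lborel. f x = 0" using integral_nonneg_eq_0_iff_AE[OF i] nn by simp
  moreover have o: "open {x. f x > 0}" using open_Collect_less[OF continuous_on_const f, of 0] by simp
  ultimately have "{x. f x > 0} \<in> null_sets lborel"
    by (subst AE_iff_null_sets) (auto elim!: eventually_mono)
  then have "negligible {x. f x > 0}"
    by (simp add: negligible_iff_null_sets null_sets_completionI)
  then show False using open_not_negligible[OF o] z by auto
qed

lemma fundamental_lemma:
  fixes F :: "complex^'n::finite \<Rightarrow> complex"
  assumes W: "open W" and F: "smooth_on W F" and z0: "z0 \<in> W"
    and int: "\<And>b K. smooth_on W b \<Longrightarrow> compact K \<Longrightarrow> K \<subseteq> W \<Longrightarrow> (\<And>x. x \<notin> K \<Longrightarrow> b x = 0) \<Longrightarrow>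
      lint W (\<lambda>z. F z * cnj (b z)) = 0"
  shows "F z0 = 0"
proof (rule ccontr)
  assume nz: "F z0 \<noteq> 0"
  obtain r where r: "r > 0" "cball z0 r \<subseteq> W" using W z0 open_contains_cball by blast
  obtain \<phi> where phi: "smooth_on UNIV \<phi>" "\<And>z. \<phi> z \<ge> 0" "\<phi> z0 > 0" "\<And>z. z \<notin> cball z0 r \<Longrightarrow> \<phi> z = (0::real)"
    using smooth_bump[OF r(1), of z0] by blast
  \<comment> \<open>Testing F against \<phi> F gives the integrand \<phi> |F|^2, which is
    nonnegative and positive at z0.\<close>
  define b where "b z = of_real (\<phi> z) * F z" for z
  have phi': "smooth_on W (\<lambda>z. complex_of_real (\<phi> z))"
    using smooth_on_bounded_linear[OF W bounded_linear_of_real smooth_on_subset[OF phi(1)]] by auto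
  have b: "smooth_on W b" unfolding b_def[abs_def] by (rule smooth_on_mult[OF W phi' F])
  have b0: "b z = 0" if "z \<notin> cball z0 r" for z using phi(4)[OF that] by (simp add: b_def)
  define g where "g z = \<phi> z * (norm (F z))\<^sup>2" for z
  have gF: "F z * cnj (b z) = of_real (g z)" for z
    by (simp add: b_def g_def complex_norm_square[symmetric] mult_ac del: of_real_power)
  have "smooth_on W (\<lambda>z. F z * cnj (b z))" by (intro smooth_on_mult smooth_on_cnj W F b)
  then have "smooth_on UNIV (\<lambda>z. F z * cnj (b z))"
    by (rule smooth_on_zero_extension[OF W _ compact_cball r(2)]) (simp add: b0)
  then have "continuous_on UNIV (\<lambda>z. complex_of_real (g z))"
    unfolding gF by (rule smooth_on_continuous)
  then have "continuous_on UNIV (\<lambda>z. Re (complex_of_real (g z)))" by (rule continuous_on_Re)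
  then have cg: "continuous_on UNIV g" by simp
  have g0: "g z = 0" if "z \<notin> cball z0 r" for z using phi(4)[OF that] by (simp add: g_def)
  have ig: "integrable lborel g"
  proof -
    have "integrable lborel (\<lambda>x. indicator (cball z0 r) x *\<^sub>R g x)"
      using cg by (intro borel_integrable_compact) (auto intro: continuous_on_subset)
    moreover have "(\<lambda>x. indicator (cball z0 r) x *\<^sub>R g x) = g"
      using g0 by (auto simp: indicator_def fun_eq_iff)
    ultimately show ?thesis by simp
  qed
  have "lint W (\<lambda>z. F z * cnj (b z)) = 0"
    by (rule int[OF b compact_cball r(2) b0])
  moreover have "lint W (\<lambda>z. F z * cnj (b z)) = integral\<^sup>L lborel (\<lambda>z. complex_of_real (g z))"
  proof (unfold gF, rule set_integral_eq_integral)
    show "complex_of_real (g x) = 0" if "x \<notin> W" for x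
    proof -
      have "x \<notin> cball z0 r" using r(2) that by blast
      then show ?thesis by (simp add: g0 del: mem_cball)
    qed
  qed
  ultimately have "integral\<^sup>L lborel g = 0" by simp
  moreover have "g z0 > 0" using phi(3) nz by (simp add: g_def)
  moreover have "g z \<ge> 0" for z using phi(2) by (simp add: g_def)
  ultimately show False using continuous_nonneg_integral_pos[OF cg ig] by blast
qed

section \<open>Hermitian matrices\<close>

definition hform :: "complex^'n^'n \<Rightarrow> complex^'n \<Rightarrow> complex^'n \<Rightarrow> complex" where
  "hform P u v = (\<Sum>i\<in>UNIV. \<Sum>j\<in>UNIV. P $ i $ j * u $ i * cnj (v $ j))"

lemma hermitian_posdefD:
  assumes "hermitian_posdef P"
  shows "P $ j $ i = cnj (P $ i $ j)" "v \<noteq> 0 \<Longrightarrow> 0 < Re (hform P v v)"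
  using assms unfolding hermitian_posdef_def hform_def by blast+

lemma hform_hermitian:
  assumes "hermitian_posdef P"
  shows "hform P v u = cnj (hform P u v)"
proof -
  have "hform P v u = (\<Sum>i\<in>UNIV. \<Sum>j\<in>UNIV. cnj (P $ j $ i * u $ j * cnj (v $ i)))"
    unfolding hform_def
  proof (intro sum.cong refl)
    fix i j
    show "P $ i $ j * v $ i * cnj (u $ j) = cnj (P $ j $ i * u $ j * cnj (v $ i))"
      unfolding hermitian_posdefD(1)[OF assms, of i j] by (simp add: mult_ac)
  qed
  also have "\<dots> = cnj (hform P u v)"
    unfolding hform_def by (subst sum.swap) simp
  finally show ?thesis .
qed

lemma hform_real: "hermitian_posdef P \<Longrightarrow> hform P v v = of_real (Re (hform P v v))"
  using hform_hermitian[of P v v] by (metis complex_cnj_cancel_iff of_real_Re Reals_cnj_iff)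

lemma hform_add_left: "hform P (u + w) v = hform P u v + hform P w v"
  by (simp add: hform_def algebra_simps sum.distrib)

lemma hform_diff_left: "hform P (u - w) v = hform P u v - hform P w v"
  by (simp add: hform_def algebra_simps sum_subtractf)

lemma hform_scale_left: "hform P (c *s u) v = c * hform P u v"
  by (simp add: hform_def sum_distrib_left mult_ac)

lemma hform_scale_right: "hform P u (c *s v) = cnj c * hform P u v"
  by (simp add: hform_def sum_distrib_left mult_ac)

lemma hform_zero: "hform P 0 v = 0" "hform P v 0 = 0"
  by (simp_all add: hform_def)

lemma hform_sum_left: "hform P (\<Sum>a\<in>S. f a) v = (\<Sum>a\<in>S. hform P (f a) v)"
  by (induction S rule: infinite_finite_induct) (simp_all add: hform_zero hform_add_left)

text \<open>Gram-Schmidt along the index set. The second clause of the induction, that the vectors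
  built so far are supported in S, gives the new vector the coordinate 1 at c, so it is nonzero and
  can be normalized.\<close>

lemma orthonormal_frame_exists:
  fixes P :: "complex^'n::finite^'n"
  assumes P: "hermitian_posdef P"
  obtains e :: "'n \<Rightarrow> complex^'n" where "\<And>a b. hform P (e a) (e b) = (if a = b then 1 else 0)"
proof -
  have "\<exists>e. (\<forall>a\<in>S. \<forall>b\<in>S. hform P (e a) (e b) = (if a = b then 1 else 0)) \<and>
      (\<forall>a\<in>S. \<forall>i. i \<notin> S \<longrightarrow> e a $ i = 0)" for S :: "'n set"
    using finite[of S]
  proof (induction S)
    case (insert c S)
    then obtain e where e: "\<And>a b. a \<in> S \<Longrightarrow> b \<in> S \<Longrightarrow> hform P (e a) (e b) = (if a = b then 1 else 0)"
      "\<And>a i. a \<in> S \<Longrightarrow> i \<notin> S \<Longrightarrow> e a $ i = 0" by metis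
    define u where "u = axis c 1 - (\<Sum>a\<in>S. hform P (axis c 1) (e a) *s e a)"
    have ue: "hform P u (e b) = 0" if "b \<in> S" for b
    proof -
      have "(\<Sum>a\<in>S. hform P (axis c 1) (e a) * hform P (e a) (e b))
          = (\<Sum>a\<in>S. if a = b then hform P (axis c 1) (e b) else 0)"
        using e that by (intro sum.cong) auto
      then show ?thesis
        using insert.hyps that by (simp add: u_def hform_diff_left hform_sum_left hform_scale_left)
    qed
    have uc: "u $ c = 1" using insert.hyps e(2) by (simp add: u_def axis_def)
    then have "u \<noteq> 0" by auto
    then have pos: "Re (hform P u u) > 0" by (rule hermitian_posdefD(2)[OF P])
    define k where "k = complex_of_real (1 / sqrt (Re (hform P u u)))"
    have kk: "k * (cnj k * hform P u u) = 1"
    proof -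
      have "k * cnj k = of_real (1 / Re (hform P u u))"
      proof -
        have "1 / sqrt (Re (hform P u u)) * (1 / sqrt (Re (hform P u u))) = 1 / Re (hform P u u)"
          using pos by simp
        then show ?thesis unfolding k_def complex_cnj_complex_of_real of_real_mult[symmetric] by simp
      qed
      then have "k * cnj k * hform P u u = of_real (1 / Re (hform P u u) * Re (hform P u u))"
        unfolding of_real_mult using hform_real[OF P, of u] by simp
      then show ?thesis using pos by (simp add: mult.assoc)
    qed
    then have kk': "cnj k * (k * hform P u u) = 1" by (simp add: mult_ac)
    define e' where "e' = e(c := k *s u)"
    have "hform P (e' a) (e' b) = (if a = b then 1 else 0)" if "a \<in> insert c S" "b \<in> insert c S" for a b
      using that insert.hyps e(1) ue kk kk' hform_hermitian[OF P, of "e _" u]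
      by (auto simp: e'_def hform_scale_left hform_scale_right)
    moreover have "e' a $ i = 0" if "a \<in> insert c S" "i \<notin> insert c S" for a i
      using that insert.hyps e(2) by (auto simp: e'_def u_def axis_def)
    ultimately show ?case by blast
  qed auto
  from this[of UNIV] that show ?thesis by auto
qed

lemma sum_axis_delta:
  fixes f :: "'n::finite \<Rightarrow> complex"
  shows "(\<Sum>k\<in>UNIV. f k * (if k = i then 1 else 0)) = f i" "(\<Sum>k\<in>UNIV. (if k = i then 1 else 0) * f k) = f i"
    "(\<Sum>k\<in>UNIV. f k * (if i = k then 1 else 0)) = f i" "(\<Sum>k\<in>UNIV. (if i = k then 1 else 0) * f k) = f i"
  by (simp_all add: if_distrib if_distribR cong: if_cong)

lemma det_cnj: "det (\<chi> i j. cnj (A $ i $ j)) = cnj (det A)"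
  unfolding det_def by simp

lemma matrix_inv_eqI:
  fixes A B :: "complex^'n::finite^'n"
  assumes "A ** B = mat 1" "B ** A = mat 1"
  shows "matrix_inv A = B"
proof -
  have "A ** matrix_inv A = mat 1 \<and> matrix_inv A ** A = mat 1"
    unfolding matrix_inv_def by (rule someI[of _ B]) (use assms in simp)
  moreover have "matrix_inv A = (matrix_inv A ** A) ** B"
    unfolding matrix_mul_assoc[symmetric] assms by (rule matrix_mul_rid[symmetric])
  ultimately show ?thesis by (simp add: matrix_mul_lid)
qed

context
  fixes P :: "complex^'n::finite^'n" and e :: "'n \<Rightarrow> complex^'n"
  assumes P: "hermitian_posdef P"
    and e: "\<And>a b. hform P (e a) (e b) = (if a = b then 1 else 0)"
begin

private definition "E = (\<chi> a i. e a $ i)"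
private definition "E' = (\<chi> i a. cnj (e a $ i))"

text \<open>Orthonormality as a matrix identity, from which the inverse and the determinant of P are
  read off.\<close>

private lemma EPE: "E ** P ** E' = mat 1"
proof -
  have "(E ** P ** E') $ a $ b = hform P (e a) (e b)" for a b
    unfolding matrix_matrix_mult_def hform_def E_def E'_def
    by (simp add: sum_distrib_right sum_distrib_left mult_ac) (subst sum.swap, simp)
  then show ?thesis using e by (simp add: vec_eq_iff mat_def)
qed

lemma matrix_inv_frame: "matrix_inv P = E' ** E"
proof -
  have 1: "(P ** E') ** E = mat 1"
    using EPE matrix_left_right_inverse[of E "P ** E'"] by (simp add: matrix_mul_assoc)
  then have 2: "P ** (E' ** E) = mat 1" by (simp add: matrix_mul_assoc)
  then have "(E' ** E) ** P = mat 1" using matrix_left_right_inverse by blast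
  with 2 show ?thesis by (rule matrix_inv_eqI)
qed

text \<open>This is what turns a trace against the inverse metric into a sum over an orthonormal
  frame.\<close>

lemma matrix_inv_frame_component: "matrix_inv P $ l $ k = (\<Sum>a\<in>UNIV. cnj (e a $ l) * e a $ k)"
  unfolding matrix_inv_frame by (simp add: matrix_matrix_mult_def E_def E'_def)

text \<open>In this form the determinant is visibly real and positive, so its logarithm makes
  sense.\<close>

lemma det_frame: "det P = of_real (1 / (norm (det E))\<^sup>2)" "det E \<noteq> 0"
proof -
  have "det E' = cnj (det E)"
  proof -
    have "E' = transpose (\<chi> i j. cnj (E $ i $ j))" by (simp add: E_def E'_def transpose_def)
    then show ?thesis by (simp add: det_transpose det_cnj)
  qed
  then have d: "det E * det P * cnj (det E) = 1"
    using arg_cong[OF EPE, of det] by (simp add: det_mul)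
  then show "det E \<noteq> 0" by auto
  have "det P * of_real ((norm (det E))\<^sup>2) = 1"
    unfolding complex_norm_square using d by (simp add: mult_ac)
  then show "det P = of_real (1 / (norm (det E))\<^sup>2)"
    using \<open>det E \<noteq> 0\<close> by (simp add: nonzero_eq_divide_eq)
qed

end

lemma hermitian_posdef_det:
  fixes P :: "complex^'n::finite^'n"
  assumes P: "hermitian_posdef P"
  shows "Re (det P) > 0" "det P = of_real (Re (det P))"
proof -
  obtain e :: "'n \<Rightarrow> complex^'n" where e: "\<And>a b. hform P (e a) (e b) = (if a = b then 1 else 0)"
    using orthonormal_frame_exists[OF P] by blast
  show "Re (det P) > 0" "det P = of_real (Re (det P))"
    using det_frame[of P e, OF P e] by (simp_all del: of_real_divide of_real_power)
qed

lemma hermitian_posdef_invertible: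
  fixes P :: "complex^'n::finite^'n"
  assumes P: "hermitian_posdef P"
  shows "det P \<noteq> 0" "P ** matrix_inv P = mat 1" "matrix_inv P ** P = mat 1"
proof -
  show "det P \<noteq> 0" using hermitian_posdef_det[OF P] by auto
  then have "invertible P" by (simp add: invertible_det_nz)
  then obtain B where "P ** B = mat 1" "B ** P = mat 1" by (auto simp: invertible_def)
  then show "P ** matrix_inv P = mat 1" "matrix_inv P ** P = mat 1"
    using matrix_inv_eqI by auto
qed

lemma matrix_inv_sum:
  fixes P :: "complex^'n::finite^'n"
  assumes P: "hermitian_posdef P"
  shows "(\<Sum>k\<in>UNIV. P $ i $ k * matrix_inv P $ k $ j) = (if i = j then 1 else 0)"
    "(\<Sum>k\<in>UNIV. matrix_inv P $ i $ k * P $ k $ j) = (if i = j then 1 else 0)"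
  using arg_cong[OF hermitian_posdef_invertible(2)[OF P], of "\<lambda>A. A $ i $ j"]
    arg_cong[OF hermitian_posdef_invertible(3)[OF P], of "\<lambda>A. A $ i $ j"]
  by (simp_all add: matrix_matrix_mult_def mat_def)

lemma sum_pair: "(\<Sum>x\<in>X. \<Sum>y\<in>Y. g x y) = (\<Sum>p\<in>X\<times>Y. g (fst p) (snd p))"
  by (simp add: sum.cartesian_product case_prod_unfold)

lemma sum_swap_pairs:
  "(\<Sum>x\<in>X. \<Sum>y\<in>Y. \<Sum>u\<in>U. \<Sum>v\<in>V. f x y u v) = (\<Sum>u\<in>U. \<Sum>v\<in>V. \<Sum>x\<in>X. \<Sum>y\<in>Y. f x y u v)"
proof -
  show ?thesis
    unfolding sum_pair[of "\<lambda>x y. \<Sum>u\<in>U. \<Sum>v\<in>V. f x y u v"] sum_pair[of "\<lambda>u v. \<Sum>x\<in>X. \<Sum>y\<in>Y. f x y u v"]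
    unfolding sum_pair[of "\<lambda>u v. f _ _ u v"] sum_pair[of "\<lambda>x y. f x y _ _"] by (rule sum.swap)
qed

text \<open>The Hermitian inner product that P induces on tensors with one holomorphic and one
  antiholomorphic lower index; the inverse metric raises both indices of A.\<close>

definition tensor_inner :: "complex^'n::finite^'n \<Rightarrow> ('n \<Rightarrow> 'n \<Rightarrow> complex) \<Rightarrow> ('n \<Rightarrow> 'n \<Rightarrow> complex) \<Rightarrow> complex" where
  "tensor_inner P A B = (\<Sum>k\<in>UNIV. \<Sum>l\<in>UNIV. \<Sum>m\<in>UNIV. \<Sum>n\<in>UNIV.
     matrix_inv P $ k $ m * A m n * matrix_inv P $ n $ l * cnj (B k l))"

lemma tensor_inner_diff:
  "tensor_inner P (\<lambda>m n. A m n - B m n) (\<lambda>m n. A m n - B m n)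
   = tensor_inner P A A - tensor_inner P A B - tensor_inner P B A + tensor_inner P B B"
  unfolding tensor_inner_def
  by (simp add: algebra_simps sum.distrib sum_subtractf)

text \<open>In an orthonormal frame this is the sum of the squares |t a b|^2 of the frame components
  of A.\<close>

lemma tensor_inner_nonneg:
  fixes P :: "complex^'n::finite^'n"
  assumes P: "hermitian_posdef P"
  shows "Re (tensor_inner P A A) \<ge> 0"
proof -
  obtain e :: "'n \<Rightarrow> complex^'n" where e: "\<And>a b. hform P (e a) (e b) = (if a = b then 1 else 0)"
    using orthonormal_frame_exists[OF P] by blast
  define t where "t a b = (\<Sum>m\<in>UNIV. \<Sum>n\<in>UNIV. e a $ m * A m n * cnj (e b $ n))" for a b
  have ex: "(\<Sum>a\<in>UNIV. x a) * c * (\<Sum>b\<in>UNIV. y b) * d = (\<Sum>a\<in>UNIV. \<Sum>b\<in>UNIV. x a * c * y b * d)"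
    for x y :: "'n \<Rightarrow> complex" and c d
    by (simp add: sum_distrib_left sum_distrib_right) (rule sum.swap)
  have "tensor_inner P A A = (\<Sum>k\<in>UNIV. \<Sum>l\<in>UNIV. \<Sum>m\<in>UNIV. \<Sum>n\<in>UNIV. \<Sum>a\<in>UNIV. \<Sum>b\<in>UNIV.
      (e a $ m * A m n * cnj (e b $ n)) * cnj (e a $ k * A k l * cnj (e b $ l)))"
    unfolding tensor_inner_def matrix_inv_frame_component[of P e, OF P e] ex
    by (simp add: mult_ac)
  also have "\<dots> = (\<Sum>k\<in>UNIV. \<Sum>l\<in>UNIV. \<Sum>a\<in>UNIV. \<Sum>b\<in>UNIV. \<Sum>m\<in>UNIV. \<Sum>n\<in>UNIV.
      (e a $ m * A m n * cnj (e b $ n)) * cnj (e a $ k * A k l * cnj (e b $ l)))"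
    by (intro sum.cong refl sum_swap_pairs)
  also have "\<dots> = (\<Sum>a\<in>UNIV. \<Sum>b\<in>UNIV. \<Sum>k\<in>UNIV. \<Sum>l\<in>UNIV. \<Sum>m\<in>UNIV. \<Sum>n\<in>UNIV.
      (e a $ m * A m n * cnj (e b $ n)) * cnj (e a $ k * A k l * cnj (e b $ l)))"
    by (rule sum_swap_pairs)
  also have "\<dots> = (\<Sum>a\<in>UNIV. \<Sum>b\<in>UNIV. t a b * cnj (t a b))"
    unfolding t_def cnj_sum by (simp only: sum_distrib_left sum_distrib_right)
  also have "\<dots> = of_real (\<Sum>a\<in>UNIV. \<Sum>b\<in>UNIV. (norm (t a b))\<^sup>2)"
    by (simp only: of_real_sum complex_norm_square)
  finally have "Re (tensor_inner P A A) = (\<Sum>a\<in>UNIV. \<Sum>b\<in>UNIV. (norm (t a b))\<^sup>2)"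
    by (metis Re_complex_of_real)
  then show ?thesis by (simp add: sum_nonneg)
qed

section \<open>Smooth Hermitian matrix fields\<close>

lemma smooth_on_det:
  fixes M :: "'a::real_normed_vector \<Rightarrow> complex^'n::finite^'n"
  assumes "open S" "\<And>i j. smooth_on S (\<lambda>z. M z $ i $ j)"
  shows "smooth_on S (\<lambda>z. det (M z))"
  unfolding det_def by (intro smooth_on_sum smooth_on_mult smooth_on_prod smooth_on_const assms)

lemma wirt_ln_Re:
  assumes W: "open W" and d: "smooth_on W d" and z: "z \<in> W"
    and re: "\<And>z. z \<in> W \<Longrightarrow> d z = of_real (Re (d z))" and pos: "\<And>z. z \<in> W \<Longrightarrow> Re (d z) > 0"
  shows "wirt a i (\<lambda>z. of_real (ln (Re (d z)))) z = wirt a i d z / d z"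
proof -
  have df: "(d has_derivative fd d z) (at z)"
    using smooth_on_differentiable[OF d z] by (simp add: frechet_derivative_works)
  have "((\<lambda>z. of_real (Re (d z)) :: complex) has_derivative (\<lambda>v. of_real (Re (fd d z v)))) (at z)"
    by (intro derivative_intros df)
  then have 1: "fd (\<lambda>z. of_real (Re (d z)) :: complex) z = (\<lambda>v. of_real (Re (fd d z v)))"
    by (rule frechet_derivative_eqI)
  have 2: "fd d z = fd (\<lambda>z. of_real (Re (d z))) z"
    by (rule frechet_derivative_cong_open[OF W z re])
  have r: "of_real (Re (fd d z v)) = fd d z v" for v
    by (rule fun_cong[OF trans[OF 2 1], of v, symmetric])
  have "((\<lambda>z. of_real (ln (Re (d z))) :: complex) has_derivative
      (\<lambda>v. of_real (Re (fd d z v) * inverse (Re (d z))))) (at z)"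
    using pos[OF z] by (auto intro!: derivative_eq_intros df simp: divide_inverse mult.commute)
  then have "fd (\<lambda>z. of_real (ln (Re (d z))) :: complex) z
      = (\<lambda>v. of_real (Re (fd d z v) * inverse (Re (d z))))"
    by (rule frechet_derivative_eqI)
  then have D: "fd (\<lambda>z. of_real (ln (Re (d z))) :: complex) z v = fd d z v / d z" for v
    by (simp add: divide_inverse r re[OF z, symmetric])
  show ?thesis unfolding wirt_def D by (simp add: add_divide_distrib mult.commute)
qed

locale hermitian_domain =
  fixes W :: "(complex^'n::finite) set" and G :: "'n lmetric"
  assumes open_W: "open W"
    and smooth_G: "\<And>i j. smooth_on W (\<lambda>z. G z $ i $ j)"
    and posdef: "\<And>z. z \<in> W \<Longrightarrow> hermitian_posdef (G z)"
begin

abbreviation "Gi z k l \<equiv> matrix_inv (G z) $ k $ l"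

lemma diff_G: "z \<in> W \<Longrightarrow> (\<lambda>z. G z $ i $ j) differentiable (at z)"
  using smooth_on_differentiable[OF smooth_G] .

lemma smooth_det_G: "smooth_on W (\<lambda>z. det (G z))"
  by (rule smooth_on_det[OF open_W smooth_G])

lemma det_G: "z \<in> W \<Longrightarrow> det (G z) \<noteq> 0"
  using hermitian_posdef_invertible(1)[OF posdef] .

text \<open>Cramer's rule exhibits the entries of the inverse as quotients of determinants in the
  entries of G, which shows that they are smooth.\<close>

lemma matrix_inv_cramer:
  assumes z: "z \<in> W"
  shows "Gi z k l = det (\<chi> i j. if j = k then axis l 1 $ i else G z $ i $ j) / det (G z)"
proof -
  define x where "x = (\<chi> k. Gi z k l)"
  have "G z *v x = axis l 1"
    using matrix_inv_sum(1)[OF posdef[OF z]]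
    by (simp add: vec_eq_iff matrix_vector_mult_def x_def axis_def eq_commute)
  then have "x = (\<chi> k. det (\<chi> i j. if j = k then axis l 1 $ i else G z $ i $ j) / det (G z))"
    using cramer[OF det_G[OF z]] by blast
  then have "x $ k = (\<chi> k. det (\<chi> i j. if j = k then axis l 1 $ i else G z $ i $ j) / det (G z)) $ k"
    by (rule arg_cong)
  then show ?thesis by (simp add: x_def)
qed

lemma smooth_inv_G: "smooth_on W (\<lambda>z. Gi z k l)"
proof (rule smooth_on_cong[OF open_W])
  show "smooth_on W (\<lambda>z. det (\<chi> i j. if j = k then axis l 1 $ i else G z $ i $ j) / det (G z))"
  proof (rule smooth_on_divide[OF open_W det_G _ smooth_det_G])
    show "smooth_on W (\<lambda>z. det ((\<chi> i j. if j = k then axis l 1 $ i else G z $ i $ j) :: complex^'n^'n))"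
    proof (rule smooth_on_det[OF open_W])
      fix i j
      show "smooth_on W (\<lambda>z. ((\<chi> i j. if j = k then axis l 1 $ i else G z $ i $ j) :: complex^'n^'n) $ i $ j)"
        by (cases "j = k") (simp_all add: smooth_on_const smooth_G)
    qed
  qed
qed (simp add: matrix_inv_cramer)

lemma diff_inv_G: "z \<in> W \<Longrightarrow> (\<lambda>z. Gi z k l) differentiable (at z)"
  using smooth_on_differentiable[OF smooth_inv_G] .

text \<open>Differentiate the identity that the inverse times G is 1, then multiply by the inverse
  from the right.\<close>

lemma wirt_inv_G:
  assumes z: "z \<in> W"
  shows "wirt a i (\<lambda>z. Gi z k l) z
    = - (\<Sum>m\<in>UNIV. \<Sum>n\<in>UNIV. Gi z k m * wirt a i (\<lambda>z. G z $ m $ n) z * Gi z n l)"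
proof -
  let ?I = "\<lambda>k l z. Gi z k l"
  have e: "(\<Sum>m\<in>UNIV. wirt a i (?I k m) z * G z $ m $ n) = - (\<Sum>m\<in>UNIV. ?I k m z * wirt a i (\<lambda>z. G z $ m $ n) z)" for n
  proof -
    have "wirt a i (\<lambda>z. \<Sum>m\<in>UNIV. ?I k m z * G z $ m $ n) z = wirt a i (\<lambda>z. if k = n then 1 else 0) z"
      by (rule wirt_cong_open[OF open_W z]) (simp add: matrix_inv_sum(2)[OF posdef])
    also have "\<dots> = 0" by (rule wirt_const)
    finally have "(\<Sum>m\<in>UNIV. wirt a i (?I k m) z * G z $ m $ n + ?I k m z * wirt a i (\<lambda>z. G z $ m $ n) z) = 0"
      using z by (simp add: wirt_sum wirt_mult diff_G diff_inv_G differentiable_mult)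
    then show ?thesis by (simp add: sum.distrib eq_neg_iff_add_eq_0)
  qed
  have "wirt a i (?I k l) z = (\<Sum>m\<in>UNIV. wirt a i (?I k m) z * (if m = l then 1 else 0))"
    by (simp add: sum_axis_delta)
  also have "\<dots> = (\<Sum>m\<in>UNIV. \<Sum>n\<in>UNIV. wirt a i (?I k m) z * (G z $ m $ n * ?I n l z))"
    by (simp only: matrix_inv_sum(1)[OF posdef[OF z], symmetric] sum_distrib_left)
  also have "\<dots> = (\<Sum>n\<in>UNIV. (\<Sum>m\<in>UNIV. wirt a i (?I k m) z * G z $ m $ n) * ?I n l z)"
    by (subst sum.swap) (simp add: sum_distrib_right mult.assoc)
  also have "\<dots> = - (\<Sum>n\<in>UNIV. \<Sum>m\<in>UNIV. ?I k m z * wirt a i (\<lambda>z. G z $ m $ n) z * ?I n l z)"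
    unfolding e by (simp add: sum_distrib_right sum_negf)
  finally show ?thesis by (subst sum.swap)
qed

text \<open>Jacobi's formula. The product rule differentiates one row at a time. The derivative of
  row r is the combination of the rows of G with coefficients \<open>x r\<close>, and by Cramer's
  lemma the determinant with this row put in is \<open>x r $ r\<close> times
  \<open>det G\<close>.\<close>

lemma wirt_det_G:
  assumes z: "z \<in> W"
  shows "wirt a i (\<lambda>z. det (G z)) z
    = det (G z) * (\<Sum>k\<in>UNIV. \<Sum>l\<in>UNIV. Gi z k l * wirt a i (\<lambda>z. G z $ l $ k) z)"
proof -
  define D where "D r j = wirt a i (\<lambda>z. G z $ r $ j) z" for r j
  define x where "x r = (\<chi> m. \<Sum>j\<in>UNIV. D r j * Gi z j m)" for r
  have dp: "(\<lambda>z. \<Prod>r\<in>UNIV. G z $ r $ p r) differentiable (at z)" for p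
    using smooth_on_differentiable[OF smooth_on_prod[OF open_W smooth_G] z] .
  have prod_split: "D r (p r) * (\<Prod>s\<in>UNIV-{r}. G z $ s $ p s) = (\<Prod>s\<in>UNIV. if s = r then D s (p s) else G z $ s $ p s)" for r p
  proof -
    have "(\<Prod>s\<in>UNIV. if s = r then D s (p s) else G z $ s $ p s)
      = D r (p r) * (\<Prod>s\<in>UNIV-{r}. if s = r then D s (p s) else G z $ s $ p s)"
      by (subst prod.remove[of _ r]) auto
    also have "(\<Prod>s\<in>UNIV-{r}. if s = r then D s (p s) else G z $ s $ p s) = (\<Prod>s\<in>UNIV-{r}. G z $ s $ p s)"
      by (rule prod.cong) auto
    finally show ?thesis by simp
  qed
  have row: "(\<Sum>m\<in>UNIV. x r $ m *s row m (G z)) = (\<chi> j. D r j)" for r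
  proof -
    have "(\<Sum>m\<in>UNIV. x r $ m *s row m (G z)) $ j = D r j" for j
    proof -
      have "(\<Sum>m\<in>UNIV. x r $ m *s row m (G z)) $ j = (\<Sum>m\<in>UNIV. \<Sum>k\<in>UNIV. D r k * (Gi z k m * G z $ m $ j))"
        by (simp add: x_def row_def sum_distrib_right mult.assoc)
      also have "\<dots> = (\<Sum>k\<in>UNIV. D r k * (if k = j then 1 else 0))"
        by (subst sum.swap) (simp only: matrix_inv_sum(2)[OF posdef[OF z], symmetric] sum_distrib_left)
      also have "\<dots> = D r j" by (simp add: sum_axis_delta)
      finally show ?thesis .
    qed
    then show ?thesis by (simp add: vec_eq_iff)
  qed
  have "wirt a i (\<lambda>z. det (G z)) z
     = (\<Sum>p | p permutes UNIV. of_int (sign p) * (\<Sum>r\<in>UNIV. D r (p r) * (\<Prod>s\<in>UNIV-{r}. G z $ s $ p s)))"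
    unfolding det_def D_def using z
    by (subst wirt_sum) (auto intro!: sum.cong differentiable_mult dp simp: wirt_mult dp wirt_const wirt_prod diff_G)
  also have "\<dots> = (\<Sum>r\<in>UNIV. \<Sum>p | p permutes UNIV. of_int (sign p) * (\<Prod>s\<in>UNIV. if s = r then D s (p s) else G z $ s $ p s))"
    unfolding prod_split sum_distrib_left by (rule sum.swap)
  also have "\<dots> = (\<Sum>r\<in>UNIV. det (\<chi> s. if s = r then (\<Sum>m\<in>UNIV. x r $ m *s row m (G z)) else row s (G z)))"
    unfolding row by (simp add: det_def row_def if_distrib if_distribR cong: if_cong)
  also have "\<dots> = (\<Sum>r\<in>UNIV. x r $ r * det (G z))"
    by (simp only: cramer_lemma_transpose)
  also have "\<dots> = det (G z) * (\<Sum>r\<in>UNIV. \<Sum>j\<in>UNIV. Gi z j r * D r j)"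
    by (simp add: x_def sum_distrib_left sum_distrib_right mult_ac)
  finally show ?thesis unfolding D_def by (subst (asm) sum.swap)
qed

lemma wirt_ln_det_G:
  assumes z: "z \<in> W"
  shows "wirt a i (\<lambda>z. of_real (ln (Re (det (G z))))) z
    = (\<Sum>k\<in>UNIV. \<Sum>l\<in>UNIV. Gi z k l * wirt a i (\<lambda>z. G z $ l $ k) z)"
  using wirt_ln_Re[OF open_W smooth_det_G z hermitian_posdef_det(2)[OF posdef] hermitian_posdef_det(1)[OF posdef]]
    det_G[OF z] wirt_det_G[OF z] by simp

lemma wirt_G_cnj:
  assumes z: "z \<in> W"
  shows "wirt a i (\<lambda>z. G z $ l $ k) z = cnj (wirt (cnj a) i (\<lambda>z. G z $ k $ l) z)"
proof -
  have "wirt a i (\<lambda>z. G z $ l $ k) z = wirt a i (\<lambda>z. cnj (G z $ k $ l)) z"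
    by (rule wirt_cong_open[OF open_W z]) (rule hermitian_posdefD(1)[OF posdef])
  then show ?thesis using wirt_cnj[OF diff_G[OF z]] by simp
qed

end

section \<open>The formal adjoints applied to the fundamental form\<close>

lemma sum_rotate3: "(\<Sum>j\<in>J. \<Sum>k\<in>K. \<Sum>m\<in>M. f j k m) = (\<Sum>k\<in>K. \<Sum>m\<in>M. \<Sum>j\<in>J. f j k m)"
  by (subst sum.swap) (intro sum.cong refl sum.swap)

lemma sum_length_1: "(\<Sum>I | length I = Suc 0. f I) = (\<Sum>i\<in>UNIV. f [i::'n::finite])"
proof -
  have "{I::'n list. length I = Suc 0} = (\<lambda>i. [i]) ` UNIV" by (auto simp: length_Suc_conv)
  then show ?thesis by (simp add: sum.reindex inj_on_def)
qed

lemma permutes_length_le_1: "\<sigma> permutes {..<length I} \<Longrightarrow> length I \<le> Suc 0 \<Longrightarrow> \<sigma> = id"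
proof (cases "length I")
  case (Suc n)
  assume "\<sigma> permutes {..<length I}" "length I \<le> Suc 0"
  moreover from this Suc have "{..<length I} = {0}" by auto
  ultimately show ?thesis by simp
qed simp

text \<open>In degrees 0 and 1 alternation is vacuous, and in all other degrees the components
  vanish.\<close>

lemma alternating_length_le_1:
  fixes h :: "'n list \<Rightarrow> complex"
  assumes "\<sigma> permutes {..<length I}" "\<And>I. length I \<noteq> 0 \<Longrightarrow> length I \<noteq> 1 \<Longrightarrow> h I = 0"
  shows "h (permute_list \<sigma> I) = of_int (sign \<sigma>) * h I"
proof (cases "length I \<le> Suc 0")
  case True
  then have "\<sigma> = id" using permutes_length_le_1[OF assms(1)] by blast
  then show ?thesis by simp
next
  case False
  then have "length I \<noteq> 0" "length I \<noteq> 1" by auto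
  then show ?thesis using assms(2)[of I] assms(2)[of "permute_list \<sigma> I"] by simp
qed

lemma local_form_01I:
  fixes f :: "'n::finite \<Rightarrow> complex^'n \<Rightarrow> complex"
  assumes W: "open W" and f: "\<And>j. smooth_on W (f j)"
  shows "local_form W 0 1 (\<lambda>z I J. if z \<in> W \<and> I = [] \<and> length J = 1 then f (hd J) z else 0)"
proof -
  have "smooth_on W (\<lambda>z. if z \<in> W \<and> I = [] \<and> length J = 1 then f (hd J) z else 0)" for I J :: "'n list"
    by (cases "I = [] \<and> length J = 1"; rule smooth_on_cong[OF W, where f="if I = [] \<and> length J = 1 then f (hd J) else (\<lambda>z. 0)"])
       (auto intro: f smooth_on_const)
  then show ?thesis
    unfolding local_form_def
    by (intro conjI allI impI alternating_length_le_1 alternating_length_le_1[where h="\<lambda>I. _ I _"]) auto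
qed

lemma local_form_10I:
  fixes f :: "'n::finite \<Rightarrow> complex^'n \<Rightarrow> complex"
  assumes W: "open W" and f: "\<And>j. smooth_on W (f j)"
  shows "local_form W 1 0 (\<lambda>z I J. if z \<in> W \<and> J = [] \<and> length I = 1 then f (hd I) z else 0)"
proof -
  have "smooth_on W (\<lambda>z. if z \<in> W \<and> J = [] \<and> length I = 1 then f (hd I) z else 0)" for I J :: "'n list"
    by (cases "J = [] \<and> length I = 1"; rule smooth_on_cong[OF W, where f="if J = [] \<and> length I = 1 then f (hd I) else (\<lambda>z. 0)"])
       (auto intro: f smooth_on_const)
  then show ?thesis
    unfolding local_form_def
    by (intro conjI allI impI alternating_length_le_1 alternating_length_le_1[where h="\<lambda>I. _ I _"]) auto
qed

lemma set_integral_cong_open: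
  fixes f h :: "'a::euclidean_space \<Rightarrow> complex"
  assumes "open W" "\<And>z. z \<in> W \<Longrightarrow> f z = h z"
  shows "lint W f = lint W h"
  by (rule set_lebesgue_integral_cong) (use assms in auto)

lemma set_integral_sum_finite:
  fixes f :: "'i \<Rightarrow> 'a \<Rightarrow> complex"
  assumes "\<And>i. i \<in> I \<Longrightarrow> set_integrable M A (f i)"
  shows "set_lebesgue_integral M A (\<lambda>x. \<Sum>i\<in>I. f i x) = (\<Sum>i\<in>I. set_lebesgue_integral M A (f i))"
  using assms unfolding set_lebesgue_integral_def set_integrable_def
  by (simp add: scaleR_sum_right integral_sum)

lemma integration_by_parts_sum:
  fixes F :: "'n::finite \<Rightarrow> 'n \<Rightarrow> complex^'n \<Rightarrow> complex"
  assumes W: "open W" and F: "\<And>k l. smooth_on W (F k l)" and b: "\<And>l. smooth_on W (b l)"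
    and K: "compact K" "K \<subseteq> W" and 0: "\<And>l x. x \<notin> K \<Longrightarrow> b l x = 0"
  shows "lint W (\<lambda>z. \<Sum>k\<in>UNIV. \<Sum>l\<in>UNIV. F k l z * wirt a k (b l) z)
    = lint W (\<lambda>z. - (\<Sum>k\<in>UNIV. \<Sum>l\<in>UNIV. wirt a k (F k l) z * b l z))"
proof -
  have i1: "set_integrable lborel W (\<lambda>z. F k l z * wirt a k (b l) z)" for k l
    by (rule set_integrable_compact[OF W _ K])
       (use wirt_zero_outside[OF K(1) 0] in \<open>auto intro!: smooth_on_continuous smooth_on_mult smooth_on_wirt W F b\<close>)
  have i2: "set_integrable lborel W (\<lambda>z. wirt a k (F k l) z * b l z)" for k l
    by (rule set_integrable_compact[OF W _ K])
       (use 0 in \<open>auto intro!: smooth_on_continuous smooth_on_mult smooth_on_wirt W F b\<close>)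
  have s: "lint W (\<lambda>z. \<Sum>k\<in>UNIV. \<Sum>l\<in>UNIV. f k l z)
     = (\<Sum>k\<in>UNIV. \<Sum>l\<in>UNIV. lint W (f k l))"
    if "\<And>k l. set_integrable lborel W (f k l)" for f :: "'n \<Rightarrow> 'n \<Rightarrow> complex^'n \<Rightarrow> complex"
    unfolding sum_pair by (rule set_integral_sum_finite) (use that in simp)
  have "lint W (\<lambda>z. \<Sum>k\<in>UNIV. \<Sum>l\<in>UNIV. F k l z * wirt a k (b l) z)
    = - (\<Sum>k\<in>UNIV. \<Sum>l\<in>UNIV. lint W (\<lambda>z. wirt a k (F k l) z * b l z))"
    using s[OF i1] integration_by_parts[OF W F b K 0] by (simp add: sum_negf)
  then show ?thesis using s[OF i2] by (simp add: set_lebesgue_integral_def)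
qed

lemma fundamental_eq:
  fixes F1 F2 :: "complex^'n::finite \<Rightarrow> complex"
  assumes W: "open W" and F: "smooth_on W F1" "smooth_on W F2" and z0: "z0 \<in> W"
    and int: "\<And>(b :: complex^'n \<Rightarrow> complex) K. smooth_on W b \<Longrightarrow> compact K \<Longrightarrow> K \<subseteq> W \<Longrightarrow> (\<And>x. x \<notin> K \<Longrightarrow> b x = 0) \<Longrightarrow>
      lint W (\<lambda>z. F1 z * cnj (b z)) = lint W (\<lambda>z. F2 z * cnj (b z))"
  shows "F1 z0 = F2 z0"
proof -
  have "(\<lambda>z. F1 z - F2 z) z0 = 0"
  proof (rule fundamental_lemma[OF W smooth_on_diff[OF W F] z0])
    fix b :: "complex^'n \<Rightarrow> complex" and K assume b: "smooth_on W b" "compact K" "K \<subseteq> W" "\<And>x. x \<notin> K \<Longrightarrow> b x = 0"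
    have "set_integrable lborel W (\<lambda>z. F z * cnj (b z))" if "smooth_on W F" for F
      by (rule set_integrable_compact[OF W _ b(2,3)])
         (use b in \<open>auto intro!: smooth_on_continuous smooth_on_mult smooth_on_cnj W that\<close>)
    then show "lint W (\<lambda>z. (F1 z - F2 z) * cnj (b z)) = 0"
      using int[OF b] F by (simp add: left_diff_distrib)
  qed
  then show ?thesis by simp
qed

context hermitian_domain
begin

definition lndet :: "complex^'n \<Rightarrow> complex" where
  "lndet z = of_real (ln (Re (det (G z))))"

lemma wirt_lndet:
  assumes z: "z \<in> W"
  shows "wirt a i lndet z = (\<Sum>k\<in>UNIV. \<Sum>l\<in>UNIV. Gi z k l * wirt a i (\<lambda>z. G z $ l $ k) z)"
    "wirt a i (\<lambda>z. det (G z)) z = det (G z) * wirt a i lndet z"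
  using wirt_ln_det_G[OF z] wirt_det_G[OF z] by (simp_all add: lndet_def[abs_def])

lemma smooth_wirt_lndet: "smooth_on W (wirt a i lndet)"
  by (rule smooth_on_cong[OF open_W wirt_lndet(1)[symmetric]])
     (auto intro!: smooth_on_sum smooth_on_mult smooth_on_wirt open_W smooth_inv_G smooth_G)

text \<open>Up to normalization the (0,1)-part of the Lee form: by Jacobi's formula for
  \<open>lndet\<close> it is the trace over k and l of dbar_j g_lk - dbar_k g_lj, the conjugate of
  the Chern torsion. \<open>lee10\<close> is the conjugate of \<open>lee01\<close>.\<close>

definition lee01 :: "'n \<Rightarrow> complex^'n \<Rightarrow> complex" where
  "lee01 j z = wdzbar j lndet z - (\<Sum>k\<in>UNIV. \<Sum>l\<in>UNIV. Gi z k l * wdzbar k (\<lambda>z. G z $ l $ j) z)"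

definition lee10 :: "'n \<Rightarrow> complex^'n \<Rightarrow> complex" where
  "lee10 i z = wdz i lndet z - (\<Sum>k\<in>UNIV. \<Sum>l\<in>UNIV. Gi z k l * wdz l (\<lambda>z. G z $ i $ k) z)"

lemma smooth_lee01: "smooth_on W (lee01 j)"
  unfolding lee01_def[abs_def]
  by (intro smooth_on_diff smooth_on_sum smooth_on_mult smooth_on_wirt smooth_wirt_lndet open_W smooth_inv_G smooth_G)

lemma smooth_lee10: "smooth_on W (lee10 j)"
  unfolding lee10_def[abs_def]
  by (intro smooth_on_diff smooth_on_sum smooth_on_mult smooth_on_wirt smooth_wirt_lndet open_W smooth_inv_G smooth_G)

lemma wirt_det_inv:
  assumes z: "z \<in> W"
  shows "wirt a i (\<lambda>z. det (G z) * Gi z k l) z = det (G z) * (wirt a i lndet z * Gi z k l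
     - (\<Sum>m\<in>UNIV. \<Sum>n\<in>UNIV. Gi z k m * wirt a i (\<lambda>z. G z $ m $ n) z * Gi z n l))"
  unfolding wirt_mult[OF smooth_on_differentiable[OF smooth_det_G z] diff_inv_G[OF z]]
    wirt_lndet(2)[OF z] wirt_inv_G[OF z] by (simp add: algebra_simps)

text \<open>The factor \<open>det G * Gi z k l\<close> multiplies the derivative of the test form in
  the L2 product, so integration by parts leaves its divergence. Differentiating the determinant
  yields the logarithmic term of \<open>lee01\<close>, differentiating the inverse metric the other
  term.\<close>

lemma lee01_divergence:
  assumes z: "z \<in> W"
  shows "(\<Sum>k\<in>UNIV. wdzbar k (\<lambda>z. det (G z) * Gi z k l) z) = (\<Sum>j\<in>UNIV. lee01 j z * Gi z j l) * det (G z)"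
proof -
  have "(\<Sum>j\<in>UNIV. \<Sum>k\<in>UNIV. \<Sum>m\<in>UNIV. Gi z k m * wdzbar k (\<lambda>z. G z $ m $ j) z * Gi z j l)
      = (\<Sum>k\<in>UNIV. \<Sum>m\<in>UNIV. \<Sum>n\<in>UNIV. Gi z k m * wdzbar k (\<lambda>z. G z $ m $ n) z * Gi z n l)"
    by (rule sum_rotate3)
  then show ?thesis
    by (simp add: wirt_det_inv[OF z] lee01_def left_diff_distrib right_diff_distrib sum_subtractf
        sum_distrib_left sum_distrib_right mult_ac)
qed

lemma lee10_divergence:
  assumes z: "z \<in> W"
  shows "(\<Sum>l\<in>UNIV. wdz l (\<lambda>z. det (G z) * Gi z k l) z) = (\<Sum>i\<in>UNIV. lee10 i z * Gi z k i) * det (G z)"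
proof -
  have "(\<Sum>i\<in>UNIV. \<Sum>n\<in>UNIV. \<Sum>l\<in>UNIV. Gi z n l * wdz l (\<lambda>z. G z $ i $ n) z * Gi z k i)
      = (\<Sum>l\<in>UNIV. \<Sum>i\<in>UNIV. \<Sum>n\<in>UNIV. Gi z k i * wdz l (\<lambda>z. G z $ i $ n) z * Gi z n l)"
    by (subst sum_rotate3[symmetric]) (intro sum.cong refl, simp add: mult_ac)
  then show ?thesis
    by (simp add: wirt_det_inv[OF z] lee10_def left_diff_distrib right_diff_distrib sum_subtractf
        sum_distrib_left sum_distrib_right mult_ac)
qed

text \<open>The explicit formula for the \<partial>-adjoint of \<omega>: \<i> comes from the
  components of \<omega>, the minus sign from integration by parts. In \<open>adj10\<close> that
  sign is cancelled by the factor \<open>(-1)^length I\<close> of \<open>delbar\<close>.\<close>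

definition adj01 :: "'n lform" where
  "adj01 = (\<lambda>z I J. if z \<in> W \<and> I = [] \<and> length J = 1 then - \<i> * lee01 (hd J) z else 0)"

definition adj10 :: "'n lform" where
  "adj10 = (\<lambda>z I J. if z \<in> W \<and> J = [] \<and> length I = 1 then \<i> * lee10 (hd I) z else 0)"

lemma form_inner_01:
  "form_inner G 0 1 a b z = (\<Sum>l\<in>UNIV. (\<Sum>j\<in>UNIV. a z [] [j] * Gi z j l) * cnj (b z [] [l]))"
proof -
  have "form_inner G 0 1 a b z = (\<Sum>j\<in>UNIV. \<Sum>l\<in>UNIV. a z [] [j] * Gi z j l * cnj (b z [] [l]))"
    by (simp add: form_inner_def sum_length_1 mult_ac)
  then show ?thesis by (subst (asm) sum.swap) (simp add: sum_distrib_right)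
qed

lemma form_inner_10:
  "form_inner G 1 0 a b z = (\<Sum>k\<in>UNIV. (\<Sum>i\<in>UNIV. a z [i] [] * Gi z k i) * cnj (b z [k] []))"
proof -
  have "form_inner G 1 0 a b z = (\<Sum>i\<in>UNIV. \<Sum>k\<in>UNIV. a z [i] [] * Gi z k i * cnj (b z [k] []))"
    by (simp add: form_inner_def sum_length_1 mult_ac)
  then show ?thesis by (subst (asm) sum.swap) (simp add: sum_distrib_right)
qed

text \<open>The components of \<omega> are \<i> times the metric itself, so one of the two inverse
  metrics in the pairing cancels and a single trace of the conjugate of b remains.\<close>

lemma form_inner_11_fundamental:
  assumes z: "z \<in> W"
  shows "form_inner G 1 1 (fundamental_form W G) b z
    = (\<Sum>k\<in>UNIV. \<Sum>l\<in>UNIV. \<i> * Gi z k l * cnj (b z [k] [l]))"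
proof -
  have "form_inner G 1 1 (fundamental_form W G) b z
    = (\<Sum>i\<in>UNIV. \<Sum>k\<in>UNIV. \<Sum>j\<in>UNIV. \<Sum>l\<in>UNIV. \<i> * G z $ i $ j * Gi z k i * Gi z j l * cnj (b z [k] [l]))"
    using z by (simp add: form_inner_def sum_length_1 fundamental_form_def mult_ac)
  also have "\<dots> = (\<Sum>k\<in>UNIV. \<Sum>j\<in>UNIV. \<Sum>l\<in>UNIV. \<Sum>i\<in>UNIV. (Gi z k i * G z $ i $ j) * (\<i> * Gi z j l * cnj (b z [k] [l])))"
  proof -
    have "(\<Sum>i\<in>UNIV. \<Sum>k\<in>UNIV. \<Sum>j\<in>UNIV. \<Sum>l\<in>UNIV. \<i> * G z $ i $ j * Gi z k i * Gi z j l * cnj (b z [k] [l]))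
      = (\<Sum>i\<in>UNIV. \<Sum>k\<in>UNIV. \<Sum>j\<in>UNIV. \<Sum>l\<in>UNIV. (Gi z k i * G z $ i $ j) * (\<i> * Gi z j l * cnj (b z [k] [l])))"
      by (intro sum.cong refl) (simp add: mult_ac)
    also have "\<dots> = (\<Sum>k\<in>UNIV. \<Sum>j\<in>UNIV. \<Sum>i\<in>UNIV. \<Sum>l\<in>UNIV. (Gi z k i * G z $ i $ j) * (\<i> * Gi z j l * cnj (b z [k] [l])))"
      by (rule sum_rotate3)
    also have "\<dots> = (\<Sum>k\<in>UNIV. \<Sum>j\<in>UNIV. \<Sum>l\<in>UNIV. \<Sum>i\<in>UNIV. (Gi z k i * G z $ i $ j) * (\<i> * Gi z j l * cnj (b z [k] [l])))"
      by (rule sum.cong[OF refl], rule sum.cong[OF refl], rule sum.swap)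
    finally show ?thesis .
  qed
  also have "\<dots> = (\<Sum>k\<in>UNIV. \<Sum>j\<in>UNIV. \<Sum>l\<in>UNIV. (if k = j then 1 else 0) * (\<i> * Gi z j l * cnj (b z [k] [l])))"
    by (simp only: sum_distrib_right[symmetric] matrix_inv_sum(2)[OF posdef[OF z]])
  also have "\<dots> = (\<Sum>k\<in>UNIV. \<Sum>l\<in>UNIV. \<i> * Gi z k l * cnj (b z [k] [l]))"
    by (rule sum.cong[OF refl], subst sum.swap) (simp only: sum_axis_delta)
  finally show ?thesis .
qed

text \<open>Conjugation turns \<partial> of b into dbar of the conjugate of b. Moving that
  derivative onto \<open>det G * Gi z k l\<close> produces the divergence computed in
  \<open>lee01_divergence\<close>.\<close>

lemma adj01_adjoint:
  assumes b: "test_form W 0 1 b"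
  shows "L2_inner W G 0 1 adj01 b = L2_inner W G (Suc 0) 1 (fundamental_form W G) (del b)"
proof -
  obtain K where K: "compact K" "K \<subseteq> W" "\<And>z I J. z \<notin> K \<Longrightarrow> b z I J = 0"
    using b by (auto simp: test_form_def)
  have sb: "smooth_on W (\<lambda>z. b z [] [l])" for l
    using b by (auto simp: test_form_def local_form_def)
  let ?c = "2 ^ CARD('n) :: complex"
  have "L2_inner W G (Suc 0) 1 (fundamental_form W G) (del b)
    = lint W (\<lambda>z. \<Sum>k\<in>UNIV. \<Sum>l\<in>UNIV.
        (\<i> * ?c * (det (G z) * Gi z k l)) * wdzbar k (\<lambda>z. cnj (b z [] [l])) z)"
    unfolding L2_inner_def
  proof (rule set_integral_cong_open[OF open_W])
    fix z assume z: "z \<in> W"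
    have "cnj (del b z [k] [l]) = wdzbar k (\<lambda>z. cnj (b z [] [l])) z" for k l
      using wirt_cnj[OF smooth_on_differentiable[OF sb z], of \<i>]
      by (simp add: del_def remove_nth_def dz_wirt)
    then show "form_inner G (Suc 0) 1 (fundamental_form W G) (del b) z * (?c * det (G z))
      = (\<Sum>k\<in>UNIV. \<Sum>l\<in>UNIV. (\<i> * ?c * (det (G z) * Gi z k l)) * wdzbar k (\<lambda>z. cnj (b z [] [l])) z)"
      using form_inner_11_fundamental[OF z, of "del b"]
      by (simp add: sum_distrib_left sum_distrib_right mult_ac)
  qed
  also have "\<dots> = lint W (\<lambda>z. - (\<Sum>k\<in>UNIV. \<Sum>l\<in>UNIV.
        wdzbar k (\<lambda>z. \<i> * ?c * (det (G z) * Gi z k l)) z * cnj (b z [] [l])))"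
    by (rule integration_by_parts_sum[OF open_W _ _ K(1,2)])
       (use K(3) in \<open>auto intro!: smooth_on_mult smooth_on_const smooth_on_cnj smooth_det_G smooth_inv_G sb open_W\<close>)
  also have "\<dots> = L2_inner W G 0 1 adj01 b"
    unfolding L2_inner_def
  proof (rule set_integral_cong_open[OF open_W])
    fix z assume z: "z \<in> W"
    have d: "(\<lambda>z. det (G z) * Gi z k l) differentiable (at z)" for k l
      by (intro differentiable_mult smooth_on_differentiable[OF smooth_det_G z] diff_inv_G z)
    have w: "wdzbar k (\<lambda>z. \<i> * ?c * (det (G z) * Gi z k l)) z = \<i> * ?c * wdzbar k (\<lambda>z. det (G z) * Gi z k l) z" for k l
      using wirt_mult[OF differentiable_const[of "\<i> * ?c"] d] by (simp add: wirt_const)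
    have "(\<Sum>k\<in>UNIV. \<Sum>l\<in>UNIV. wdzbar k (\<lambda>z. \<i> * ?c * (det (G z) * Gi z k l)) z * cnj (b z [] [l]))
      = (\<Sum>l\<in>UNIV. \<i> * ?c * ((\<Sum>k\<in>UNIV. wdzbar k (\<lambda>z. det (G z) * Gi z k l) z) * cnj (b z [] [l])))"
      unfolding w by (subst sum.swap) (simp add: sum_distrib_left sum_distrib_right mult_ac)
    also have "\<dots> = (\<Sum>l\<in>UNIV. \<i> * ?c * ((\<Sum>j\<in>UNIV. lee01 j z * Gi z j l) * det (G z) * cnj (b z [] [l])))"
      unfolding lee01_divergence[OF z] ..
    finally show "- (\<Sum>k\<in>UNIV. \<Sum>l\<in>UNIV. wdzbar k (\<lambda>z. \<i> * ?c * (det (G z) * Gi z k l)) z * cnj (b z [] [l]))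
        = form_inner G 0 1 adj01 b z * (?c * det (G z))"
      using z unfolding form_inner_01 adj01_def
      by (simp add: sum_distrib_left sum_distrib_right mult_ac sum_negf)
  qed
  finally show ?thesis ..
qed

lemma adj10_adjoint:
  assumes b: "test_form W 1 0 b"
  shows "L2_inner W G 1 0 adj10 b = L2_inner W G 1 (Suc 0) (fundamental_form W G) (delbar b)"
proof -
  obtain K where K: "compact K" "K \<subseteq> W" "\<And>z I J. z \<notin> K \<Longrightarrow> b z I J = 0"
    using b by (auto simp: test_form_def)
  have sb: "smooth_on W (\<lambda>z. b z [k] [])" for k
    using b by (auto simp: test_form_def local_form_def)
  let ?c = "2 ^ CARD('n) :: complex"
  have "L2_inner W G 1 (Suc 0) (fundamental_form W G) (delbar b)
    = lint W (\<lambda>z. \<Sum>l\<in>UNIV. \<Sum>k\<in>UNIV.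
        (- \<i> * ?c * (det (G z) * Gi z k l)) * wdz l (\<lambda>z. cnj (b z [k] [])) z)"
    unfolding L2_inner_def
  proof (rule set_integral_cong_open[OF open_W])
    fix z assume z: "z \<in> W"
    have "cnj (delbar b z [k] [l]) = - wdz l (\<lambda>z. cnj (b z [k] [])) z" for k l
      using wirt_cnj[OF smooth_on_differentiable[OF sb z], of "-\<i>"]
      by (simp add: delbar_def remove_nth_def dzbar_wirt)
    then have "form_inner G 1 (Suc 0) (fundamental_form W G) (delbar b) z * (?c * det (G z))
      = (\<Sum>k\<in>UNIV. \<Sum>l\<in>UNIV. (- \<i> * ?c * (det (G z) * Gi z k l)) * wdz l (\<lambda>z. cnj (b z [k] [])) z)"
      using form_inner_11_fundamental[OF z, of "delbar b"]
      by (simp add: sum_distrib_left sum_distrib_right mult_ac)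
    then show "form_inner G 1 (Suc 0) (fundamental_form W G) (delbar b) z * (?c * det (G z))
      = (\<Sum>l\<in>UNIV. \<Sum>k\<in>UNIV. (- \<i> * ?c * (det (G z) * Gi z k l)) * wdz l (\<lambda>z. cnj (b z [k] [])) z)"
      by (subst sum.swap)
  qed
  also have "\<dots> = lint W (\<lambda>z. - (\<Sum>l\<in>UNIV. \<Sum>k\<in>UNIV.
        wdz l (\<lambda>z. - \<i> * ?c * (det (G z) * Gi z k l)) z * cnj (b z [k] [])))"
    by (rule integration_by_parts_sum[OF open_W _ _ K(1,2)])
       (use K(3) in \<open>auto intro!: smooth_on_mult smooth_on_uminus smooth_on_const smooth_on_cnj smooth_det_G smooth_inv_G sb open_W\<close>)
  also have "\<dots> = L2_inner W G 1 0 adj10 b"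
    unfolding L2_inner_def
  proof (rule set_integral_cong_open[OF open_W])
    fix z assume z: "z \<in> W"
    have d: "(\<lambda>z. det (G z) * Gi z k l) differentiable (at z)" for k l
      by (intro differentiable_mult smooth_on_differentiable[OF smooth_det_G z] diff_inv_G z)
    have w: "wdz l (\<lambda>z. - \<i> * ?c * (det (G z) * Gi z k l)) z = - \<i> * ?c * wdz l (\<lambda>z. det (G z) * Gi z k l) z" for k l
      using wirt_mult[OF differentiable_const[of "- \<i> * ?c"] d] by (simp add: wirt_const)
    have "(\<Sum>l\<in>UNIV. \<Sum>k\<in>UNIV. wdz l (\<lambda>z. - \<i> * ?c * (det (G z) * Gi z k l)) z * cnj (b z [k] []))
      = (\<Sum>k\<in>UNIV. - \<i> * ?c * ((\<Sum>l\<in>UNIV. wdz l (\<lambda>z. det (G z) * Gi z k l) z) * cnj (b z [k] [])))"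
      unfolding w by (subst sum.swap) (simp add: sum_distrib_left sum_distrib_right mult_ac)
    also have "\<dots> = (\<Sum>k\<in>UNIV. - \<i> * ?c * ((\<Sum>i\<in>UNIV. lee10 i z * Gi z k i) * det (G z) * cnj (b z [k] [])))"
      unfolding lee10_divergence[OF z] ..
    finally show "- (\<Sum>l\<in>UNIV. \<Sum>k\<in>UNIV. wdz l (\<lambda>z. - \<i> * ?c * (det (G z) * Gi z k l)) z * cnj (b z [k] []))
        = form_inner G 1 0 adj10 b z * (?c * det (G z))"
      using z unfolding form_inner_10 adj10_def
      by (simp add: sum_distrib_left sum_distrib_right mult_ac sum_negf)
  qed
  finally show ?thesis ..
qed

lemma local_form_adj01: "local_form W 0 1 adj01"
  unfolding adj01_def
  by (rule local_form_01I[OF open_W]) (intro smooth_on_mult smooth_on_const smooth_lee01 open_W)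

lemma local_form_adj10: "local_form W 1 0 adj10"
  unfolding adj10_def
  by (rule local_form_10I[OF open_W]) (intro smooth_on_mult smooth_on_const smooth_lee10 open_W)

lemma lower_index_01:
  assumes z: "z \<in> W"
  shows "(\<Sum>l\<in>UNIV. (\<Sum>j\<in>UNIV. e j * Gi z j l) * G z $ l $ k) = e k"
proof -
  have "(\<Sum>l\<in>UNIV. (\<Sum>j\<in>UNIV. e j * Gi z j l) * G z $ l $ k) = (\<Sum>l\<in>UNIV. \<Sum>j\<in>UNIV. e j * (Gi z j l * G z $ l $ k))"
    by (simp add: sum_distrib_right mult.assoc)
  also have "\<dots> = (\<Sum>j\<in>UNIV. e j * (if j = k then 1 else 0))"
    by (subst sum.swap) (simp only: sum_distrib_left[symmetric] matrix_inv_sum(2)[OF posdef[OF z]])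
  finally show ?thesis by (simp only: sum_axis_delta)
qed

lemma lower_index_10:
  assumes z: "z \<in> W"
  shows "(\<Sum>k\<in>UNIV. (\<Sum>i\<in>UNIV. e i * Gi z k i) * G z $ m $ k) = e m"
proof -
  have "(\<Sum>k\<in>UNIV. (\<Sum>i\<in>UNIV. e i * Gi z k i) * G z $ m $ k) = (\<Sum>k\<in>UNIV. \<Sum>i\<in>UNIV. e i * (G z $ m $ k * Gi z k i))"
    by (simp add: sum_distrib_left mult_ac)
  also have "\<dots> = (\<Sum>i\<in>UNIV. e i * (if m = i then 1 else 0))"
    by (subst sum.swap) (simp only: sum_distrib_left[symmetric] matrix_inv_sum(1)[OF posdef[OF z]])
  finally show ?thesis by (simp only: sum_axis_delta)
qed

text \<open>Test forms with a single nonzero component l isolate one raised component of e, to which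
  the fundamental lemma applies; lowering the index recovers e. Together with the adjoint identity
  this evaluates the definite description in \<open>del_adj\<close>.\<close>

lemma L2_inner_01_unique:
  assumes e: "local_form W 0 1 e" and e': "local_form W 0 1 e'"
    and eq: "\<And>b. test_form W 0 1 b \<Longrightarrow> L2_inner W G 0 1 e b = L2_inner W G 0 1 e' b"
  shows "e = e'"
proof (intro ext)
  fix z I J
  let ?F = "\<lambda>e l z. (\<Sum>j\<in>UNIV. e z [] [j] * Gi z j l) * (2 ^ CARD('n) * det (G z))"
  have sF: "smooth_on W (?F e l)" if "local_form W 0 1 e" for e l
    using that unfolding local_form_def
    by (intro smooth_on_mult smooth_on_sum smooth_on_const smooth_det_G smooth_inv_G open_W) auto
  have F: "?F e l z = ?F e' l z" if z: "z \<in> W" for l z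
  proof (rule fundamental_eq[OF open_W sF[OF e] sF[OF e'] z])
    fix \<phi> :: "complex^'n \<Rightarrow> complex" and K
    assume \<phi>: "smooth_on W \<phi>" "compact K" "K \<subseteq> W" "\<And>x. x \<notin> K \<Longrightarrow> \<phi> x = 0"
    define b :: "'n lform" where
      "b = (\<lambda>z I J. if z \<in> W \<and> I = [] \<and> length J = 1 then (if hd J = l then \<phi> else (\<lambda>z. 0)) z else 0)"
    have "local_form W 0 1 b" unfolding b_def
      by (rule local_form_01I[OF open_W]) (simp add: \<phi>(1) smooth_on_const)
    then have "test_form W 0 1 b" using \<phi> by (auto simp: test_form_def b_def intro!: exI[of _ K])
    moreover have "L2_inner W G 0 1 e b = lint W (\<lambda>z. ?F e l z * cnj (\<phi> z))" for e
      unfolding L2_inner_def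
    proof (rule set_integral_cong_open[OF open_W])
      show "form_inner G 0 1 e b z * (2 ^ CARD('n) * det (G z)) = ?F e l z * cnj (\<phi> z)" if "z \<in> W" for z
        unfolding form_inner_01 b_def using that by (simp add: if_distrib if_distribR cong: if_cong)
    qed
    ultimately show "lint W (\<lambda>z. ?F e l z * cnj (\<phi> z))
       = lint W (\<lambda>z. ?F e' l z * cnj (\<phi> z))"
      using eq[of b] by simp
  qed
  show "e z I J = e' z I J"
  proof (cases "z \<in> W \<and> I = [] \<and> length J = 1")
    case True
    then obtain k where J: "J = [k]" by (auto simp: length_Suc_conv)
    have "(\<Sum>j\<in>UNIV. e z [] [j] * Gi z j l) = (\<Sum>j\<in>UNIV. e' z [] [j] * Gi z j l)" for l
      using F[of z l] True det_G by simp
    then show ?thesis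
      using lower_index_01[of z "\<lambda>j. e z [] [j]" k] lower_index_01[of z "\<lambda>j. e' z [] [j]" k] True J by simp
  next
    case False
    then have "z \<notin> W \<or> length I \<noteq> 0 \<or> length J \<noteq> 1" by auto
    then show ?thesis using e e' unfolding local_form_def by metis
  qed
qed

lemma L2_inner_10_unique:
  assumes e: "local_form W 1 0 e" and e': "local_form W 1 0 e'"
    and eq: "\<And>b. test_form W 1 0 b \<Longrightarrow> L2_inner W G 1 0 e b = L2_inner W G 1 0 e' b"
  shows "e = e'"
proof (intro ext)
  fix z I J
  let ?F = "\<lambda>e k z. (\<Sum>i\<in>UNIV. e z [i] [] * Gi z k i) * (2 ^ CARD('n) * det (G z))"
  have sF: "smooth_on W (?F e l)" if "local_form W 1 0 e" for e l
    using that unfolding local_form_def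
    by (intro smooth_on_mult smooth_on_sum smooth_on_const smooth_det_G smooth_inv_G open_W) auto
  have F: "?F e l z = ?F e' l z" if z: "z \<in> W" for l z
  proof (rule fundamental_eq[OF open_W sF[OF e] sF[OF e'] z])
    fix \<phi> :: "complex^'n \<Rightarrow> complex" and K
    assume \<phi>: "smooth_on W \<phi>" "compact K" "K \<subseteq> W" "\<And>x. x \<notin> K \<Longrightarrow> \<phi> x = 0"
    define b :: "'n lform" where
      "b = (\<lambda>z I J. if z \<in> W \<and> J = [] \<and> length I = 1 then (if hd I = l then \<phi> else (\<lambda>z. 0)) z else 0)"
    have "local_form W 1 0 b" unfolding b_def
      by (rule local_form_10I[OF open_W]) (simp add: \<phi>(1) smooth_on_const)
    then have "test_form W 1 0 b" using \<phi> by (auto simp: test_form_def b_def intro!: exI[of _ K])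
    moreover have "L2_inner W G 1 0 e b = lint W (\<lambda>z. ?F e l z * cnj (\<phi> z))" for e
      unfolding L2_inner_def
    proof (rule set_integral_cong_open[OF open_W])
      show "form_inner G 1 0 e b z * (2 ^ CARD('n) * det (G z)) = ?F e l z * cnj (\<phi> z)" if "z \<in> W" for z
        unfolding form_inner_10 b_def using that by (simp add: if_distrib if_distribR cong: if_cong)
    qed
    ultimately show "lint W (\<lambda>z. ?F e l z * cnj (\<phi> z))
       = lint W (\<lambda>z. ?F e' l z * cnj (\<phi> z))"
      using eq[of b] by simp
  qed
  show "e z I J = e' z I J"
  proof (cases "z \<in> W \<and> J = [] \<and> length I = 1")
    case True
    then obtain k where I: "I = [k]" by (auto simp: length_Suc_conv)
    have "(\<Sum>j\<in>UNIV. e z [j] [] * Gi z l j) = (\<Sum>j\<in>UNIV. e' z [j] [] * Gi z l j)" for l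
      using F[of z l] True det_G by simp
    then show ?thesis
      using lower_index_10[of z "\<lambda>j. e z [j] []" k] lower_index_10[of z "\<lambda>j. e' z [j] []" k] True I by simp
  next
    case False
    then have "z \<notin> W \<or> length I \<noteq> 1 \<or> length J \<noteq> 0" by auto
    then show ?thesis using e e' unfolding local_form_def by metis
  qed
qed

lemma del_adj_fundamental: "del_adj W G 0 1 (fundamental_form W G) = adj01"
  unfolding del_adj_def
  using local_form_adj01 adj01_adjoint L2_inner_01_unique
  by (intro the_equality) auto

lemma delbar_adj_fundamental: "delbar_adj W G 1 0 (fundamental_form W G) = adj10"
  unfolding delbar_adj_def
  using local_form_adj10 adj10_adjoint L2_inner_10_unique
  by (intro the_equality) auto

text \<open>Each of the three terms of the Ricci form contributes second derivatives of
  \<open>lndet\<close>. Those from the first and the third cancel, being taken in the same order, so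
  the contribution of \<open>adj10\<close> is the one left.\<close>

lemma bismut_ricci_matrix_eq:
  assumes z: "z \<in> W"
  shows "bismut_ricci_matrix W G z $ i $ j = wdzbar j (wdz i lndet) z
    - wdz i (\<lambda>z. \<Sum>k\<in>UNIV. \<Sum>l\<in>UNIV. Gi z k l * wdzbar k (\<lambda>z. G z $ l $ j) z) z
    - wdzbar j (\<lambda>z. \<Sum>k\<in>UNIV. \<Sum>l\<in>UNIV. Gi z k l * wdz l (\<lambda>z. G z $ i $ k) z) z"
proof -
  have wc: "wirt a i (\<lambda>z. c * f z) z = c * wirt a i f z" if "f differentiable (at z)" for a i c f
    using wirt_mult[where f="\<lambda>z. c", OF differentiable_const that] by (simp add: wirt_const)
  have d1: "(\<lambda>z. \<Sum>k\<in>UNIV. \<Sum>l\<in>UNIV. Gi z k l * wdzbar k (\<lambda>z. G z $ l $ j) z) differentiable (at z)"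
    by (rule smooth_on_differentiable[OF _ z])
       (intro smooth_on_sum smooth_on_mult smooth_on_wirt open_W smooth_inv_G smooth_G)
  have d2: "(\<lambda>z. \<Sum>k\<in>UNIV. \<Sum>l\<in>UNIV. Gi z k l * wdz l (\<lambda>z. G z $ i $ k) z) differentiable (at z)"
    by (rule smooth_on_differentiable[OF _ z])
       (intro smooth_on_sum smooth_on_mult smooth_on_wirt open_W smooth_inv_G smooth_G)
  have dl: "wirt a i lndet differentiable (at z)" for a i
    by (rule smooth_on_differentiable[OF smooth_wirt_lndet z])
  have "del adj01 z [i] [j] = wdz i (\<lambda>z. - \<i> * lee01 j z) z"
    unfolding del_def dz_wirt
    by (simp add: remove_nth_def) (rule wirt_cong_open[OF open_W z], simp add: adj01_def)
  also have "\<dots> = - \<i> * wdz i (lee01 j) z"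
    by (rule wc[OF smooth_on_differentiable[OF smooth_lee01 z]])
  also have "wdz i (lee01 j) z = wdz i (wdzbar j lndet) z
     - wdz i (\<lambda>z. \<Sum>k\<in>UNIV. \<Sum>l\<in>UNIV. Gi z k l * wdzbar k (\<lambda>z. G z $ l $ j) z) z"
    unfolding lee01_def[abs_def] by (rule wirt_diff[OF dl d1])
  finally have 1: "del adj01 z [i] [j] = - \<i> * (wdz i (wdzbar j lndet) z
     - wdz i (\<lambda>z. \<Sum>k\<in>UNIV. \<Sum>l\<in>UNIV. Gi z k l * wdzbar k (\<lambda>z. G z $ l $ j) z) z)" .
  have "delbar adj10 z [i] [j] = - wdzbar j (\<lambda>z. \<i> * lee10 i z) z"
    unfolding delbar_def dzbar_wirt
    by (simp add: remove_nth_def) (rule wirt_cong_open[OF open_W z], simp add: adj10_def)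
  also have "wdzbar j (\<lambda>z. \<i> * lee10 i z) z = \<i> * wdzbar j (lee10 i) z"
    by (rule wc[OF smooth_on_differentiable[OF smooth_lee10 z]])
  also have "wdzbar j (lee10 i) z = wdzbar j (wdz i lndet) z
     - wdzbar j (\<lambda>z. \<Sum>k\<in>UNIV. \<Sum>l\<in>UNIV. Gi z k l * wdz l (\<lambda>z. G z $ i $ k) z) z"
    unfolding lee10_def[abs_def] by (rule wirt_diff[OF dl d2])
  finally have 2: "delbar adj10 z [i] [j] = - (\<i> * (wdzbar j (wdz i lndet) z
     - wdzbar j (\<lambda>z. \<Sum>k\<in>UNIV. \<Sum>l\<in>UNIV. Gi z k l * wdz l (\<lambda>z. G z $ i $ k) z) z))" .
  have 3: "del (delbar (log_det G)) z [i] [j] = wdz i (wdzbar j lndet) z"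
    by (simp add: del_def delbar_def remove_nth_def dz_wirt dzbar_wirt log_det_def lndet_def[abs_def])
  show ?thesis
    unfolding bismut_ricci_matrix_def bismut_ricci11_def del_adj_fundamental delbar_adj_fundamental
    by (simp add: 1 2 3 diff_divide_distrib add_divide_distrib right_diff_distrib)
qed

section \<open>The Bismut Ricci form of a pluriclosed metric\<close>

definition dG :: "complex^'n \<Rightarrow> 'n \<Rightarrow> 'n \<Rightarrow> 'n \<Rightarrow> complex" where
  "dG z i l k = wdz i (\<lambda>z. G z $ l $ k) z"

definition hG :: "complex^'n \<Rightarrow> 'n \<Rightarrow> 'n \<Rightarrow> 'n \<Rightarrow> 'n \<Rightarrow> complex" where
  "hG z i j l k = wdz i (wdzbar j (\<lambda>z. G z $ l $ k)) z"

text \<open>The difference of \<open>dGv\<close> and \<open>qG\<close> has the components v^i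
  (\<partial>_i g_mn - \<partial>_m g_in), the Chern torsion contracted with v. On its own
  \<open>qG\<close> is the lowered connection term in the Chern derivative of v.\<close>

definition dGv :: "complex^'n \<Rightarrow> complex^'n \<Rightarrow> 'n \<Rightarrow> 'n \<Rightarrow> complex" where
  "dGv z v m n = (\<Sum>i\<in>UNIV. v $ i * dG z i m n)"

definition qG :: "complex^'n \<Rightarrow> complex^'n \<Rightarrow> 'n \<Rightarrow> 'n \<Rightarrow> complex" where
  "qG z v k l = (\<Sum>j\<in>UNIV. v $ j * dG z k j l)"

lemma dbar_G: "z \<in> W \<Longrightarrow> wdzbar j (\<lambda>z. G z $ l $ k) z = cnj (dG z j k l)"
  using wirt_G_cnj[of z \<i> j l k] by (simp add: dG_def)

lemma hG_commute: "z \<in> W \<Longrightarrow> wdzbar j (wdz i (\<lambda>z. G z $ l $ k)) z = hG z i j l k"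
  unfolding hG_def by (rule wirt_commute[OF open_W smooth_G])

lemma diff_wirt_G: "z \<in> W \<Longrightarrow> wirt a i (\<lambda>z. G z $ l $ k) differentiable (at z)"
  by (rule smooth_on_differentiable[OF smooth_on_wirt[OF open_W smooth_G]])

lemma wirt_contraction:
  assumes z: "z \<in> W" and f: "\<And>k l. f k l differentiable (at z)"
  shows "wirt a i (\<lambda>z. \<Sum>k\<in>UNIV. \<Sum>l\<in>UNIV. Gi z k l * f k l z) z
    = (\<Sum>k\<in>UNIV. \<Sum>l\<in>UNIV. wirt a i (\<lambda>z. Gi z k l) z * f k l z + Gi z k l * wirt a i (f k l) z)"
proof -
  have d: "(\<lambda>z. Gi z k l * f k l z) differentiable (at z)" for k l
    by (intro differentiable_mult diff_inv_G z f)
  have "wirt a i (\<lambda>z. \<Sum>k\<in>UNIV. \<Sum>l\<in>UNIV. Gi z k l * f k l z) z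
    = (\<Sum>k\<in>UNIV. \<Sum>l\<in>UNIV. wirt a i (\<lambda>z. Gi z k l * f k l z) z)"
    using d by (subst wirt_sum) (auto intro!: differentiable_sum sum.cong wirt_sum)
  then show ?thesis by (simp add: wirt_mult[OF diff_inv_G[OF z] f])
qed

lemma bismut_ricci_matrix_expand:
  assumes z: "z \<in> W"
  shows "bismut_ricci_matrix W G z $ i $ j = (\<Sum>k\<in>UNIV. \<Sum>l\<in>UNIV.
     Gi z k l * (hG z i j l k - hG z i k l j - hG z l j i k)
     + (wdzbar j (\<lambda>z. Gi z k l) z * (dG z i l k - dG z l i k)
     - wdz i (\<lambda>z. Gi z k l) z * cnj (dG z k j l)))"
proof -
  \<comment> \<open>Jacobi's formula brings the logarithmic term into the shape of the other two, a
    contraction with the inverse metric, so one product rule serves all three.\<close>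
  have 1: "wdzbar j (wdz i lndet) z
     = wdzbar j (\<lambda>z. \<Sum>k\<in>UNIV. \<Sum>l\<in>UNIV. Gi z k l * wdz i (\<lambda>z. G z $ l $ k) z) z"
    by (rule wirt_cong_open[OF open_W z wirt_lndet(1)])
  show ?thesis
    unfolding bismut_ricci_matrix_eq[OF z] 1
    unfolding wirt_contraction[OF z diff_wirt_G[OF z]]
    unfolding dbar_G[OF z] hG_commute[OF z] dG_def[symmetric] hG_def[symmetric]
    unfolding sum_subtractf[symmetric]
    by (intro sum.cong refl) (simp add: algebra_simps)
qed

lemma tensor_inner_swap:
  "(\<Sum>k\<in>UNIV. \<Sum>l\<in>UNIV. (\<Sum>m\<in>UNIV. \<Sum>n\<in>UNIV. Gi z k m * cnj (B n m) * Gi z n l) * A l k)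
    = tensor_inner (G z) A B"
proof -
  have "(\<Sum>k\<in>UNIV. \<Sum>l\<in>UNIV. (\<Sum>m\<in>UNIV. \<Sum>n\<in>UNIV. Gi z k m * cnj (B n m) * Gi z n l) * A l k)
    = (\<Sum>k\<in>UNIV. \<Sum>l\<in>UNIV. \<Sum>m\<in>UNIV. \<Sum>n\<in>UNIV. Gi z n l * A l k * Gi z k m * cnj (B n m))"
    unfolding sum_distrib_right by (intro sum.cong refl) (simp add: mult_ac)
  also have "\<dots> = (\<Sum>m\<in>UNIV. \<Sum>n\<in>UNIV. \<Sum>k\<in>UNIV. \<Sum>l\<in>UNIV. Gi z n l * A l k * Gi z k m * cnj (B n m))"
    by (rule sum_swap_pairs)
  also have "\<dots> = (\<Sum>m\<in>UNIV. \<Sum>n\<in>UNIV. \<Sum>l\<in>UNIV. \<Sum>k\<in>UNIV. Gi z n l * A l k * Gi z k m * cnj (B n m))"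
    by (rule sum.cong[OF refl], rule sum.cong[OF refl], rule sum.swap)
  also have "\<dots> = tensor_inner (G z) A B"
    unfolding tensor_inner_def by (rule sum.swap)
  finally show ?thesis .
qed

text \<open>Pluriclosedness replaces three second-derivative terms by the single one in which the
  pairs (i,j) and (l,k) have changed roles; its trace is the one produced by
  \<open>hessian_sqn\<close>. What remains are, up to sign, three of the four terms of
  \<open>tensor_inner_diff\<close> for \<open>dGv\<close> and \<open>qG\<close>; the fourth is
  supplied by that Hessian.\<close>

lemma ricci_quadratic:
  assumes z: "z \<in> W"
    and pc: "\<And>i j k l. hG z i j l k - hG z i k l j - hG z l j i k + hG z l k i j = 0"
  shows "hform (bismut_ricci_matrix W G z) v v =
     - (\<Sum>k\<in>UNIV. \<Sum>l\<in>UNIV. Gi z k l * (\<Sum>i\<in>UNIV. \<Sum>j\<in>UNIV. hG z l k i j * v $ i * cnj (v $ j)))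
     - tensor_inner (G z) (dGv z v) (dGv z v) + tensor_inner (G z) (dGv z v) (qG z v)
     + tensor_inner (G z) (qG z v) (dGv z v)"
proof -
  \<comment> \<open>A and B are the derivatives of the inverse metric along v and along its
    conjugate. Each becomes a first derivative of G between two inverse metrics, the pattern that
    \<open>tensor_inner\<close> contracts.\<close>
  define A where "A k l = (\<Sum>i\<in>UNIV. v $ i * wdz i (\<lambda>z. Gi z k l) z)" for k l
  define B where "B k l = (\<Sum>j\<in>UNIV. cnj (v $ j) * wdzbar j (\<lambda>z. Gi z k l) z)" for k l
  have A: "A k l = - (\<Sum>m\<in>UNIV. \<Sum>n\<in>UNIV. Gi z k m * dGv z v m n * Gi z n l)" for k l
  proof -
    have "A k l = - (\<Sum>i\<in>UNIV. \<Sum>m\<in>UNIV. \<Sum>n\<in>UNIV. v $ i * (Gi z k m * dG z i m n * Gi z n l))"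
      unfolding A_def wirt_inv_G[OF z] dG_def[symmetric] by (simp add: sum_distrib_left sum_negf)
    also have "\<dots> = - (\<Sum>m\<in>UNIV. \<Sum>n\<in>UNIV. \<Sum>i\<in>UNIV. v $ i * (Gi z k m * dG z i m n * Gi z n l))"
      by (subst sum_rotate3) (rule refl)
    finally show ?thesis
      by (simp add: dGv_def sum_distrib_left sum_distrib_right mult_ac)
  qed
  have B: "B k l = - (\<Sum>m\<in>UNIV. \<Sum>n\<in>UNIV. Gi z k m * cnj (dGv z v n m) * Gi z n l)" for k l
  proof -
    have "B k l = - (\<Sum>i\<in>UNIV. \<Sum>m\<in>UNIV. \<Sum>n\<in>UNIV. cnj (v $ i) * (Gi z k m * cnj (dG z i n m) * Gi z n l))"
      unfolding B_def wirt_inv_G[OF z] dbar_G[OF z] by (simp add: sum_distrib_left sum_negf)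
    also have "\<dots> = - (\<Sum>m\<in>UNIV. \<Sum>n\<in>UNIV. \<Sum>i\<in>UNIV. cnj (v $ i) * (Gi z k m * cnj (dG z i n m) * Gi z n l))"
      by (subst sum_rotate3) (rule refl)
    finally show ?thesis
      by (simp add: dGv_def sum_distrib_left sum_distrib_right mult_ac)
  qed
  have H: "hG z i j l k - hG z i k l j - hG z l j i k = - hG z l k i j" for i j k l
    using pc[of i j l k] by (simp add: eq_neg_iff_add_eq_0)
  have "hform (bismut_ricci_matrix W G z) v v = (\<Sum>i\<in>UNIV. \<Sum>j\<in>UNIV. \<Sum>k\<in>UNIV. \<Sum>l\<in>UNIV.
     - (Gi z k l * (hG z l k i j * v $ i * cnj (v $ j)))
     + (((v $ i * (dG z i l k - dG z l i k)) * (cnj (v $ j) * wdzbar j (\<lambda>z. Gi z k l) z))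
     - ((v $ i * wdz i (\<lambda>z. Gi z k l) z) * (cnj (v $ j * dG z k j l)))))"
    unfolding hform_def bismut_ricci_matrix_expand[OF z] H sum_distrib_right
    by (intro sum.cong refl) (simp add: algebra_simps)
  also have "\<dots> = (\<Sum>k\<in>UNIV. \<Sum>l\<in>UNIV. \<Sum>i\<in>UNIV. \<Sum>j\<in>UNIV.
     - (Gi z k l * (hG z l k i j * v $ i * cnj (v $ j)))
     + (((v $ i * (dG z i l k - dG z l i k)) * (cnj (v $ j) * wdzbar j (\<lambda>z. Gi z k l) z))
     - ((v $ i * wdz i (\<lambda>z. Gi z k l) z) * (cnj (v $ j * dG z k j l)))))"
    by (rule sum_swap_pairs)
  also have "\<dots> = (\<Sum>k\<in>UNIV. \<Sum>l\<in>UNIV.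
     - (Gi z k l * (\<Sum>i\<in>UNIV. \<Sum>j\<in>UNIV. hG z l k i j * v $ i * cnj (v $ j)))
     + ((dGv z v l k - qG z v l k) * B k l - A k l * cnj (qG z v k l)))"
    unfolding sum.distrib sum_subtractf sum_negf sum_product[symmetric] A_def B_def
    unfolding sum_distrib_left[symmetric] cnj_sum[symmetric]
    by (simp add: dGv_def qG_def right_diff_distrib sum_subtractf)
  also have "\<dots> = - (\<Sum>k\<in>UNIV. \<Sum>l\<in>UNIV. Gi z k l * (\<Sum>i\<in>UNIV. \<Sum>j\<in>UNIV. hG z l k i j * v $ i * cnj (v $ j)))
      + ((\<Sum>k\<in>UNIV. \<Sum>l\<in>UNIV. B k l * dGv z v l k) - (\<Sum>k\<in>UNIV. \<Sum>l\<in>UNIV. B k l * qG z v l k)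
         - (\<Sum>k\<in>UNIV. \<Sum>l\<in>UNIV. A k l * cnj (qG z v k l)))"
    by (simp add: sum.distrib sum_subtractf sum_negf algebra_simps)
  finally have fin: "hform (bismut_ricci_matrix W G z) v v = \<dots>" .
  have BX: "(\<Sum>k\<in>UNIV. \<Sum>l\<in>UNIV. B k l * X l k) = - tensor_inner (G z) X (dGv z v)" for X
    unfolding B using tensor_inner_swap[of z "dGv z v" X] by (simp add: sum_negf)
  have AX: "(\<Sum>k\<in>UNIV. \<Sum>l\<in>UNIV. A k l * cnj (qG z v k l)) = - tensor_inner (G z) (dGv z v) (qG z v)"
    unfolding A tensor_inner_def by (simp add: sum_negf sum_distrib_right)
  show ?thesis unfolding fin BX AX by simp
qed

text \<open>Antisymmetrizing in i, l and in j, k, as \<open>del\<close> and \<open>delbar\<close>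
  do, produces the four terms and their signs.\<close>

lemma pluriclosed_components:
  assumes z: "z \<in> W" and pc: "\<And>I J. del (delbar (fundamental_form W G)) z I J = 0"
  shows "hG z i j l k - hG z i k l j - hG z l j i k + hG z l k i j = 0"
proof -
  have w1: "delbar (fundamental_form W G) y [m] [j, k]
    = - (\<i> * (wdzbar j (\<lambda>z. G z $ m $ k) y - wdzbar k (\<lambda>z. G z $ m $ j) y))" if y: "y \<in> W" for y m j k
  proof -
    have "wdzbar j (\<lambda>w. fundamental_form W G w [m] [k]) y = \<i> * wdzbar j (\<lambda>z. G z $ m $ k) y" for j k
    proof -
      have "wdzbar j (\<lambda>w. fundamental_form W G w [m] [k]) y = wdzbar j (\<lambda>z. \<i> * G z $ m $ k) y"
        by (rule wirt_cong_open[OF open_W y]) (simp add: fundamental_form_def)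
      also have "\<dots> = \<i> * wdzbar j (\<lambda>z. G z $ m $ k) y"
        using wirt_mult[where f="\<lambda>z. \<i>", OF differentiable_const diff_G[OF y]] by (simp add: wirt_const)
      finally show ?thesis .
    qed
    then show ?thesis
      by (simp add: delbar_def remove_nth_def dzbar_wirt numeral_2_eq_2 right_diff_distrib)
  qed
  have w2: "wdz i (\<lambda>w. delbar (fundamental_form W G) w [m] [j, k]) z = - (\<i> * (hG z i j m k - hG z i k m j))" for i m
  proof -
    have "wdz i (\<lambda>w. delbar (fundamental_form W G) w [m] [j, k]) z
      = wdz i (\<lambda>y. (-\<i>) * (wdzbar j (\<lambda>z. G z $ m $ k) y - wdzbar k (\<lambda>z. G z $ m $ j) y)) z"
      by (rule wirt_cong_open[OF open_W z]) (simp add: w1)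
    also have "\<dots> = (-\<i>) * wdz i (\<lambda>y. wdzbar j (\<lambda>z. G z $ m $ k) y - wdzbar k (\<lambda>z. G z $ m $ j) y) z"
      using wirt_mult[where f="\<lambda>z. -\<i>", OF differentiable_const differentiable_diff[OF diff_wirt_G[OF z] diff_wirt_G[OF z]]]
      by (simp add: wirt_const)
    also have "\<dots> = - (\<i> * (hG z i j m k - hG z i k m j))"
      unfolding wirt_diff[OF diff_wirt_G[OF z] diff_wirt_G[OF z]] hG_def by simp
    finally show ?thesis .
  qed
  have "del (delbar (fundamental_form W G)) z [i, l] [j, k] = 0" by (rule pc)
  then have "- (\<i> * (hG z i j l k - hG z i k l j)) + \<i> * (hG z l j i k - hG z l k i j) = 0"
    unfolding del_def dz_wirt by (simp add: remove_nth_def numeral_2_eq_2 w2)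
  then have "\<i> * (hG z i j l k - hG z i k l j - hG z l j i k + hG z l k i j) = 0"
    by (simp add: algebra_simps)
  then show ?thesis by (simp only: mult_eq_0_iff) simp
qed

end

section \<open>The Laplacian of the norm of a parallel extension\<close>

lemma linear_axis_expansion:
  fixes L :: "complex^'n::finite \<Rightarrow> complex"
  assumes "linear L"
  shows "L w = (\<Sum>k\<in>UNIV. of_real (Re (w $ k)) * L (axis k 1) + of_real (Im (w $ k)) * L (axis k \<i>))"
proof -
  have "w = (\<Sum>k\<in>UNIV. Re (w $ k) *\<^sub>R axis k 1 + Im (w $ k) *\<^sub>R axis k \<i>)"
  proof (subst vec_eq_iff, intro allI)
    fix i
    have "(\<Sum>k\<in>UNIV. Re (w $ k) *\<^sub>R axis k 1 + Im (w $ k) *\<^sub>R axis k \<i>) $ i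
       = (\<Sum>k\<in>UNIV. if i = k then w $ i else 0)"
      unfolding sum_component
      by (intro sum.cong refl) (auto simp: axis_def complex_eq_iff)
    then show "w $ i = (\<Sum>k\<in>UNIV. Re (w $ k) *\<^sub>R axis k 1 + Im (w $ k) *\<^sub>R axis k \<i>) $ i"
      by simp
  qed
  then have "L w = L (\<Sum>k\<in>UNIV. Re (w $ k) *\<^sub>R axis k 1 + Im (w $ k) *\<^sub>R axis k \<i>)"
    by (rule arg_cong)
  then show ?thesis
    unfolding linear_sum[OF assms] linear_add[OF assms] linear_cmul[OF assms]
    by (simp only: scaleR_conv_of_real)
qed

text \<open>Splits the derivative along w by type, which reduces complex Hessians to real second
  derivatives along w and \<i> w.\<close>

lemma wirt_directional:
  fixes f :: "complex^'n::finite \<Rightarrow> complex"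
  assumes "f differentiable (at x)"
  shows "(\<Sum>k\<in>UNIV. w $ k * wdz k f x)
      = (fd f x w - \<i> * fd f x (\<i> *s w)) / 2"
    "(\<Sum>k\<in>UNIV. cnj (w $ k) * wdzbar k f x)
      = (fd f x w + \<i> * fd f x (\<i> *s w)) / 2"
proof -
  have l: "linear (fd f x)" by (rule linear_frechet_derivative[OF assms])
  let ?D = "fd f x"
  have i: "\<i> * (\<Sum>k\<in>UNIV. of_real (Re ((\<i> *s w) $ k)) * ?D (axis k 1) + of_real (Im ((\<i> *s w) $ k)) * ?D (axis k \<i>))
     = (\<Sum>k\<in>UNIV. \<i> * (of_real (Re (w $ k)) * ?D (axis k \<i>) - of_real (Im (w $ k)) * ?D (axis k 1)))"
    by (simp add: sum_distrib_left)
  show "(\<Sum>k\<in>UNIV. w $ k * wdz k f x) = (?D w - \<i> * ?D (\<i> *s w)) / 2"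
    unfolding linear_axis_expansion[OF l, of w] linear_axis_expansion[OF l, of "\<i> *s w"] i
    unfolding sum_subtractf[symmetric] sum_divide_distrib
  proof (intro sum.cong refl)
    fix k
    have "w $ k = of_real (Re (w $ k)) + \<i> * of_real (Im (w $ k))" by (simp add: complex_eq_iff)
    then have "w $ k * wdz k f x = (of_real (Re (w $ k)) + \<i> * of_real (Im (w $ k))) * wdz k f x" by simp
    then show "w $ k * wdz k f x = (of_real (Re (w $ k)) * ?D (axis k 1) + of_real (Im (w $ k)) * ?D (axis k \<i>)
      - \<i> * (of_real (Re (w $ k)) * ?D (axis k \<i>) - of_real (Im (w $ k)) * ?D (axis k 1))) / 2"
      by (simp add: wirt_def algebra_simps)
  qed
  show "(\<Sum>k\<in>UNIV. cnj (w $ k) * wdzbar k f x) = (?D w + \<i> * ?D (\<i> *s w)) / 2"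
    unfolding linear_axis_expansion[OF l, of w] linear_axis_expansion[OF l, of "\<i> *s w"] i
    unfolding sum.distrib[symmetric] sum_divide_distrib
  proof (intro sum.cong refl)
    fix k
    have "cnj (w $ k) = of_real (Re (w $ k)) - \<i> * of_real (Im (w $ k))" by (simp add: complex_eq_iff)
    then have "cnj (w $ k) * wdzbar k f x = (of_real (Re (w $ k)) - \<i> * of_real (Im (w $ k))) * wdzbar k f x" by simp
    then show "cnj (w $ k) * wdzbar k f x = (of_real (Re (w $ k)) * ?D (axis k 1) + of_real (Im (w $ k)) * ?D (axis k \<i>)
      + \<i> * (of_real (Re (w $ k)) * ?D (axis k \<i>) - of_real (Im (w $ k)) * ?D (axis k 1))) / 2"
      by (simp add: wirt_def algebra_simps)
  qed
qed

text \<open>Four times the real part is the sum of the real second derivatives along w and along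
  \<i> w, both nonpositive at a maximum. The mixed derivatives carry a factor \<i> and drop
  out.\<close>

lemma complex_hessian_nonpos:
  fixes R :: "complex^'n::finite \<Rightarrow> real" and w :: "complex^'n"
  assumes W: "open W" and R: "smooth_on W R" and z: "z \<in> W" and max: "\<And>x. x \<in> W \<Longrightarrow> R x \<le> R z"
  shows "Re (\<Sum>k\<in>UNIV. \<Sum>l\<in>UNIV. w $ k * cnj (w $ l) * wdz k (wdzbar l (\<lambda>x. of_real (R x))) z) \<le> 0"
proof -
  let ?f = "\<lambda>x. complex_of_real (R x)"
  let ?u = "\<i> *s w"
  have f: "smooth_on W ?f" by (rule smooth_on_bounded_linear[OF W bounded_linear_of_real R])
  have sg: "smooth_on W (\<lambda>x. fd ?f x v)" for v by (rule smooth_on_frechet[OF f])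
  let ?g = "\<lambda>x. \<Sum>l\<in>UNIV. cnj (w $ l) * wdzbar l ?f x"
  let ?h = "\<lambda>x. (1/2) * (fd ?f x w + \<i> * fd ?f x ?u)"
  have gs: "wdzbar l ?f differentiable (at z)" for l
    by (rule smooth_on_differentiable[OF smooth_on_wirt[OF W f] z])
  have gd: "(\<lambda>x. cnj (w $ l) * wdzbar l ?f x) differentiable (at z)" for l
    by (intro differentiable_mult differentiable_const gs)
  have "(\<Sum>k\<in>UNIV. \<Sum>l\<in>UNIV. w $ k * cnj (w $ l) * wdz k (wdzbar l ?f) z)
    = (\<Sum>k\<in>UNIV. w $ k * wdz k ?g z)"
    using wirt_mult[OF differentiable_const gs]
    by (simp add: wirt_sum[OF gd] wirt_const sum_distrib_left mult.assoc)
  also have "\<dots> = (\<Sum>k\<in>UNIV. w $ k * wdz k ?h z)"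
    using wirt_directional(2)[OF smooth_on_differentiable[OF f]]
    by (intro sum.cong refl arg_cong2[where f="(*)"] wirt_cong_open[OF W z]) auto
  also have "\<dots> = (fd ?h z w - \<i> * fd ?h z ?u) / 2"
    by (rule wirt_directional(1), rule smooth_on_differentiable[OF _ z])
       (intro smooth_on_mult smooth_on_add smooth_on_const sg W)
  also have "fd ?h z = (\<lambda>v. (1/2) * (fd (\<lambda>x. fd ?f x w) z v
     + \<i> * fd (\<lambda>x. fd ?f x ?u) z v))"
  proof (rule frechet_derivative_eqI)
    have d: "((\<lambda>x. fd ?f x u) has_derivative
        fd (\<lambda>x. fd ?f x u) z) (at z)" for u
      using smooth_on_differentiable[OF sg z] by (simp add: frechet_derivative_works)
    show "(?h has_derivative (\<lambda>v. (1/2) * (fd (\<lambda>x. fd ?f x w) z v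
     + \<i> * fd (\<lambda>x. fd ?f x ?u) z v))) (at z)"
      by (intro has_derivative_mult_right has_derivative_add d)
  qed
  finally have e: "(\<Sum>k\<in>UNIV. \<Sum>l\<in>UNIV. w $ k * cnj (w $ l) * wdz k (wdzbar l ?f) z)
     = ((1/2) * (fd (\<lambda>x. fd ?f x w) z w
     + \<i> * fd (\<lambda>x. fd ?f x ?u) z w)
     - \<i> * ((1/2) * (fd (\<lambda>x. fd ?f x w) z ?u
     + \<i> * fd (\<lambda>x. fd ?f x ?u) z ?u))) / 2" .
  have B: "fd (\<lambda>x. fd ?f x u) z v
      = of_real (fd (\<lambda>x. fd R x u) z v)" for u v
    by (rule second_derivative_bounded_linear[OF W R z bounded_linear_of_real])
  have "Re (\<Sum>k\<in>UNIV. \<Sum>l\<in>UNIV. w $ k * cnj (w $ l) * wdz k (wdzbar l ?f) z)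
      = (fd (\<lambda>x. fd R x w) z w
       + fd (\<lambda>x. fd R x ?u) z ?u) / 4"
    unfolding e B by (simp add: field_simps)
  also have "\<dots> \<le> 0"
    using second_derivative_test[OF W R z max, of w] second_derivative_test[OF W R z max, of ?u] by simp
  finally show ?thesis .
qed

section \<open>Traces of Hessians and parallel extensions\<close>

context hermitian_domain
begin

definition trG :: "complex^'n \<Rightarrow> ('n \<Rightarrow> 'n \<Rightarrow> complex) \<Rightarrow> complex" where
  "trG z M = (\<Sum>k\<in>UNIV. \<Sum>l\<in>UNIV. Gi z l k * M k l)"

lemma trG_frame:
  assumes z: "z \<in> W"
  obtains e :: "'n \<Rightarrow> complex^'n" where
    "\<And>M. trG z M = (\<Sum>a\<in>UNIV. \<Sum>k\<in>UNIV. \<Sum>l\<in>UNIV. e a $ k * cnj (e a $ l) * M k l)"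
proof -
  obtain e :: "'n \<Rightarrow> complex^'n" where e: "\<And>a b. hform (G z) (e a) (e b) = (if a = b then 1 else 0)"
    using orthonormal_frame_exists[OF posdef[OF z]] by blast
  have "trG z M = (\<Sum>a\<in>UNIV. \<Sum>k\<in>UNIV. \<Sum>l\<in>UNIV. e a $ k * cnj (e a $ l) * M k l)" for M
  proof -
    have "trG z M = (\<Sum>k\<in>UNIV. \<Sum>l\<in>UNIV. \<Sum>a\<in>UNIV. e a $ k * cnj (e a $ l) * M k l)"
      unfolding trG_def matrix_inv_frame_component[OF posdef[OF z] e]
      by (simp add: sum_distrib_left sum_distrib_right mult_ac)
    also have "\<dots> = (\<Sum>a\<in>UNIV. \<Sum>k\<in>UNIV. \<Sum>l\<in>UNIV. e a $ k * cnj (e a $ l) * M k l)"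
      by (rule sum_rotate3[symmetric])
    finally show ?thesis .
  qed
  then show ?thesis by (rule that)
qed

lemma trG_hessian_nonpos:
  assumes z: "z \<in> W" and R: "smooth_on W R" and max: "\<And>x. x \<in> W \<Longrightarrow> R x \<le> R z"
  shows "Re (trG z (\<lambda>k l. wdz k (wdzbar l (\<lambda>x. of_real (R x))) z)) \<le> 0"
proof -
  obtain e :: "'n \<Rightarrow> complex^'n" where e: "\<And>M. trG z M = (\<Sum>a\<in>UNIV. \<Sum>k\<in>UNIV. \<Sum>l\<in>UNIV. e a $ k * cnj (e a $ l) * M k l)"
    using trG_frame[OF z] by blast
  show ?thesis unfolding e Re_sum[of _ UNIV]
    by (rule sum_nonpos) (use complex_hessian_nonpos[OF open_W R z max] in \<open>simp add: Re_sum\<close>)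
qed

lemma trG_rank_one_nonneg:
  assumes z: "z \<in> W"
  shows "Re (trG z (\<lambda>k l. a k * cnj (a l))) \<ge> 0"
proof -
  obtain e :: "'n \<Rightarrow> complex^'n" where e: "\<And>M. trG z M = (\<Sum>a\<in>UNIV. \<Sum>k\<in>UNIV. \<Sum>l\<in>UNIV. e a $ k * cnj (e a $ l) * M k l)"
    using trG_frame[OF z] by blast
  have "trG z (\<lambda>k l. a k * cnj (a l)) = (\<Sum>b\<in>UNIV. \<Sum>k\<in>UNIV. \<Sum>l\<in>UNIV. (e b $ k * a k) * cnj (e b $ l * a l))"
    unfolding e by (simp add: mult_ac)
  also have "\<dots> = (\<Sum>b\<in>UNIV. of_real ((norm (\<Sum>k\<in>UNIV. e b $ k * a k))\<^sup>2))"
    unfolding sum_product[symmetric] cnj_sum[symmetric] complex_norm_square ..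
  finally show ?thesis by (simp add: sum_nonneg del: of_real_power)
qed

text \<open>The holomorphic extension of \<open>v\<close> that is parallel at \<open>z0\<close> for the Chern connection.\<close>

definition parallel_ext :: "complex^'n \<Rightarrow> complex^'n \<Rightarrow> complex^'n \<Rightarrow> complex^'n" where
  "parallel_ext z0 v z = (\<chi> a. v $ a
     + (\<Sum>k\<in>UNIV. - (\<Sum>j\<in>UNIV. qG z0 v k j * Gi z0 j a) * (z $ k - z0 $ k)))"

lemma parallel_ext_base: "parallel_ext z0 v z0 = v"
  by (simp add: parallel_ext_def)

lemma smooth_parallel_ext: "smooth_on S (\<lambda>z. parallel_ext z0 v z $ a)" if "open S"
  unfolding parallel_ext_def
  by (simp, intro smooth_on_add smooth_on_sum smooth_on_mult smooth_on_diff smooth_on_uminus smooth_on_const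
      smooth_on_component that)

lemma wirt_parallel_ext:
  "wirt c k (\<lambda>z. parallel_ext z0 v z $ a) z = - (\<Sum>j\<in>UNIV. qG z0 v k j * Gi z0 j a) * ((1 + c * \<i>) / 2)"
proof -
  have d: "(\<lambda>z::complex^'n. z $ i - z0 $ i) differentiable (at z)" for i
    by (intro differentiable_diff differentiable_component differentiable_const)
  have m: "wirt c k (\<lambda>z. r * (z $ i - z0 $ i)) z = r * (if k = i then (1 + c * \<i>) / 2 else 0)" for r i
    using wirt_mult[OF differentiable_const[of r] d[of i]]
    by (simp add: wirt_const wirt_diff differentiable_component wirt_component)
  have md: "(\<lambda>z::complex^'n. r * (z $ i - z0 $ i)) differentiable (at z)" for r i
    by (intro differentiable_mult differentiable_const d)
  define r where "r i = - (\<Sum>j\<in>UNIV. qG z0 v i j * Gi z0 j a)" for i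
  have rd: "(\<lambda>z::complex^'n. \<Sum>i\<in>UNIV. r i * (z $ i - z0 $ i)) differentiable (at z)"
    by (intro differentiable_sum finite ballI md)
  have "wirt c k (\<lambda>z. v $ a + (\<Sum>i\<in>UNIV. r i * (z $ i - z0 $ i))) z
    = (\<Sum>i\<in>UNIV. r i * (if k = i then (1 + c * \<i>) / 2 else 0))"
    unfolding wirt_add[OF differentiable_const rd] wirt_const wirt_sum[where f="\<lambda>i z. r i * (z $ i - z0 $ i)", OF md] m
    by simp
  also have "\<dots> = r k * ((1 + c * \<i>) / 2)"
    by (simp add: if_distrib cong: if_cong)
  finally show ?thesis
    by (simp add: parallel_ext_def r_def)
qed

lemma wirt_parallel_ext_dbar: "wdzbar k (\<lambda>z. parallel_ext z0 v z $ a) z = 0"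
  by (simp add: wirt_parallel_ext)

lemma wirt_parallel_ext_d: "wdz k (\<lambda>z. parallel_ext z0 v z $ a) z = - (\<Sum>j\<in>UNIV. qG z0 v k j * Gi z0 j a)"
  by (simp add: wirt_parallel_ext)

text \<open>Kept complex-valued, although its values on W are real, so that Wirtinger derivatives
  apply.\<close>

definition sqn :: "complex^'n \<Rightarrow> complex^'n \<Rightarrow> complex^'n \<Rightarrow> complex" where
  "sqn z0 v z = hform (G z) (parallel_ext z0 v z) (parallel_ext z0 v z)"

lemma smooth_sqn: "smooth_on W (sqn z0 v)"
  unfolding sqn_def[abs_def] hform_def
  by (intro smooth_on_sum smooth_on_mult smooth_on_cnj smooth_parallel_ext smooth_G open_W)

lemma diff_ext: "(\<lambda>z. parallel_ext z0 v z $ a) differentiable (at z)"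
  by (rule smooth_on_differentiable[OF smooth_parallel_ext[OF open_UNIV]]) simp

lemma diff_ext_cnj: "(\<lambda>z. cnj (parallel_ext z0 v z $ a)) differentiable (at z)"
  by (rule differentiable_cnj[OF diff_ext])

lemma wirt_sqn_term:
  assumes "f differentiable (at z)"
  shows "wirt c k (\<lambda>z. f z * parallel_ext z0 v z $ i * cnj (parallel_ext z0 v z $ j)) z
    = wirt c k f z * parallel_ext z0 v z $ i * cnj (parallel_ext z0 v z $ j)
     + f z * wirt c k (\<lambda>z. parallel_ext z0 v z $ i) z * cnj (parallel_ext z0 v z $ j)
     + f z * parallel_ext z0 v z $ i * cnj (wirt (cnj c) k (\<lambda>z. parallel_ext z0 v z $ j) z)"
  using wirt_mult[OF differentiable_mult[OF assms diff_ext] diff_ext_cnj]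
    wirt_mult[OF assms diff_ext] wirt_cnj[OF diff_ext]
  by (simp add: algebra_simps)

lemma wirt_sqn:
  assumes z: "z \<in> W"
  shows "wirt c k (sqn z0 v) z = (\<Sum>i\<in>UNIV. \<Sum>j\<in>UNIV.
       wirt c k (\<lambda>z. G z $ i $ j) z * parallel_ext z0 v z $ i * cnj (parallel_ext z0 v z $ j)
     + G z $ i $ j * wirt c k (\<lambda>z. parallel_ext z0 v z $ i) z * cnj (parallel_ext z0 v z $ j)
     + G z $ i $ j * parallel_ext z0 v z $ i * cnj (wirt (cnj c) k (\<lambda>z. parallel_ext z0 v z $ j) z))"
proof -
  have d: "(\<lambda>z. G z $ i $ j * parallel_ext z0 v z $ i * cnj (parallel_ext z0 v z $ j)) differentiable (at z)" for i j
    by (intro differentiable_mult diff_G z diff_ext diff_ext_cnj)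
  have "wirt c k (sqn z0 v) z = (\<Sum>i\<in>UNIV. \<Sum>j\<in>UNIV. wirt c k (\<lambda>z. G z $ i $ j * parallel_ext z0 v z $ i * cnj (parallel_ext z0 v z $ j)) z)"
    unfolding sqn_def[abs_def] hform_def
    by (subst wirt_sum) (auto intro!: differentiable_sum d sum.cong wirt_sum)
  then show ?thesis by (simp add: wirt_sqn_term[OF diff_G[OF z]])
qed

text \<open>Chern-parallelism at z in lowered form: the connection term \<open>qG\<close> cancels
  the derivative of the extension. As the extension is affine, that derivative may be taken at any
  x.\<close>

lemma lower_ext:
  assumes z: "z \<in> W"
  shows "(\<Sum>i\<in>UNIV. G z $ i $ j * wdz k (\<lambda>y. parallel_ext z v y $ i) x) = - qG z v k j"
proof -
  have "(\<Sum>i\<in>UNIV. G z $ i $ j * wdz k (\<lambda>y. parallel_ext z v y $ i) x)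
    = - (\<Sum>i\<in>UNIV. (\<Sum>m\<in>UNIV. qG z v k m * Gi z m i) * G z $ i $ j)"
    by (simp add: wirt_parallel_ext_d sum_negf mult.commute)
  then show ?thesis using lower_index_01[OF z, of "qG z v k" j] by simp
qed

text \<open>Since V is holomorphic, the z_k-derivative of g(V,V) sees only the covariant derivative
  of V, which is 0 at z. Reality of \<open>sqn\<close> then gives the conjugate derivative.\<close>

lemma wirt_sqn_base:
  assumes z: "z \<in> W"
  shows "wdz k (sqn z v) z = 0" "wdzbar k (sqn z v) z = 0"
proof -
  have "wdz k (sqn z v) z = (\<Sum>i\<in>UNIV. \<Sum>j\<in>UNIV. dG z k i j * v $ i * cnj (v $ j)
      + G z $ i $ j * wdz k (\<lambda>y. parallel_ext z v y $ i) z * cnj (v $ j))"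
    unfolding wirt_sqn[OF z] by (simp add: parallel_ext_base wirt_parallel_ext_dbar dG_def)
  also have "\<dots> = (\<Sum>j\<in>UNIV. (\<Sum>i\<in>UNIV. v $ i * dG z k i j) * cnj (v $ j)
      + (\<Sum>i\<in>UNIV. G z $ i $ j * wdz k (\<lambda>y. parallel_ext z v y $ i) z) * cnj (v $ j))"
    by (subst sum.swap) (simp add: sum.distrib sum_distrib_left sum_distrib_right mult_ac)
  also have "\<dots> = 0" unfolding lower_ext[OF z] by (simp add: qG_def)
  finally show 1: "wdz k (sqn z v) z = 0" .
  have "wdzbar k (sqn z v) z = wdzbar k (\<lambda>x. cnj (sqn z v x)) z"
    by (rule wirt_cong_open[OF open_W z]) (unfold sqn_def, rule hform_hermitian[OF posdef])
  also have "\<dots> = cnj (wdz k (sqn z v) z)"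
    using wirt_cnj[OF smooth_on_differentiable[OF smooth_sqn z]] by simp
  finally show "wdzbar k (sqn z v) z = 0" using 1 by simp
qed

text \<open>Holomorphy and parallelism at z eliminate all derivatives of V except through the
  connection, and what is left is minus the Chern curvature in directions k and l, evaluated on
  v.\<close>

lemma hessian_sqn:
  assumes z: "z \<in> W"
  shows "wdz k (wdzbar l (sqn z v)) z = (\<Sum>i\<in>UNIV. \<Sum>j\<in>UNIV. hG z k l i j * v $ i * cnj (v $ j))
     - (\<Sum>i\<in>UNIV. \<Sum>j\<in>UNIV. qG z v k j * Gi z j i * cnj (qG z v l i))"
proof -
  let ?V = "\<lambda>y. parallel_ext z v y"
  define L where "L i k = - (\<Sum>j\<in>UNIV. qG z v k j * Gi z j i)" for i k
  have WL: "wdz k (\<lambda>y. ?V y $ i) x = L i k" for i k x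
    by (simp add: wirt_parallel_ext_d L_def)
  have GL: "(\<Sum>i\<in>UNIV. G z $ i $ j * L i k) = - qG z v k j" for j k
    using lower_ext[OF z, of j k v z] by (simp add: WL)
  have d1: "(\<lambda>y. wdzbar l (\<lambda>z. G z $ i $ j) y * ?V y $ i * cnj (?V y $ j)) differentiable (at z)" for i j
    by (intro differentiable_mult diff_wirt_G z diff_ext diff_ext_cnj)
  have d2: "(\<lambda>y. G y $ i $ j * ?V y $ i) differentiable (at z)" for i j
    by (intro differentiable_mult diff_G z diff_ext)
  have d3: "(\<lambda>y. (G y $ i $ j * ?V y $ i) * cnj (L j l)) differentiable (at z)" for i j
    by (intro differentiable_mult differentiable_const d2)
  have "wdz k (wdzbar l (sqn z v)) z = wdz k (\<lambda>y. \<Sum>i\<in>UNIV. \<Sum>j\<in>UNIV.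
       wdzbar l (\<lambda>z. G z $ i $ j) y * ?V y $ i * cnj (?V y $ j)
     + (G y $ i $ j * ?V y $ i) * cnj (L j l)) z"
    by (rule wirt_cong_open[OF open_W z]) (simp add: wirt_sqn wirt_parallel_ext_dbar WL)
  also have "\<dots> = (\<Sum>i\<in>UNIV. \<Sum>j\<in>UNIV. wdz k (\<lambda>y. wdzbar l (\<lambda>z. G z $ i $ j) y * ?V y $ i * cnj (?V y $ j)
     + (G y $ i $ j * ?V y $ i) * cnj (L j l)) z)"
    by (subst wirt_sum) (auto intro!: differentiable_sum differentiable_add d1 d3 sum.cong wirt_sum)
  also have "\<dots> = (\<Sum>i\<in>UNIV. \<Sum>j\<in>UNIV. (hG z k l i j * v $ i * cnj (v $ j)
       + cnj (dG z l j i) * L i k * cnj (v $ j))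
     + (dG z k i j * v $ i + G z $ i $ j * L i k) * cnj (L j l))"
    by (simp add: wirt_add[OF d1 d3] wirt_sqn_term[OF diff_wirt_G[OF z]] wirt_mult[OF d2 differentiable_const]
        wirt_mult[OF diff_G[OF z] diff_ext] wirt_const WL wirt_parallel_ext_dbar parallel_ext_base
        dbar_G[OF z] hG_def[symmetric] dG_def[symmetric])
  also have "\<dots> = (\<Sum>i\<in>UNIV. \<Sum>j\<in>UNIV. hG z k l i j * v $ i * cnj (v $ j))
      + (\<Sum>i\<in>UNIV. \<Sum>j\<in>UNIV. L i k * cnj (v $ j * dG z l j i))
      + (\<Sum>j\<in>UNIV. \<Sum>i\<in>UNIV. (v $ i * dG z k i j + G z $ i $ j * L i k) * cnj (L j l))"
    unfolding sum.distrib
    by (subst (3) sum.swap) (simp add: mult_ac)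
  \<comment> \<open>The inner sum is the z_k-derivative at z of the j-th component of V lowered by
    g; parallelism makes it 0.\<close>
  also have "(\<Sum>j\<in>UNIV. \<Sum>i\<in>UNIV. (v $ i * dG z k i j + G z $ i $ j * L i k) * cnj (L j l)) = 0"
    unfolding sum_distrib_right[symmetric] sum.distrib GL by (simp add: qG_def)
  also have "(\<Sum>i\<in>UNIV. \<Sum>j\<in>UNIV. L i k * cnj (v $ j * dG z l j i)) = (\<Sum>i\<in>UNIV. L i k * cnj (qG z v l i))"
    unfolding sum_distrib_left[symmetric] cnj_sum[symmetric] qG_def ..
  also have "\<dots> = - (\<Sum>i\<in>UNIV. \<Sum>j\<in>UNIV. qG z v k j * Gi z j i * cnj (qG z v l i))"
    by (simp add: L_def sum_distrib_right sum_negf)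
  finally show ?thesis by simp
qed

text \<open>Here the square is completed: with \<open>ricci_quadratic\<close> the trace equals minus
  \<rho>(v,v) minus the squared norm of the torsion contracted with v.\<close>

lemma trG_hessian_sqn:
  assumes z: "z \<in> W" and pc: "\<And>i j k l. hG z i j l k - hG z i k l j - hG z l j i k + hG z l k i j = 0"
  shows "Re (trG z (\<lambda>k l. wdz k (wdzbar l (sqn z v)) z)) \<le> - Re (hform (bismut_ricci_matrix W G z) v v)"
proof -
  have "trG z (\<lambda>k l. wdz k (wdzbar l (sqn z v)) z)
    = (\<Sum>k\<in>UNIV. \<Sum>l\<in>UNIV. Gi z l k * (\<Sum>i\<in>UNIV. \<Sum>j\<in>UNIV. hG z k l i j * v $ i * cnj (v $ j)))
     - (\<Sum>k\<in>UNIV. \<Sum>l\<in>UNIV. Gi z l k * (\<Sum>i\<in>UNIV. \<Sum>j\<in>UNIV. qG z v k j * Gi z j i * cnj (qG z v l i)))"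
    unfolding trG_def hessian_sqn[OF z] by (simp add: right_diff_distrib sum_subtractf)
  also have "(\<Sum>k\<in>UNIV. \<Sum>l\<in>UNIV. Gi z l k * (\<Sum>i\<in>UNIV. \<Sum>j\<in>UNIV. qG z v k j * Gi z j i * cnj (qG z v l i)))
      = tensor_inner (G z) (qG z v) (qG z v)"
  proof -
    have "(\<Sum>k\<in>UNIV. \<Sum>l\<in>UNIV. Gi z l k * (\<Sum>i\<in>UNIV. \<Sum>j\<in>UNIV. qG z v k j * Gi z j i * cnj (qG z v l i)))
      = (\<Sum>l\<in>UNIV. \<Sum>k\<in>UNIV. \<Sum>i\<in>UNIV. \<Sum>j\<in>UNIV. Gi z l k * qG z v k j * Gi z j i * cnj (qG z v l i))"
      by (subst sum.swap) (simp add: sum_distrib_left mult_ac)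
    also have "\<dots> = tensor_inner (G z) (qG z v) (qG z v)"
      unfolding tensor_inner_def
      by (rule sum.cong[OF refl], rule sum.swap)
    finally show ?thesis .
  qed
  also have "(\<Sum>k\<in>UNIV. \<Sum>l\<in>UNIV. Gi z l k * (\<Sum>i\<in>UNIV. \<Sum>j\<in>UNIV. hG z k l i j * v $ i * cnj (v $ j)))
     = (\<Sum>k\<in>UNIV. \<Sum>l\<in>UNIV. Gi z k l * (\<Sum>i\<in>UNIV. \<Sum>j\<in>UNIV. hG z l k i j * v $ i * cnj (v $ j)))"
    by (rule sum.swap)
  finally have "trG z (\<lambda>k l. wdz k (wdzbar l (sqn z v)) z) = - hform (bismut_ricci_matrix W G z) v v
     - tensor_inner (G z) (\<lambda>m n. dGv z v m n - qG z v m n) (\<lambda>m n. dGv z v m n - qG z v m n)"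
    unfolding ricci_quadratic[OF z pc] tensor_inner_diff by simp
  then show ?thesis using tensor_inner_nonneg[OF posdef[OF z]] by simp
qed

section \<open>Bochner argument at a maximum\<close>

text \<open>Every cross term of the product rule contains a factor \<open>wdzbar l (f s) z\<close>,
  which is 0, and the undifferentiated factors are 1 at z.\<close>

lemma hessian_prod:
  assumes z: "z \<in> W" and S: "finite S" and f: "\<And>s. s \<in> S \<Longrightarrow> smooth_on W (f s)"
    and one: "\<And>s. s \<in> S \<Longrightarrow> f s z = 1" and d0: "\<And>s. s \<in> S \<Longrightarrow> wdzbar l (f s) z = 0"
  shows "wdz k (wdzbar l (\<lambda>x. \<Prod>s\<in>S. f s x)) z = (\<Sum>s\<in>S. wdz k (wdzbar l (f s)) z)"
proof -
  have df: "f s differentiable (at x)" if "s \<in> S" "x \<in> W" for s x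
    by (rule smooth_on_differentiable[OF f that(2)]) (fact that)
  have dw: "wdzbar l (f s) differentiable (at z)" if "s \<in> S" for s
    by (rule smooth_on_differentiable[OF smooth_on_wirt[OF open_W f[OF that]] z])
  have dp: "(\<lambda>x. \<Prod>t\<in>S - {s}. f t x) differentiable (at z)" for s
    by (rule smooth_on_differentiable[OF smooth_on_prod[OF open_W f] z]) auto
  have "wdz k (wdzbar l (\<lambda>x. \<Prod>s\<in>S. f s x)) z
     = wdz k (\<lambda>x. \<Sum>s\<in>S. wdzbar l (f s) x * (\<Prod>t\<in>S - {s}. f t x)) z"
    by (rule wirt_cong_open[OF open_W z]) (rule wirt_prod[OF S df])
  also have "\<dots> = (\<Sum>s\<in>S. wdz k (\<lambda>x. wdzbar l (f s) x * (\<Prod>t\<in>S - {s}. f t x)) z)"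
    by (rule wirt_sum) (intro differentiable_mult dw dp)
  also have "\<dots> = (\<Sum>s\<in>S. wdz k (wdzbar l (f s)) z)"
    by (intro sum.cong refl) (simp add: wirt_mult[OF dw dp] d0 one)
  finally show ?thesis .
qed

lemma bochner_at_max:
  assumes z: "z \<in> W" and pc: "\<And>i j k l. hG z i j l k - hG z i k l j - hG z l j i k + hG z l k i j = 0"
    and S: "finite S" and unit: "\<And>s. s \<in> S \<Longrightarrow> hform (G z) (v s) (v s) = 1"
    and \<Phi>: "smooth_on W \<Phi>" and hol: "\<And>x l. x \<in> W \<Longrightarrow> wdzbar l \<Phi> x = 0"
    and le: "\<And>x. x \<in> W \<Longrightarrow> (norm (\<Phi> x))\<^sup>2 \<le> m * (\<Prod>s\<in>S. Re (sqn z (v s) x))"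
    and eq: "(norm (\<Phi> z))\<^sup>2 = m" and m: "m > 0"
  shows "(\<Sum>s\<in>S. Re (hform (bismut_ricci_matrix W G z) (v s) (v s))) \<le> 0"
proof -
  \<comment> \<open>Written with \<open>cnj\<close> and complex factors so that the Wirtinger rules
    apply; \<open>FR\<close> identifies it with the real difference whose maximum over W is 0,
    attained at z.\<close>
  define F where "F x = \<Phi> x * cnj (\<Phi> x) + of_real (- m) * (\<Prod>s\<in>S. sqn z (v s) x)" for x
  have sF: "smooth_on W F" unfolding F_def[abs_def]
    by (intro smooth_on_add smooth_on_mult smooth_on_cnj smooth_on_const smooth_on_prod smooth_sqn \<Phi> open_W)
  have FR: "F x = of_real ((norm (\<Phi> x))\<^sup>2 - m * (\<Prod>s\<in>S. Re (sqn z (v s) x)))" if "x \<in> W" for x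
  proof -
    have "sqn z (v s) x = of_real (Re (sqn z (v s) x))" for s
      unfolding sqn_def by (rule hform_real[OF posdef[OF that]])
    then have "(\<Prod>s\<in>S. sqn z (v s) x) = (\<Prod>s\<in>S. of_real (Re (sqn z (v s) x)))"
      by (intro prod.cong refl)
    then show ?thesis
      unfolding F_def by (simp only: of_real_diff of_real_mult of_real_prod complex_norm_square of_real_minus) simp
  qed
  have unit': "sqn z (v s) z = 1" if "s \<in> S" for s
    using unit[OF that] by (simp add: sqn_def parallel_ext_base)
  have Fz: "F z = 0" using FR[OF z] unit' eq by simp
  have "Re (trG z (\<lambda>k l. wdz k (wdzbar l (\<lambda>x. of_real (Re (F x)))) z)) \<le> 0"
  proof (rule trG_hessian_nonpos[OF z])
    show "smooth_on W (\<lambda>x. Re (F x))" by (rule smooth_on_bounded_linear[OF open_W bounded_linear_Re sF])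
    show "Re (F x) \<le> Re (F z)" if "x \<in> W" for x
      using le[OF that] unfolding FR[OF that] Fz Re_complex_of_real by simp
  qed
  moreover have "wdz k (wdzbar l (\<lambda>x. of_real (Re (F x)))) z
     = wdz k \<Phi> z * cnj (wdz l \<Phi> z) - of_real m * (\<Sum>s\<in>S. wdz k (wdzbar l (sqn z (v s))) z)" for k l
  proof -
    have d\<Phi>: "\<Phi> differentiable (at x)" if "x \<in> W" for x by (rule smooth_on_differentiable[OF \<Phi> that])
    have sp: "smooth_on W (\<lambda>x. \<Prod>s\<in>S. sqn z (v s) x)" by (intro smooth_on_prod smooth_sqn open_W)
    have dp: "(\<lambda>x. \<Prod>s\<in>S. sqn z (v s) x) differentiable (at x)" if "x \<in> W" for x
      by (rule smooth_on_differentiable[OF sp that])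
    have dw: "wdzbar l (\<lambda>x. \<Prod>s\<in>S. sqn z (v s) x) differentiable (at z)"
      by (rule smooth_on_differentiable[OF smooth_on_wirt[OF open_W sp] z])
    have dw\<Phi>: "(\<lambda>x. cnj (wdz l \<Phi> x)) differentiable (at z)"
      by (rule differentiable_cnj, rule smooth_on_differentiable[OF smooth_on_wirt[OF open_W \<Phi>] z])
    have "wdzbar l (\<lambda>x. of_real (Re (F x))) x
        = \<Phi> x * cnj (wdz l \<Phi> x) + of_real (-m) * wdzbar l (\<lambda>x. \<Prod>s\<in>S. sqn z (v s) x) x" if x: "x \<in> W" for x
    proof -
      have "wdzbar l (\<lambda>x. of_real (Re (F x))) x = wdzbar l F x"
        by (rule wirt_cong_open[OF open_W x]) (simp add: FR)
      also have "\<dots> = wdzbar l (\<lambda>x. \<Phi> x * cnj (\<Phi> x)) x + wdzbar l (\<lambda>x. of_real (-m) * (\<Prod>s\<in>S. sqn z (v s) x)) x"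
        unfolding F_def[abs_def]
        by (rule wirt_add) (intro differentiable_mult differentiable_cnj differentiable_const d\<Phi> dp x)+
      also have "wdzbar l (\<lambda>x. \<Phi> x * cnj (\<Phi> x)) x = \<Phi> x * cnj (wdz l \<Phi> x)"
        unfolding wirt_mult[OF d\<Phi>[OF x] differentiable_cnj[OF d\<Phi>[OF x]]] wirt_cnj[OF d\<Phi>[OF x]] by (simp add: hol x)
      also have "wdzbar l (\<lambda>x. of_real (-m) * (\<Prod>s\<in>S. sqn z (v s) x)) x = of_real (-m) * wdzbar l (\<lambda>x. \<Prod>s\<in>S. sqn z (v s) x) x"
        unfolding wirt_mult[OF differentiable_const dp[OF x]] wirt_const by simp
      finally show ?thesis .
    qed
    then have "wdz k (wdzbar l (\<lambda>x. of_real (Re (F x)))) z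
      = wdz k (\<lambda>x. \<Phi> x * cnj (wdz l \<Phi> x) + of_real (-m) * wdzbar l (\<lambda>x. \<Prod>s\<in>S. sqn z (v s) x) x) z"
      by (rule wirt_cong_open[OF open_W z])
    also have "\<dots> = wdz k (\<lambda>x. \<Phi> x * cnj (wdz l \<Phi> x)) z
        + wdz k (\<lambda>x. of_real (-m) * wdzbar l (\<lambda>x. \<Prod>s\<in>S. sqn z (v s) x) x) z"
      by (rule wirt_add) (intro differentiable_mult dw\<Phi> differentiable_const d\<Phi> dw z)+
    also have "wdz k (\<lambda>x. \<Phi> x * cnj (wdz l \<Phi> x)) z = wdz k \<Phi> z * cnj (wdz l \<Phi> z)"
    proof -
      \<comment> \<open>Through the conjugation the derivative becomes \<open>wdzbar k\<close>,
        which commutes with \<open>wdz l\<close> and annihilates \<Phi>; only the product of first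
        derivatives survives.\<close>
      have "wdz k (\<lambda>x. cnj (wdz l \<Phi> x)) z = cnj (wdzbar k (wdz l \<Phi>) z)"
        using wirt_cnj[OF smooth_on_differentiable[OF smooth_on_wirt[OF open_W \<Phi>] z]] by simp
      also have "wdzbar k (wdz l \<Phi>) z = wdz l (wdzbar k \<Phi>) z"
        by (rule wirt_commute[OF open_W \<Phi> z])
      also have "\<dots> = wdz l (\<lambda>x. 0) z"
        by (rule wirt_cong_open[OF open_W z]) (rule hol)
      finally have "wdz k (\<lambda>x. cnj (wdz l \<Phi> x)) z = 0" by (simp add: wirt_const)
      then show ?thesis by (simp add: wirt_mult[OF d\<Phi>[OF z] dw\<Phi>])
    qed
    also have "wdz k (\<lambda>x. of_real (-m) * wdzbar l (\<lambda>x. \<Prod>s\<in>S. sqn z (v s) x) x) z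
        = of_real (-m) * wdz k (wdzbar l (\<lambda>x. \<Prod>s\<in>S. sqn z (v s) x)) z"
      unfolding wirt_mult[OF differentiable_const dw] wirt_const by simp
    also have "wdz k (wdzbar l (\<lambda>x. \<Prod>s\<in>S. sqn z (v s) x)) z = (\<Sum>s\<in>S. wdz k (wdzbar l (sqn z (v s))) z)"
      by (rule hessian_prod[OF z S smooth_sqn unit' wirt_sqn_base(2)[OF z]])
    finally show ?thesis by simp
  qed
  moreover have "trG z (\<lambda>k l. wdz k \<Phi> z * cnj (wdz l \<Phi> z) - of_real m * (\<Sum>s\<in>S. M s k l))
     = trG z (\<lambda>k l. wdz k \<Phi> z * cnj (wdz l \<Phi> z)) - of_real m * (\<Sum>s\<in>S. trG z (M s))" for M
  proof -
    have "(\<Sum>s\<in>S. trG z (M s)) = trG z (\<lambda>k l. \<Sum>s\<in>S. M s k l)"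
      unfolding trG_def sum_distrib_left by (rule sum_rotate3)
    then show ?thesis
      unfolding trG_def by (simp add: right_diff_distrib sum_subtractf sum_distrib_left mult_ac)
  qed
  ultimately have "Re (trG z (\<lambda>k l. wdz k \<Phi> z * cnj (wdz l \<Phi> z)))
      - m * (\<Sum>s\<in>S. Re (trG z (\<lambda>k l. wdz k (wdzbar l (sqn z (v s))) z))) \<le> 0"
    by simp
  \<comment> \<open>The gradient term of \<Phi> has nonnegative trace, so dropping it preserves the
    inequality.\<close>
  then have "m * (\<Sum>s\<in>S. Re (trG z (\<lambda>k l. wdz k (wdzbar l (sqn z (v s))) z))) \<ge> 0"
    using trG_rank_one_nonneg[OF z, of "\<lambda>k. wdz k \<Phi> z"] by simp
  then have "0 \<le> (\<Sum>s\<in>S. Re (trG z (\<lambda>k l. wdz k (wdzbar l (sqn z (v s))) z)))"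
    using m by (simp add: zero_le_mult_iff)
  also have "\<dots> \<le> (\<Sum>s\<in>S. - Re (hform (bismut_ricci_matrix W G z) (v s) (v s)))"
    by (intro sum_mono trG_hessian_sqn[OF z pc])
  finally show ?thesis by (simp add: sum_negf)
qed

end

section \<open>Evaluation of (p,0)-forms on tuples of vectors\<close>

text \<open>Expanding the product of sums selects one index per factor, and such a selection is a
  list of length p.\<close>

lemma sum_lists_prod:
  fixes f :: "nat \<Rightarrow> 'n::finite \<Rightarrow> complex"
  shows "(\<Sum>I | length I = p. \<Prod>s<p. f s (I ! s)) = (\<Prod>s<p. \<Sum>i\<in>UNIV. f s i)"
proof (induction p arbitrary: f)
  case (Suc p)
  have s: "{I::'n list. length I = Suc p} = (\<lambda>(i, I). i # I) ` (UNIV \<times> {I. length I = p})"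
    by (auto simp: length_Suc_conv image_iff)
  have "(\<Sum>I | length I = Suc p. \<Prod>s<Suc p. f s (I ! s))
      = (\<Sum>(i, I)\<in>UNIV \<times> {I. length I = p}. f 0 i * (\<Prod>s<p. f (Suc s) (I ! s)))"
    unfolding s by (subst sum.reindex) (auto simp: inj_on_def prod.lessThan_Suc_shift case_prod_unfold intro!: sum.cong simp del: prod.lessThan_Suc)
  also have "\<dots> = (\<Sum>i\<in>UNIV. f 0 i) * (\<Sum>I | length I = p. \<Prod>s<p. f (Suc s) (I ! s))"
    unfolding sum.cartesian_product[symmetric] by (rule sum_product[symmetric])
  also have "\<dots> = (\<Prod>s<Suc p. \<Sum>i\<in>UNIV. f s i)"
    unfolding Suc.IH[of "\<lambda>s. f (Suc s)"] by (simp add: prod.lessThan_Suc_shift del: prod.lessThan_Suc)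
  finally show ?case .
qed simp

lemma finite_lists_length: "finite {I::'n::finite list. length I = p}"
  using finite_lists_length_eq[of "UNIV::'n set" p] by simp

text \<open>The value of a (p,0)-form on p vectors: the 1/p! of the coefficient convention cancels
  against the p! permutations in the wedge product.\<close>

definition form_ev :: "nat \<Rightarrow> ('n::finite list \<Rightarrow> complex) \<Rightarrow> (nat \<Rightarrow> complex^'n) \<Rightarrow> complex" where
  "form_ev p a v = (\<Sum>I | length I = p. a I * (\<Prod>s<p. v s $ (I ! s)))"

lemma form_ev_cong: "(\<And>s. s < p \<Longrightarrow> v s = w s) \<Longrightarrow> form_ev p a v = form_ev p a w"
  by (auto simp: form_ev_def intro!: sum.cong prod.cong)

lemma form_ev_scale: "form_ev p a (\<lambda>s. k s *s v s) = (\<Prod>s<p. k s) * form_ev p a v"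
  by (simp add: form_ev_def prod.distrib sum_distrib_left mult_ac)

lemma form_ev_zero: "s < p \<Longrightarrow> v s = 0 \<Longrightarrow> form_ev p a v = 0"
  unfolding form_ev_def by (rule sum.neutral) (auto intro!: prod_zero bexI[of _ s])

text \<open>Coordinate vectors recover the coefficients, so a nonzero form has a nonzero value on
  some tuple of nonzero vectors.\<close>

lemma form_ev_axis:
  assumes "length I = p"
  shows "form_ev p a (\<lambda>s. axis (I ! s) 1) = a I"
proof -
  have "(\<Prod>s<p. axis (I ! s) 1 $ (K ! s)) = (if K = I then 1 else 0 :: complex)" if lK: "length K = p" for K
  proof (cases "K = I")
    case False
    then obtain s where "s < p" "K ! s \<noteq> I ! s" using lK assms by (auto simp: list_eq_iff_nth_eq)
    then show ?thesis using False by (auto simp: axis_def intro!: prod_zero bexI[of _ s])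
  qed (simp add: axis_def)
  then have "form_ev p a (\<lambda>s. axis (I ! s) 1) = (\<Sum>K | length K = p. a K * (if K = I then 1 else 0))"
    unfolding form_ev_def by (intro sum.cong) auto
  also have "\<dots> = a I"
    using assms by (simp add: if_distrib finite_lists_length cong: if_cong)
  finally show ?thesis .
qed

lemma form_ev_diff_slot:
  assumes s: "s < p"
  shows "form_ev p a (v(s := u - k *s w)) = form_ev p a (v(s := u)) - k * form_ev p a (v(s := w))"
proof -
  have e: "(\<Prod>r<p. (v(s := x)) r $ (I ! r)) = x $ (I ! s) * (\<Prod>r\<in>{..<p}-{s}. v r $ (I ! r))" for x I
    using s by (subst prod.remove[of _ s]) (auto intro!: prod.cong)
  show ?thesis unfolding form_ev_def e
    by (simp add: algebra_simps sum_subtractf sum_distrib_left)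
qed

text \<open>Exchanging the entries s and t of the index list changes the sign of the coefficient but
  not the product of vector components, so the sum equals its own negative.\<close>

lemma form_ev_repeat:
  assumes alt: "\<And>I \<sigma>. length I = p \<Longrightarrow> \<sigma> permutes {..<p} \<Longrightarrow> a (permute_list \<sigma> I) = of_int (sign \<sigma>) * a I"
    and st: "s < p" "t < p" "s \<noteq> t" and v: "v s = v t"
  shows "form_ev p a v = 0"
proof -
  define \<tau> where "\<tau> = Transposition.transpose s t"
  have \<tau>: "\<tau> permutes {..<p}" unfolding \<tau>_def using st by (intro permutes_swap_id) auto
  have sg: "sign \<tau> = -1" using st by (simp add: \<tau>_def sign_swap_id)
  have inv: "\<tau> (\<tau> r) = r" for r by (simp add: \<tau>_def)
  let ?f = "\<lambda>I. a I * (\<Prod>r<p. v r $ (I ! r))"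
  have pl: "permute_list \<tau> (permute_list \<tau> I) = I" if "length I = p" for I :: "'a list"
    using that \<tau> inv permutes_in_image[OF \<tau>] by (intro nth_equalityI) (auto simp: permute_list_nth)
  have "form_ev p a v = (\<Sum>I | length I = p. ?f (permute_list \<tau> I))"
    unfolding form_ev_def
    by (rule sum.reindex_bij_witness[where i="permute_list \<tau>" and j="permute_list \<tau>"]) (auto simp: pl)
  also have "\<dots> = (\<Sum>I | length I = p. - ?f I)"
  proof (intro sum.cong refl)
    fix I :: "'a list" assume "I \<in> {I. length I = p}"
    then have I: "length I = p" by simp
    have "(\<Prod>r<p. v r $ (permute_list \<tau> I ! r)) = (\<Prod>r<p. v (\<tau> r) $ (I ! \<tau> r))"
    proof (intro prod.cong refl)
      fix r assume "r \<in> {..<p}"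
      moreover have "v (\<tau> r) = v r" using v by (auto simp: \<tau>_def Transposition.transpose_def)
      ultimately show "v r $ (permute_list \<tau> I ! r) = v (\<tau> r) $ (I ! \<tau> r)"
        using I \<tau> by (simp add: permute_list_nth)
    qed
    also have "\<dots> = (\<Prod>r<p. v r $ (I ! r))"
      by (rule prod.permute[OF \<tau>, symmetric, unfolded o_def])
    finally show "?f (permute_list \<tau> I) = - ?f I"
      using alt[OF I \<tau>] sg by simp
  qed
  also have "\<dots> = - form_ev p a v" by (simp add: form_ev_def sum_negf)
  finally show ?thesis by simp
qed

section \<open>Existence of a maximum on a compact manifold\<close>

text \<open>The differential of the transition map at x, acting on holomorphic tangent
  vectors.\<close>

definition jacobian_map :: "('m, 'n::finite) chart \<Rightarrow> ('m, 'n) chart \<Rightarrow> 'm \<Rightarrow> complex^'n \<Rightarrow> complex^'n" where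
  "jacobian_map c d x v = (\<chi> k. \<Sum>i\<in>UNIV. v $ i * dz i (\<lambda>z. transition c d z $ k) (snd c x))"

definition rayleigh :: "nat \<Rightarrow> 'n::finite lform \<Rightarrow> 'n lmetric \<Rightarrow> complex^'n \<Rightarrow> (nat \<Rightarrow> complex^'n) \<Rightarrow> real" where
  "rayleigh p a G z v = (norm (form_ev p (\<lambda>I. a z I []) v))\<^sup>2 / (\<Prod>s<p. Re (hform (G z) (v s) (v s)))"

lemma rayleigh_cong: "(\<And>s. s < p \<Longrightarrow> v s = w s) \<Longrightarrow> rayleigh p a G z v = rayleigh p a G z w"
  unfolding rayleigh_def using form_ev_cong[of p v w] by simp

text \<open>Homogeneity of degree 0 in each slot permits two normalizations: by the Euclidean norm,
  to obtain a compact set of tuples, and by g at the maximum point.\<close>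

lemma rayleigh_scale:
  assumes "\<And>s. s < p \<Longrightarrow> k s \<noteq> 0"
  shows "rayleigh p a G z (\<lambda>s. of_real (k s) *s v s) = rayleigh p a G z v"
proof -
  have "Re (hform (G z) (of_real (k s) *s v s) (of_real (k s) *s v s)) = (k s)\<^sup>2 * Re (hform (G z) (v s) (v s))" for s
    by (simp add: hform_scale_left hform_scale_right power2_eq_square)
  moreover have "(norm (\<Prod>s<p. complex_of_real (k s)))\<^sup>2 = (\<Prod>s<p. (k s)\<^sup>2)"
    by (simp add: prod_norm[symmetric] prod_power_distrib)
  moreover have "(\<Prod>s<p. (k s)\<^sup>2) \<noteq> 0" using assms by simp
  ultimately show ?thesis
    unfolding rayleigh_def form_ev_scale by (simp add: norm_mult power_mult_distrib prod.distrib)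
qed

locale compact_hermitian =
  fixes X :: "'m topology" and A :: "('m, 'n::finite) chart set" and g :: "('m, 'n) chart \<Rightarrow> 'n lmetric"
    and p :: nat and \<alpha> :: "('m, 'n) mform"
  assumes manifold: "complex_manifold X A" and compact: "compact_space X"
    and metric: "hermitian_metric A g" and form: "manifold_form A p 0 \<alpha>"
begin

abbreviation "ev c z \<equiv> form_ev p (\<lambda>I. \<alpha> c z I [])"
abbreviation "ray c \<equiv> rayleigh p (\<alpha> c) (g c)"

lemma chart:
  assumes "c \<in> A"
  shows "openin X (fst c)" "open (chart_image c)"
    "continuous_map (subtopology X (fst c)) (top_of_set (chart_image c)) (snd c)"
  using manifold assms unfolding complex_manifold_def homeomorphic_eq_everything_map by auto

lemma local_form_chart: "c \<in> A \<Longrightarrow> local_form (chart_image c) p 0 (\<alpha> c)"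
  using form by (auto simp: manifold_form_def)

lemma smooth_form: "c \<in> A \<Longrightarrow> smooth_on (chart_image c) (\<lambda>z. \<alpha> c z I [])"
  using local_form_chart by (auto simp: local_form_def)

lemma posdef_chart: "c \<in> A \<Longrightarrow> z \<in> chart_image c \<Longrightarrow> hermitian_posdef (g c z)"
  using metric by (auto simp: hermitian_metric_def)

lemma hermitian_domain_chart:
  assumes c: "c \<in> A"
  shows "hermitian_domain (chart_image c) (g c)"
proof
  show "open (chart_image c)" by (rule chart(2)[OF c])
  fix i j
  have "local_form (chart_image c) 1 1 (fundamental_form (chart_image c) (g c))"
    using metric c unfolding hermitian_metric_def manifold_form_def by (auto split: if_splits)
  then have "smooth_on (chart_image c) (\<lambda>z. (- \<i>) * fundamental_form (chart_image c) (g c) z [i] [j])"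
    by (intro smooth_on_mult smooth_on_const chart(2)[OF c]) (auto simp: local_form_def)
  then show "smooth_on (chart_image c) (\<lambda>z. g c z $ i $ j)"
    by (rule smooth_on_cong[OF chart(2)[OF c], rotated]) (simp add: fundamental_form_def)
qed (rule posdef_chart[OF c])

lemma form_ev_jacobian:
  assumes cd: "c \<in> A" "d \<in> A" and x: "x \<in> fst c" "x \<in> fst d"
  shows "ev c (snd c x) v = ev d (snd d x) (\<lambda>s. jacobian_map c d x (v s))"
proof -
  let ?D = "\<lambda>i k. dz i (\<lambda>z. transition c d z $ k) (snd c x)"
  have e: "\<alpha> c (snd c x) I [] = (\<Sum>K | length K = p. \<alpha> d (snd d x) K [] * (\<Prod>s<p. ?D (I ! s) (K ! s)))"
    if "length I = p" for I
  proof -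
    have "\<forall>I J. length I = p \<longrightarrow> length J = 0 \<longrightarrow> \<alpha> c (snd c x) I J =
       (\<Sum>K | length K = p. \<Sum>L | length L = 0. \<alpha> d (snd d x) K L
            * (\<Prod>s<p. dz (I ! s) (\<lambda>z. transition c d z $ (K ! s)) (snd c x))
            * (\<Prod>t<0. cnj (dz (J ! t) (\<lambda>z. transition c d z $ (L ! t)) (snd c x))))"
      using form cd x unfolding manifold_form_def by blast
    from this[rule_format, of I "[]"] that show ?thesis by simp
  qed
  have "ev c (snd c x) v
    = (\<Sum>I | length I = p. \<Sum>K | length K = p. \<alpha> d (snd d x) K [] * (\<Prod>s<p. v s $ (I ! s) * ?D (I ! s) (K ! s)))"
    unfolding form_ev_def by (intro sum.cong refl) (simp add: e sum_distrib_left sum_distrib_right prod.distrib mult_ac)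
  also have "\<dots> = (\<Sum>K | length K = p. \<alpha> d (snd d x) K [] * (\<Sum>I | length I = p. \<Prod>s<p. v s $ (I ! s) * ?D (I ! s) (K ! s)))"
    by (subst sum.swap) (simp add: sum_distrib_left)
  also have "\<dots> = (\<Sum>K | length K = p. \<alpha> d (snd d x) K [] * (\<Prod>s<p. \<Sum>i\<in>UNIV. v s $ i * ?D i (K ! s)))"
  proof (intro sum.cong refl)
    fix K :: "'n list"
    show "\<alpha> d (snd d x) K [] * (\<Sum>I | length I = p. \<Prod>s<p. v s $ (I ! s) * ?D (I ! s) (K ! s))
        = \<alpha> d (snd d x) K [] * (\<Prod>s<p. \<Sum>i\<in>UNIV. v s $ i * ?D i (K ! s))"
      using sum_lists_prod[where f="\<lambda>s i. v s $ i * ?D i (K ! s)" and p=p] by simp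
  qed
  finally show ?thesis by (simp add: form_ev_def jacobian_map_def)
qed

lemma hform_jacobian:
  assumes cd: "c \<in> A" "d \<in> A" and x: "x \<in> fst c" "x \<in> fst d"
  shows "hform (g c (snd c x)) u w = hform (g d (snd d x)) (jacobian_map c d x u) (jacobian_map c d x w)"
proof -
  let ?D = "\<lambda>i k. dz i (\<lambda>z. transition c d z $ k) (snd c x)"
  have im: "snd c x \<in> chart_image c" "snd d x \<in> chart_image d" using x by (auto simp: chart_image_def)
  have e: "g c (snd c x) $ i $ j = (\<Sum>k\<in>UNIV. \<Sum>l\<in>UNIV. g d (snd d x) $ k $ l * ?D i k * cnj (?D j l))" for i j
  proof -
    let ?om = "\<lambda>c. if c \<in> A then fundamental_form (chart_image c) (g c) else (\<lambda>z I J. 0)"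
    have "manifold_form A 1 1 ?om" using metric by (simp add: hermitian_metric_def)
    then have all: "\<forall>I J. length I = 1 \<longrightarrow> length J = 1 \<longrightarrow> ?om c (snd c x) I J =
       (\<Sum>K | length K = 1. \<Sum>L | length L = 1. ?om d (snd d x) K L
            * (\<Prod>s<1. dz (I ! s) (\<lambda>z. transition c d z $ (K ! s)) (snd c x))
            * (\<Prod>t<1. cnj (dz (J ! t) (\<lambda>z. transition c d z $ (L ! t)) (snd c x))))"
      using cd x unfolding manifold_form_def by blast
    have "\<i> * g c (snd c x) $ i $ j = (\<Sum>k\<in>UNIV. \<Sum>l\<in>UNIV. \<i> * g d (snd d x) $ k $ l * ?D i k * cnj (?D j l))"
      using all[rule_format, of "[i]" "[j]"] cd im by (simp add: sum_length_1 fundamental_form_def)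
    then have "\<i> * g c (snd c x) $ i $ j = \<i> * (\<Sum>k\<in>UNIV. \<Sum>l\<in>UNIV. g d (snd d x) $ k $ l * ?D i k * cnj (?D j l))"
      by (simp add: sum_distrib_left mult_ac)
    then show ?thesis by (simp only: mult_cancel_left) simp
  qed
  have pr: "(\<Sum>i\<in>UNIV. \<Sum>j\<in>UNIV. r * (a i * b j)) = r * ((\<Sum>i\<in>UNIV. a i) * (\<Sum>j\<in>UNIV. b j))"
    for r and a b :: "'n \<Rightarrow> complex"
    unfolding sum_product unfolding sum_distrib_left ..
  have "hform (g c (snd c x)) u w = (\<Sum>i\<in>UNIV. \<Sum>j\<in>UNIV. \<Sum>k\<in>UNIV. \<Sum>l\<in>UNIV.
      g d (snd d x) $ k $ l * ((u $ i * ?D i k) * cnj (w $ j * ?D j l)))"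
    unfolding hform_def e sum_distrib_right by (intro sum.cong refl) (simp add: mult_ac)
  also have "\<dots> = (\<Sum>k\<in>UNIV. \<Sum>l\<in>UNIV. \<Sum>i\<in>UNIV. \<Sum>j\<in>UNIV.
      g d (snd d x) $ k $ l * ((u $ i * ?D i k) * cnj (w $ j * ?D j l)))"
    by (rule sum_swap_pairs)
  also have "\<dots> = (\<Sum>k\<in>UNIV. \<Sum>l\<in>UNIV. g d (snd d x) $ k $ l * ((\<Sum>i\<in>UNIV. u $ i * ?D i k) * cnj (\<Sum>j\<in>UNIV. w $ j * ?D j l)))"
    unfolding pr cnj_sum ..
  finally show ?thesis by (simp add: hform_def jacobian_map_def mult_ac)
qed

text \<open>Chart independence is what makes maxima found in different charts comparable.\<close>

lemma rayleigh_jacobian: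
  assumes "c \<in> A" "d \<in> A" "x \<in> fst c" "x \<in> fst d"
  shows "ray c (snd c x) v = ray d (snd d x) (\<lambda>s. jacobian_map c d x (v s))"
  unfolding rayleigh_def form_ev_jacobian[OF assms] hform_jacobian[OF assms] ..

text \<open>The differential carries one local metric to the other, so it preserves lengths and is
  injective; the inverse transition map does not enter.\<close>

lemma jacobian_nonzero:
  assumes cd: "c \<in> A" "d \<in> A" and x: "x \<in> fst c" "x \<in> fst d" and v: "v \<noteq> 0"
  shows "jacobian_map c d x v \<noteq> 0"
proof
  assume "jacobian_map c d x v = 0"
  then have "hform (g c (snd c x)) v v = 0" using hform_jacobian[OF cd x, of v v] by (simp add: hform_zero)
  moreover have "Re (hform (g c (snd c x)) v v) > 0"
    by (rule hermitian_posdefD(2)[OF posdef_chart[OF cd(1)] v]) (use x in \<open>auto simp: chart_image_def\<close>)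
  ultimately show False by simp
qed

lemma rayleigh_max_compact:
  assumes c: "c \<in> A" and K: "compact K" "K \<noteq> {}" "K \<subseteq> chart_image c" and p: "p \<le> CARD('n)"
  obtains z1 v1 where "z1 \<in> K" "\<And>s. s < p \<Longrightarrow> v1 s \<noteq> 0"
    "\<And>z v. z \<in> K \<Longrightarrow> (\<And>s. s < p \<Longrightarrow> v s \<noteq> 0) \<Longrightarrow> ray c z v \<le> ray c z1 v1"
proof -
  interpret hermitian_domain "chart_image c" "g c" by (rule hermitian_domain_chart[OF c])
  \<comment> \<open>As p is at most n, the p vectors can be stored as rows of an n by n matrix, with
    \<open>idx\<close> assigning rows to slots. Tuples of unit vectors then range over a compact
    subset N of a Euclidean space.\<close>
  obtain idx :: "nat \<Rightarrow> 'n" where "bij_betw idx {0..<CARD('n)} UNIV"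
    using ex_bij_betw_nat_finite[of "UNIV :: 'n set"] by auto
  then have idx: "inj_on idx {..<p}"
    using p by (auto simp: bij_betw_def intro: inj_on_subset)
  define N where "N = {V :: complex^'n^'n. \<forall>a. norm (V $ a) = 1}"
  have "compact N"
  proof -
    have "bounded N"
    proof (rule boundedI)
      fix V assume "V \<in> N"
      then have "(\<Sum>a\<in>UNIV. norm (V $ a)) = CARD('n)" by (simp add: N_def)
      then show "norm V \<le> CARD('n)"
        using L2_set_le_sum[of UNIV "\<lambda>a. norm (V $ a)"] norm_vec_def[of V] by simp
    qed
    moreover have "closed N" unfolding N_def
      by (intro closed_Collect_all closed_Collect_eq continuous_intros)
    ultimately show ?thesis by (simp add: compact_eq_bounded_closed)
  qed
  moreover have "(\<chi> a. axis a 1) \<in> N" by (simp add: N_def)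
  ultimately have KN: "compact (K \<times> N)" "K \<times> N \<noteq> {}" using K by (auto intro: compact_Times)
  let ?f = "\<lambda>q. ray c (fst q) (\<lambda>s. snd q $ idx s)"
  have N0: "V $ a \<noteq> 0" if "V \<in> N" for V a using that unfolding N_def by (metis (mono_tags) mem_Collect_eq norm_zero zero_neq_one)
  have ca: "continuous_on (K \<times> N) (\<lambda>q. \<alpha> c (fst q) I [])" for I
    by (rule continuous_on_compose2[OF smooth_on_continuous[OF smooth_form[OF c]]])
       (use K in \<open>auto intro!: continuous_intros\<close>)
  have cg: "continuous_on (K \<times> N) (\<lambda>q. g c (fst q) $ i $ j)" for i j
    by (rule continuous_on_compose2[OF smooth_on_continuous[OF smooth_G]])
       (use K in \<open>auto intro!: continuous_intros\<close>)
  have nz: "(\<Prod>s<p. Re (hform (g c (fst q)) (snd q $ idx s) (snd q $ idx s))) \<noteq> 0" if "q \<in> K \<times> N" for q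
  proof -
    have "Re (hform (g c (fst q)) (snd q $ idx s) (snd q $ idx s)) > 0" for s
      by (rule hermitian_posdefD(2)[OF posdef]) (use that K N0 in auto)
    then show ?thesis by (simp add: less_imp_neq[symmetric])
  qed
  have cont: "continuous_on (K \<times> N) ?f"
    unfolding rayleigh_def
  proof (rule continuous_on_divide)
    show "continuous_on (K \<times> N) (\<lambda>q. (norm (form_ev p (\<lambda>I. \<alpha> c (fst q) I []) (\<lambda>s. snd q $ idx s)))\<^sup>2)"
      unfolding form_ev_def by (intro continuous_intros ca)
    show "continuous_on (K \<times> N) (\<lambda>q. \<Prod>s<p. Re (hform (g c (fst q)) (snd q $ idx s) (snd q $ idx s)))"
      unfolding hform_def by (intro continuous_intros cg)
  qed (use nz in auto)
  obtain q1 where q1: "q1 \<in> K \<times> N" "\<And>q. q \<in> K \<times> N \<Longrightarrow> ?f q \<le> ?f q1"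
    using continuous_attains_sup[OF KN cont] by blast
  show ?thesis
  proof (rule that[of "fst q1" "\<lambda>s. snd q1 $ idx s"])
    show "fst q1 \<in> K" using q1 by auto
    show "snd q1 $ idx s \<noteq> 0" for s using q1 N0 by auto
    fix z and v :: "nat \<Rightarrow> complex^'n" assume z: "z \<in> K" and v: "\<And>s. s < p \<Longrightarrow> v s \<noteq> 0"
    define w where "w s = of_real (1 / norm (v s)) *s v s" for s
    have w1: "norm (w s) = 1" if "s < p" for s
    proof -
      have "w s = (1 / norm (v s)) *\<^sub>R v s"
        unfolding w_def by (simp add: vec_eq_iff complex_eq_iff)
      then show ?thesis using v[OF that] by simp
    qed
    \<comment> \<open>Rows that belong to no slot are filled with coordinate vectors, so that every
      row has norm 1 and V lies in N.\<close>
    define V where "V = (\<chi> a. if a \<in> idx ` {..<p} then w (inv_into {..<p} idx a) else axis a 1)"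
    have Vw: "V $ idx s = w s" if "s < p" for s using that idx by (simp add: V_def)
    have "norm (V $ a) = 1" for a
      using w1[of "inv_into {..<p} idx a"] inv_into_into[of a idx "{..<p}"] by (auto simp: V_def)
    then have "(z, V) \<in> K \<times> N" using z by (simp add: N_def)
    from q1(2)[OF this] have "ray c z (\<lambda>s. V $ idx s) \<le> ?f q1" by simp
    moreover have "ray c z (\<lambda>s. V $ idx s) = ray c z w"
      by (rule rayleigh_cong) (rule Vw)
    moreover have "ray c z w = ray c z v"
      unfolding w_def by (rule rayleigh_scale) (use v in simp)
    ultimately show "ray c z v \<le> ?f q1" by simp
  qed
qed

text \<open>Finitely many open coordinate balls cover the manifold. Maxima are taken over their
  closures, which are compact and stay inside the chart images; the largest of these finitely many
  maxima is global.\<close>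

lemma rayleigh_max:
  assumes p: "p \<le> CARD('n)" and ne: "topspace X \<noteq> {}"
  obtains c0 z0 v0 where "c0 \<in> A" "z0 \<in> chart_image c0" "\<And>s. s < p \<Longrightarrow> v0 s \<noteq> 0"
    "\<And>c z v. c \<in> A \<Longrightarrow> z \<in> chart_image c \<Longrightarrow> (\<And>s. s < p \<Longrightarrow> v s \<noteq> 0) \<Longrightarrow>
      ray c z v \<le> ray c0 z0 v0"
proof -
  have "\<forall>x\<in>topspace X. \<exists>c r. c \<in> A \<and> x \<in> fst c \<and> r > 0 \<and> cball (snd c x) r \<subseteq> chart_image c"
  proof
    fix x assume "x \<in> topspace X"
    then obtain c where c: "c \<in> A" "x \<in> fst c" using manifold unfolding complex_manifold_def by blast
    then obtain r where "r > 0" "cball (snd c x) r \<subseteq> chart_image c"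
      using chart(2)[OF c(1)] open_contains_cball[of "chart_image c"] by (auto simp: chart_image_def)
    then show "\<exists>c r. c \<in> A \<and> x \<in> fst c \<and> r > 0 \<and> cball (snd c x) r \<subseteq> chart_image c" using c by blast
  qed
  then obtain C r where C: "\<And>x. x \<in> topspace X \<Longrightarrow> C x \<in> A" "\<And>x. x \<in> topspace X \<Longrightarrow> x \<in> fst (C x)"
    "\<And>x. x \<in> topspace X \<Longrightarrow> r x > 0" "\<And>x. x \<in> topspace X \<Longrightarrow> cball (snd (C x) x) (r x) \<subseteq> chart_image (C x)"
    by metis
  define U where "U x = {y \<in> fst (C x). snd (C x) y \<in> ball (snd (C x) x) (r x)}" for x
  have U: "openin X (U x)" if x: "x \<in> topspace X" for x
  proof -
    have fc: "fst (C x) \<subseteq> topspace X" using chart(1)[OF C(1)[OF x]] openin_subset by blast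
    have "openin (top_of_set (chart_image (C x))) (chart_image (C x) \<inter> ball (snd (C x) x) (r x))"
      by (rule openin_open_Int) simp
    from openin_continuous_map_preimage[OF chart(3)[OF C(1)[OF x]] this]
    have "openin (subtopology X (fst (C x))) {y \<in> topspace (subtopology X (fst (C x))). snd (C x) y \<in> chart_image (C x) \<inter> ball (snd (C x) x) (r x)}" .
    moreover have "{y \<in> topspace (subtopology X (fst (C x))). snd (C x) y \<in> chart_image (C x) \<inter> ball (snd (C x) x) (r x)} = U x"
      using fc by (auto simp: U_def chart_image_def)
    ultimately show ?thesis using openin_open_subtopology[OF chart(1)[OF C(1)[OF x]]] by auto
  qed
  have xU: "x \<in> U x" if "x \<in> topspace X" for x using C[OF that] by (simp add: U_def)
  have "compactin X (topspace X)" using compact by (simp add: compact_space_def)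
  then have "\<exists>\<F>. finite \<F> \<and> \<F> \<subseteq> U ` topspace X \<and> topspace X \<subseteq> \<Union>\<F>"
    unfolding compactin_def using U xU by (elim conjE allE[of _ "U ` topspace X"]) blast
  then obtain F where F: "finite F" "F \<subseteq> topspace X" "topspace X \<subseteq> (\<Union>x\<in>F. U x)"
    by (metis finite_subset_image)
  have "\<forall>x\<in>F. \<exists>z1 v1. z1 \<in> cball (snd (C x) x) (r x) \<and> (\<forall>s<p. v1 s \<noteq> 0) \<and>
    (\<forall>z v. z \<in> cball (snd (C x) x) (r x) \<longrightarrow> (\<forall>s<p. v s \<noteq> 0) \<longrightarrow>
       ray (C x) z v \<le> ray (C x) z1 v1)"
  proof
    fix x assume "x \<in> F"
    then have x: "x \<in> topspace X" using F by blast
    have ne: "cball (snd (C x) x) (r x) \<noteq> {}" using C(3)[OF x] by simp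
    show "\<exists>z1 v1. z1 \<in> cball (snd (C x) x) (r x) \<and> (\<forall>s<p. v1 s \<noteq> 0) \<and>
      (\<forall>z v. z \<in> cball (snd (C x) x) (r x) \<longrightarrow> (\<forall>s<p. v s \<noteq> 0) \<longrightarrow>
       ray (C x) z v \<le> ray (C x) z1 v1)"
      by (rule rayleigh_max_compact[OF C(1)[OF x] compact_cball ne C(4)[OF x] p]) blast
  qed
  then obtain Z V where ZV: "\<And>x. x \<in> F \<Longrightarrow> Z x \<in> cball (snd (C x) x) (r x)" "\<And>x s. x \<in> F \<Longrightarrow> s < p \<Longrightarrow> V x s \<noteq> 0"
    "\<And>x z v. x \<in> F \<Longrightarrow> z \<in> cball (snd (C x) x) (r x) \<Longrightarrow> (\<And>s. s < p \<Longrightarrow> v s \<noteq> 0) \<Longrightarrow>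
       ray (C x) z v \<le> ray (C x) (Z x) (V x)"
    by metis
  define q where "q x = ray (C x) (Z x) (V x)" for x
  have Fne: "F \<noteq> {}" using F ne by auto
  then have "Max (q ` F) \<in> q ` F" using F(1) by (intro Max_in) auto
  then obtain x0 where x0: "x0 \<in> F" "q x0 = Max (q ` F)" by auto
  have q: "q x \<le> q x0" if "x \<in> F" for x using that F(1) x0 by simp
  have x0X: "x0 \<in> topspace X" using x0 F by blast
  show ?thesis
  proof (rule that[of "C x0" "Z x0" "V x0"])
    show "C x0 \<in> A" by (rule C(1)[OF x0X])
    show "Z x0 \<in> chart_image (C x0)" using ZV(1)[OF x0(1)] C(4)[OF x0X] by blast
    show "V x0 s \<noteq> 0" if "s < p" for s by (rule ZV(2)[OF x0(1) that])
    fix c z and v :: "nat \<Rightarrow> complex^'n" assume c: "c \<in> A" and z: "z \<in> chart_image c" and v: "\<And>s. s < p \<Longrightarrow> v s \<noteq> 0"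
    obtain y where y: "y \<in> fst c" "z = snd c y" using z by (auto simp: chart_image_def)
    have "y \<in> topspace X" using chart(1)[OF c] y openin_subset by blast
    then obtain x where x: "x \<in> F" "y \<in> U x" using F by blast
    then have yx: "y \<in> fst (C x)" "snd (C x) y \<in> cball (snd (C x) x) (r x)" by (auto simp: U_def)
    have Cx: "C x \<in> A" using x F C by blast
    \<comment> \<open>A point of an arbitrary chart is moved into the chart of a ball that contains
      it, and its vectors are carried along by the differential.\<close>
    have "ray c z v = ray (C x) (snd (C x) y) (\<lambda>s. jacobian_map c (C x) y (v s))"
      unfolding y(2) by (rule rayleigh_jacobian[OF c Cx y(1) yx(1)])
    also have "\<dots> \<le> q x" unfolding q_def
      by (rule ZV(3)[OF x(1) yx(2)]) (rule jacobian_nonzero[OF c Cx y(1) yx(1) v])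
    also have "\<dots> \<le> q x0" by (rule q[OF x(1)])
    finally show "ray c z v \<le> ray (C x0) (Z x0) (V x0)"
      by (simp add: q_def)
  qed
qed

section \<open>Vanishing\<close>

text \<open>Rescaling the maximizing vectors to g-length 1 makes the denominator of the quotient 1,
  so m becomes the squared value of the form.\<close>

lemma normalized_max:
  assumes p: "p \<le> CARD('n)" and nz: "\<alpha> \<noteq> (\<lambda>c z I J. 0)"
  obtains c0 z0 v m where "c0 \<in> A" "z0 \<in> chart_image c0" "m > 0"
    "\<And>s. s < p \<Longrightarrow> hform (g c0 z0) (v s) (v s) = 1"
    "(norm (ev c0 z0 v))\<^sup>2 = m"
    "\<And>z w. z \<in> chart_image c0 \<Longrightarrow>
      (norm (ev c0 z w))\<^sup>2 \<le> m * (\<Prod>s<p. Re (hform (g c0 z) (w s) (w s)))"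
proof -
  have pos: "Re (hform (g c z) u u) > 0" if "c \<in> A" "z \<in> chart_image c" "u \<noteq> 0" for c z u
    by (rule hermitian_posdefD(2)[OF posdef_chart[OF that(1,2)] that(3)])
  obtain c z I J where a: "\<alpha> c z I J \<noteq> 0" using nz by (auto simp: fun_eq_iff)
  then have c: "c \<in> A" using form unfolding manifold_form_def by metis
  have "z \<notin> chart_image c \<or> length I \<noteq> p \<or> length J \<noteq> 0 \<longrightarrow> \<alpha> c z I J = 0"
    using local_form_chart[OF c] unfolding local_form_def by blast
  then have z: "z \<in> chart_image c" and I: "length I = p" and J: "J = []"
    using a by auto
  obtain x where x: "x \<in> fst c" "z = snd c x" using z by (auto simp: chart_image_def)
  have "topspace X \<noteq> {}" using x chart(1)[OF c] openin_subset by blast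
  then obtain c0 z0 v0 where 0: "c0 \<in> A" "z0 \<in> chart_image c0" "\<And>s. s < p \<Longrightarrow> v0 s \<noteq> 0"
    "\<And>c z v. c \<in> A \<Longrightarrow> z \<in> chart_image c \<Longrightarrow> (\<And>s. s < p \<Longrightarrow> v s \<noteq> 0) \<Longrightarrow>
      ray c z v \<le> ray c0 z0 v0"
    by (rule rayleigh_max[OF p]) blast
  define m where "m = ray c0 z0 v0"
  define k where "k s = 1 / sqrt (Re (hform (g c0 z0) (v0 s) (v0 s)))" for s
  define v where "v s = of_real (k s) *s v0 s" for s
  have k: "k s \<noteq> 0" if "s < p" for s
    using pos[OF 0(1,2) 0(3)[OF that]] by (simp add: k_def)
  have unit: "hform (g c0 z0) (v s) (v s) = 1" if "s < p" for s
  proof -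
    let ?r = "Re (hform (g c0 z0) (v0 s) (v0 s))"
    have r: "?r > 0" by (rule pos[OF 0(1,2) 0(3)[OF that]])
    have "hform (g c0 z0) (v s) (v s) = of_real (k s * k s * ?r)"
      unfolding v_def hform_scale_left hform_scale_right of_real_mult
      using hform_real[OF posdef_chart[OF 0(1,2)], of "v0 s"] by simp
    moreover have "k s * k s * ?r = 1" using r by (simp add: k_def)
    ultimately show ?thesis by simp
  qed
  have mv: "(norm (ev c0 z0 v))\<^sup>2 = m"
  proof -
    have "m = ray c0 z0 v"
      unfolding m_def v_def by (rule rayleigh_scale[symmetric]) (rule k)
    then show ?thesis by (simp add: rayleigh_def unit)
  qed
  \<comment> \<open>Some coefficient of \<alpha> is nonzero, and the coordinate vectors of its index
    list give a positive quotient.\<close>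
  have "m > 0"
  proof -
    have "ray c z (\<lambda>s. axis (I ! s) 1) \<le> m"
      unfolding m_def by (rule 0(4)[OF c z]) simp
    moreover have "(\<Prod>s<p. Re (hform (g c z) (axis (I ! s) 1) (axis (I ! s) 1))) > 0"
      by (intro prod_pos pos c z ballI) simp
    then have "ray c z (\<lambda>s. axis (I ! s) 1) > 0"
      using a J by (simp add: rayleigh_def form_ev_axis[OF I])
    ultimately show ?thesis by simp
  qed
  moreover have "(norm (ev c0 z w))\<^sup>2 \<le> m * (\<Prod>s<p. Re (hform (g c0 z) (w s) (w s)))"
    if z: "z \<in> chart_image c0" for z w
  proof (cases "\<forall>s<p. w s \<noteq> 0")
    case True
    then have "ray c0 z w \<le> m" unfolding m_def by (intro 0(4)[OF 0(1) z]) auto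
    moreover have "(\<Prod>s<p. Re (hform (g c0 z) (w s) (w s))) > 0"
      using True by (intro prod_pos pos 0(1) z ballI) auto
    ultimately show ?thesis by (simp add: rayleigh_def pos_divide_le_eq)
  next
    \<comment> \<open>Zero vectors must be allowed, because a parallel extension may vanish away
      from its base point; both sides are then 0.\<close>
    case False
    then obtain s where s: "s < p" "w s = 0" by auto
    then have 0: "(\<Prod>s<p. Re (hform (g c0 z) (w s) (w s))) = 0"
      by (intro prod_zero) (auto simp: hform_zero intro!: bexI[of _ s])
    show ?thesis unfolding 0 form_ev_zero[of s p w, OF s] by simp
  qed
  ultimately show ?thesis by (intro that[OF 0(1,2) _ unit mv]) auto
qed

lemma form_ev_alternating:
  assumes c: "c \<in> A" and st: "s < p" "t < p" "s \<noteq> t" and v: "v s = v t"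
  shows "ev c z v = 0"
  by (rule form_ev_repeat[OF _ st v]) (use local_form_chart[OF c] in \<open>auto simp: local_form_def\<close>)

text \<open>Subtracting the component of \<open>v s\<close> along \<open>v t\<close> does not change the value of an alternating
  form but shortens \<open>v s\<close>.\<close>

lemma max_orthogonal:
  assumes c: "c \<in> A" and z: "z \<in> chart_image c" and m: "m > 0"
    and unit: "\<And>s. s < p \<Longrightarrow> hform (g c z) (v s) (v s) = 1"
    and eq: "(norm (ev c z v))\<^sup>2 = m"
    and le: "\<And>w. (norm (ev c z w))\<^sup>2 \<le> m * (\<Prod>s<p. Re (hform (g c z) (w s) (w s)))"
    and st: "s < p" "t < p" "s \<noteq> t"
  shows "hform (g c z) (v s) (v t) = 0"
proof -
  let ?P = "g c z"
  let ?k = "hform ?P (v s) (v t)"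
  have P: "hermitian_posdef ?P" by (rule posdef_chart[OF c z])
  define w where "w = v(s := v s - ?k *s v t)"
  have "ev c z w = ev c z v"
    unfolding w_def form_ev_diff_slot[OF st(1)]
    using form_ev_alternating[OF c st, of "v(s := v t)" z] st by simp
  then have "m \<le> m * (\<Prod>r<p. Re (hform ?P (w r) (w r)))" using le[of w] eq by simp
  also have "(\<Prod>r<p. Re (hform ?P (w r) (w r))) = Re (hform ?P (w s) (w s)) * (\<Prod>r\<in>{..<p}-{s}. Re (hform ?P (w r) (w r)))"
    using st by (intro prod.remove) auto
  also have "(\<Prod>r\<in>{..<p}-{s}. Re (hform ?P (w r) (w r))) = 1"
    by (rule prod.neutral) (auto simp: w_def unit)
  finally have "Re (hform ?P (w s) (w s)) \<ge> 1" using m by simp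
  moreover have "hform ?P (w s) (w s) = 1 - ?k * cnj ?k"
  proof -
    have ws: "hform ?P (w s) y = hform ?P (v s) y - ?k * hform ?P (v t) y" for y
      by (simp add: w_def hform_diff_left hform_scale_left)
    have "hform ?P (v s) (w s) = cnj (hform ?P (w s) (v s))" by (rule hform_hermitian[OF P])
    moreover have "hform ?P (v t) (w s) = cnj (hform ?P (w s) (v t))" by (rule hform_hermitian[OF P])
    moreover have "hform ?P (v t) (v s) = cnj ?k" by (rule hform_hermitian[OF P])
    ultimately show ?thesis
      using ws[of "w s"] ws[of "v s"] ws[of "v t"] by (simp add: unit st)
  qed
  ultimately have "(norm ?k)\<^sup>2 \<le> 0"
    by (simp add: complex_mult_cnj cmod_power2)
  then show ?thesis by simp
qed

lemma bismut_ricci_sum_nonpos: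
  assumes pc: "pluriclosed A g" and hol: "manifold_delbar A \<alpha> = (\<lambda>c z I J. 0)"
    and c: "c \<in> A" and z: "z \<in> chart_image c" and m: "m > 0"
    and unit: "\<And>s. s < p \<Longrightarrow> hform (g c z) (v s) (v s) = 1"
    and eq: "(norm (ev c z v))\<^sup>2 = m"
    and le: "\<And>x w. x \<in> chart_image c \<Longrightarrow>
      (norm (ev c x w))\<^sup>2 \<le> m * (\<Prod>s<p. Re (hform (g c x) (w s) (w s)))"
  shows "(\<Sum>s<p. Re (hform (bismut_ricci_matrix (chart_image c) (g c) z) (v s) (v s))) \<le> 0"
proof -
  interpret hermitian_domain "chart_image c" "g c" by (rule hermitian_domain_chart[OF c])
  \<comment> \<open>Holomorphic, because the coefficients of \<alpha> and the components of the
    parallel extensions are.\<close>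
  define \<Phi> where "\<Phi> x = ev c x (\<lambda>s. parallel_ext z (v s) x)" for x
  have da: "(\<lambda>x. \<alpha> c x I []) differentiable (at x)" if "x \<in> chart_image c" for I x
    by (rule smooth_on_differentiable[OF smooth_form[OF c] that])
  have dP: "(\<lambda>x. \<Prod>s<p. parallel_ext z (v s) x $ (I ! s)) differentiable (at x)" for I x
    by (rule smooth_on_differentiable[OF smooth_on_prod[OF open_UNIV smooth_parallel_ext[OF open_UNIV]]]) simp
  show ?thesis
  proof (rule bochner_at_max[OF z _ _ _ _ _ _ _ m])
    show "hG z i j l k - hG z i k l j - hG z l j i k + hG z l k i j = 0" for i j k l
      by (rule pluriclosed_components[OF z]) (use pc c z in \<open>auto simp: pluriclosed_def\<close>)
    show "smooth_on (chart_image c) \<Phi>"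
      unfolding \<Phi>_def[abs_def] form_ev_def
      by (intro smooth_on_sum smooth_on_mult smooth_on_prod smooth_parallel_ext smooth_form c open_W)
    show "wdzbar l \<Phi> x = 0" if x: "x \<in> chart_image c" for x l
    proof -
      have a0: "wdzbar l (\<lambda>x. \<alpha> c x I []) x = 0" for I
      proof -
        have "manifold_delbar A \<alpha> c x I [l] = 0" using hol by simp
        then show ?thesis using c x by (simp add: manifold_delbar_def delbar_def remove_nth_def dzbar_wirt)
      qed
      have P0: "wdzbar l (\<lambda>x. \<Prod>s<p. parallel_ext z (v s) x $ (I ! s)) x = 0" for I
        by (subst wirt_prod) (auto intro: diff_ext simp: wirt_parallel_ext_dbar)
      have "wdzbar l \<Phi> x = (\<Sum>I | length I = p. wdzbar l (\<lambda>x. \<alpha> c x I [] * (\<Prod>s<p. parallel_ext z (v s) x $ (I ! s))) x)"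
        unfolding \<Phi>_def[abs_def] form_ev_def
        by (rule wirt_sum) (intro differentiable_mult da[OF x] dP)
      then show ?thesis by (simp add: wirt_mult[OF da[OF x] dP] a0 P0)
    qed
    show "(norm (\<Phi> x))\<^sup>2 \<le> m * (\<Prod>s<p. Re (sqn z (v s) x))" if "x \<in> chart_image c" for x
      unfolding \<Phi>_def sqn_def by (rule le[OF that])
    show "(norm (\<Phi> z))\<^sup>2 = m" using eq by (simp add: \<Phi>_def parallel_ext_base)
  qed (auto simp: unit)
qed

end

section \<open>Scalar curvature in a frame, triviality of cohomology, and the conclusion\<close>

lemma bismut_scalar_frame:
  fixes e :: "'n::finite \<Rightarrow> complex^'n"
  assumes P: "hermitian_posdef (G z)" and e: "\<And>a b. hform (G z) (e a) (e b) = (if a = b then 1 else 0)"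
  shows "bismut_scalar W G z = (\<Sum>a\<in>UNIV. Re (hform (bismut_ricci_matrix W G z) (e a) (e a)))"
proof -
  let ?R = "bismut_ricci_matrix W G z"
  have "(\<Sum>i\<in>UNIV. \<Sum>j\<in>UNIV. matrix_inv (G z) $ j $ i * ?R $ i $ j)
    = (\<Sum>i\<in>UNIV. \<Sum>j\<in>UNIV. \<Sum>a\<in>UNIV. ?R $ i $ j * e a $ i * cnj (e a $ j))"
    unfolding matrix_inv_frame_component[OF P e]
    by (simp add: sum_distrib_left sum_distrib_right mult_ac)
  also have "\<dots> = (\<Sum>a\<in>UNIV. hform ?R (e a) (e a))"
    unfolding hform_def by (rule sum_rotate3[symmetric])
  finally show ?thesis by (simp add: bismut_scalar_def)
qed

lemma zero_dolbeault_closed: "(\<lambda>c z I J. 0) \<in> dolbeault_closed (A :: ('m, 'n::finite) chart set) p 0"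
proof -
  have "local_form W p 0 (\<lambda>z I J. 0)" for W :: "(complex^'n) set"
    by (simp add: local_form_def smooth_on_const)
  moreover have "manifold_delbar A (\<lambda>c z I J. 0) = (\<lambda>c z I J. 0)"
    by (simp add: manifold_delbar_def delbar_def dzbar_wirt wirt_const fun_eq_iff)
  ultimately show ?thesis by (simp add: dolbeault_closed_def manifold_form_def)
qed

text \<open>For q = 0 only the zero form is exact, so classes are single closed forms and it
  suffices that 0 is the only one.\<close>

lemma dolbeault_trivialI:
  assumes "\<And>\<alpha>. \<alpha> \<in> dolbeault_closed A p 0 \<Longrightarrow> \<alpha> = (\<lambda>c z I J. 0)"
  shows "dolbeault_trivial A p 0"
proof -
  have "dolbeault_closed A p 0 = {\<lambda>c z I J. 0}" using assms zero_dolbeault_closed by blast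
  then show ?thesis by (simp add: dolbeault_trivial_def dolbeault_cohomology_def quotient_def)
qed

theorem theorem4p10:
  fixes X :: "'m topology"
    and A :: "('m, 'n::finite) chart set"
    and g :: "('m, 'n) chart \<Rightarrow> 'n lmetric"
  assumes "complex_manifold X A"
    and "compact_space X"
    and "hermitian_metric A g"
    and "pluriclosed A g"
  shows "(bismut_ricci_positive A g \<longrightarrow>
            (\<forall>p. 1 \<le> p \<and> p \<le> CARD('n) \<longrightarrow> dolbeault_trivial A p 0)) \<and>
         (bismut_scalar_positive A g \<longrightarrow> dolbeault_trivial A (CARD('n)) 0)"
proof (intro conjI impI allI)
  fix p assume ricci: "bismut_ricci_positive A g" and p: "1 \<le> p \<and> p \<le> CARD('n)"
  show "dolbeault_trivial A p 0"
  proof (rule dolbeault_trivialI, rule ccontr)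
    fix \<alpha> assume \<alpha>: "\<alpha> \<in> dolbeault_closed A p 0" and nz: "\<alpha> \<noteq> (\<lambda>c z I J. 0)"
    interpret compact_hermitian X A g p \<alpha>
      by unfold_locales (use assms \<alpha> in \<open>auto simp: dolbeault_closed_def\<close>)
    have hol: "manifold_delbar A \<alpha> = (\<lambda>c z I J. 0)" using \<alpha> by (simp add: dolbeault_closed_def)
    obtain c z v m where *: "c \<in> A" "z \<in> chart_image c" "m > 0"
      "\<And>s. s < p \<Longrightarrow> hform (g c z) (v s) (v s) = 1"
      "(norm (form_ev p (\<lambda>I. \<alpha> c z I []) v))\<^sup>2 = m"
      "\<And>x w. x \<in> chart_image c \<Longrightarrow>
        (norm (form_ev p (\<lambda>I. \<alpha> c x I []) w))\<^sup>2 \<le> m * (\<Prod>s<p. Re (hform (g c x) (w s) (w s)))"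
      by (rule normalized_max[OF conjunct2[OF p] nz]) blast
    have "Re (hform (bismut_ricci_matrix (chart_image c) (g c) z) (v s) (v s)) > 0" if "s < p" for s
    proof (rule hermitian_posdefD(2))
      show "hermitian_posdef (bismut_ricci_matrix (chart_image c) (g c) z)"
        using ricci *(1,2) by (auto simp: bismut_ricci_positive_def)
      show "v s \<noteq> 0" using *(4)[OF that] by (auto simp: hform_zero)
    qed
    \<comment> \<open>Strictness needs a nonempty sum, hence 1 \<le> p; for p = 0 the sum is empty,
      in accordance with the nonzero constant functions in that degree.\<close>
    then have "(\<Sum>s<p. Re (hform (bismut_ricci_matrix (chart_image c) (g c) z) (v s) (v s))) > 0"
      using p by (intro sum_pos) (auto simp: lessThan_empty_iff)
    with bismut_ricci_sum_nonpos[OF assms(4) hol *] show False by simp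
  qed
next
  assume scalar: "bismut_scalar_positive A g"
  let ?n = "CARD('n)"
  show "dolbeault_trivial A ?n 0"
  proof (rule dolbeault_trivialI, rule ccontr)
    fix \<alpha> assume \<alpha>: "\<alpha> \<in> dolbeault_closed A ?n 0" and nz: "\<alpha> \<noteq> (\<lambda>c z I J. 0)"
    interpret compact_hermitian X A g ?n \<alpha>
      by unfold_locales (use assms \<alpha> in \<open>auto simp: dolbeault_closed_def\<close>)
    have hol: "manifold_delbar A \<alpha> = (\<lambda>c z I J. 0)" using \<alpha> by (simp add: dolbeault_closed_def)
    obtain c z v m where *: "c \<in> A" "z \<in> chart_image c" "m > 0"
      "\<And>s. s < ?n \<Longrightarrow> hform (g c z) (v s) (v s) = 1"
      "(norm (form_ev ?n (\<lambda>I. \<alpha> c z I []) v))\<^sup>2 = m"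
      "\<And>x w. x \<in> chart_image c \<Longrightarrow>
        (norm (form_ev ?n (\<lambda>I. \<alpha> c x I []) w))\<^sup>2 \<le> m * (\<Prod>s<?n. Re (hform (g c x) (w s) (w s)))"
      by (rule normalized_max[OF order_refl nz]) blast
    let ?R = "bismut_ricci_matrix (chart_image c) (g c) z"
    \<comment> \<open>For p = n there are as many slots as coordinates, so \<open>idx\<close> turns
      the mutually orthogonal unit vectors into an orthonormal frame, over which the scalar
      curvature is the trace of the Ricci matrix.\<close>
    obtain idx :: "'n \<Rightarrow> nat" where idx: "bij_betw idx UNIV {..<?n}"
      using ex_bij_betw_finite_nat[of "UNIV :: 'n set"] by (auto simp: atLeast0LessThan)
    have lt: "idx a < ?n" for a using idx by (auto simp: bij_betw_def)
    have inj: "idx a = idx b \<longleftrightarrow> a = b" for a b using idx by (auto simp: bij_betw_def inj_on_def)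
    have "bismut_scalar (chart_image c) (g c) z = (\<Sum>a\<in>UNIV. Re (hform ?R (v (idx a)) (v (idx a))))"
    proof (rule bismut_scalar_frame)
      show "hermitian_posdef (g c z)" by (rule posdef_chart[OF *(1,2)])
      show "hform (g c z) (v (idx a)) (v (idx b)) = (if a = b then 1 else 0)" for a b
        using *(4)[OF lt] max_orthogonal[OF *(1-5) *(6)[OF *(2)] lt[of a] lt[of b]] inj by auto
    qed
    also have "\<dots> = (\<Sum>s<?n. Re (hform ?R (v s) (v s)))"
      by (rule sum.reindex_bij_betw[OF idx])
    also have "\<dots> \<le> 0" by (rule bismut_ricci_sum_nonpos[OF assms(4) hol *])
    finally show False using scalar *(1,2) by (auto simp: bismut_scalar_positive_def not_le[symmetric])
  qed
qed

end
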